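(* Let $K$ be a field, let $(P,L)$ be a linear space with $\#P\ge 2$, and let $\Lambda$ be its incidence complex. For each integer $k$ let $L_k$ denote the number of lines in $L$ with exactly $k$ points. Then, for each integer $i \ge 1$, one has $\beta_i(K[\Lambda]) = \beta_{i,i+2}(K[\Lambda])$ and $$\beta_{i}(K[\Lambda]) = \sum_{k\ge 1}\binom{\#P-k}{i+2}L_k-\binom{\#P}{i+2}\bigl[-1+\#L\bigr]+\binom{\#P-1}{i+1}\Bigl[-\#P+\sum_{k\ge 2}k\,L_k\Bigr]-\binom{\#P-2}{i}\Bigl[-\binom{\#P}{2}+\sum_{k\ge 2}\binom{k}{2}L_k\Bigr].$$ In particular, the depth of $K[\Lambda]$ is $2$, unless $\Lambda$ is a simplex, i.e., $\#L=1$.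
   Context: A point-line incidence structure $(P,L)$ consists of a finite set $P$ of points and a finite set $L$ of lines with an incidence relation; lines are identified with the sets of points incident to them, and $\#\ell$ is the number of points on $\ell$. It is a linear space if any two distinct points lie on exactly one common line and every line contains at least two points. The incidence complex $\Lambda$ of $(P,L)$ is the simplicial complex on the vertex set $P$ whose facets are the sets of points on each line of $L$. Put $d=\#P$ and $R=K[x_1,\dots,x_d]$ (standard grading), with variables indexed by the points. $K[\Lambda]=R/I_\Lambda$ is the Stanley-Reisner ring, where $I_\Lambda$ is generated by the squarefree monomials corresponding to nonfaces of $\Lambda$. For a graded $R$-module $M$, $\beta_{i,j}(M)=\dim_K[\operatorname{Tor}_i^R(K,M)]_j$ and $\beta_i(M)=\dim_K\operatorname{Tor}_i^R(K,M)$. The depth of a graded $K$-algebra is the maximal length of a (homogeneous) regular sequence in it. Binomial coefficients $\binom{a}{b}$ with $a\ge 0$ are $0$ if $b<0$ or $b>a$. *)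

theory Defs
  imports
    "HOL-Library.Poly_Mapping"
    "HOL-Library.Extended_Nat"
    "HOL-Algebra.Algebra"
    "Jordan_Normal_Form.VS_Connect"
begin

section \<open>Linear spaces and their incidence complexes\<close>

definition linear_space :: "'p set \<Rightarrow> 'p set set \<Rightarrow> bool" where
  "linear_space P L \<longleftrightarrow>
     finite P \<and> L \<subseteq> Pow P \<and>
     (\<forall>p\<in>P. \<forall>q\<in>P. p \<noteq> q \<longrightarrow> (\<exists>!l. l \<in> L \<and> p \<in> l \<and> q \<in> l)) \<and>
     (\<forall>l\<in>L. 2 \<le> card l)"

definition incidence_complex :: "'p set set \<Rightarrow> 'p set set" where
  "incidence_complex L = {F. \<exists>l\<in>L. F \<subseteq> l}"

definition lines_of_size :: "'p set set \<Rightarrow> nat \<Rightarrow> nat" where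
  "lines_of_size L k = card {l \<in> L. card l = k}"

section \<open>Graded modules\<close>

text \<open>
  A \<open>gmodule\<close> carries a module structure together with its homogeneous components. As
  \<open>module\<close> extends \<open>ring\<close>, the same record also serves for graded algebras. For plain
  modules the fields \<open>mult\<close> and \<open>one\<close> are irrelevant.
\<close>

record ('r, 'm) gmodule = "('r, 'm) module" +
  hcomp :: "int \<Rightarrow> 'm set"

definition sub_gmodule :: "('r, 'm) gmodule \<Rightarrow> 'm set \<Rightarrow> ('r, 'm) gmodule" where
  "sub_gmodule M Z = M\<lparr>carrier := Z, hcomp := (\<lambda>j. Z \<inter> hcomp M j)\<rparr>"

text \<open>
  Only additivity matters for the carrier, zero and addition of \<open>M Quot N\<close>, so \<open>N\<close> may be any
  submodule. If \<open>M\<close> is a commutative graded ring and \<open>N\<close> an ideal, the result is the quotient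
  ring. The coset of \<open>r \<odot> x\<close> is \<open>N <+> r \<odot> Y\<close> for the coset \<open>Y\<close> of \<open>x\<close>.
\<close>

definition quot_gmodule :: "('r, 'm) gmodule \<Rightarrow> 'm set \<Rightarrow> ('r, 'm set) gmodule" where
  "quot_gmodule M N =
    \<lparr>carrier = carrier (M Quot N), monoid.mult = monoid.mult (M Quot N),
     one = one (M Quot N), ring.zero = ring.zero (M Quot N), add = add (M Quot N),
     smult = (\<lambda>r Y. N <+>\<^bsub>M\<^esub> ((\<lambda>x. r \<odot>\<^bsub>M\<^esub> x) ` Y)),
     hcomp = (\<lambda>j. (\<lambda>x. N +>\<^bsub>M\<^esub> x) ` hcomp M j)\<rparr>"

text \<open>The graded free module with basis \<open>B\<close>, the basis element \<open>b\<close> sitting in degree \<open>a b\<close>,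
  i.e. the direct sum of the shifted modules \<open>R(- a b)\<close> over \<open>b \<in> B\<close>.\<close>

definition free_gmodule ::
  "('r, 'r) gmodule \<Rightarrow> 'b set \<Rightarrow> ('b \<Rightarrow> int) \<Rightarrow> ('r, 'b \<Rightarrow> 'r) gmodule" where
  "free_gmodule R B a =
    (let C = {f. (\<forall>b. f b \<in> carrier R) \<and> (\<forall>b. b \<notin> B \<longrightarrow> f b = \<zero>\<^bsub>R\<^esub>) \<and> finite {b. f b \<noteq> \<zero>\<^bsub>R\<^esub>}}
     in \<lparr>carrier = C, monoid.mult = (\<lambda>f g b. \<zero>\<^bsub>R\<^esub>), one = (\<lambda>b. \<zero>\<^bsub>R\<^esub>),
         ring.zero = (\<lambda>b. \<zero>\<^bsub>R\<^esub>), add = (\<lambda>f g b. f b \<oplus>\<^bsub>R\<^esub> g b),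
         smult = (\<lambda>r f b. r \<otimes>\<^bsub>R\<^esub> f b),
         hcomp = (\<lambda>j. {f \<in> C. \<forall>b\<in>B. f b \<in> hcomp R (j - a b)})\<rparr>)"

definition ghom :: "('r, 'r) gmodule \<Rightarrow> ('r, 'm) gmodule \<Rightarrow> ('r, 'n) gmodule \<Rightarrow> ('m \<Rightarrow> 'n) set" where
  "ghom R M N =
    {h \<in> LinearCombinations.module_hom R M N. \<forall>j. h ` hcomp M j \<subseteq> hcomp N j}"

section \<open>Tensor products\<close>

definition basis_elt :: "('r, 'r) gmodule \<Rightarrow> 'b \<Rightarrow> 'b \<Rightarrow> 'r" where
  "basis_elt R b = (\<lambda>b'. if b' = b then \<one>\<^bsub>R\<^esub> else \<zero>\<^bsub>R\<^esub>)"

text \<open>The free module on \<open>M \<times> N\<close>; its grading is a dummy.\<close>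

definition tensor_free ::
  "('r, 'r) gmodule \<Rightarrow> ('r, 'm) gmodule \<Rightarrow> ('r, 'n) gmodule \<Rightarrow> ('r, 'm \<times> 'n \<Rightarrow> 'r) gmodule" where
  "tensor_free R M N = free_gmodule R (carrier M \<times> carrier N) (\<lambda>_. 0)"

definition tensor_rel ::
  "('r, 'r) gmodule \<Rightarrow> ('r, 'm) gmodule \<Rightarrow> ('r, 'n) gmodule \<Rightarrow> ('m \<times> 'n \<Rightarrow> 'r) set" where
  "tensor_rel R M N =
    (let E = tensor_free R M N; e = (\<lambda>m n. basis_elt R (m, n)) in
     LinearCombinations.module.span R E
      ({e (m \<oplus>\<^bsub>M\<^esub> m') n \<ominus>\<^bsub>E\<^esub> (e m n \<oplus>\<^bsub>E\<^esub> e m' n) | m m' n.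
          m \<in> carrier M \<and> m' \<in> carrier M \<and> n \<in> carrier N} \<union>
       {e m (n \<oplus>\<^bsub>N\<^esub> n') \<ominus>\<^bsub>E\<^esub> (e m n \<oplus>\<^bsub>E\<^esub> e m n') | m n n'.
          m \<in> carrier M \<and> n \<in> carrier N \<and> n' \<in> carrier N} \<union>
       {e (r \<odot>\<^bsub>M\<^esub> m) n \<ominus>\<^bsub>E\<^esub> (r \<odot>\<^bsub>E\<^esub> e m n) | r m n.
          r \<in> carrier R \<and> m \<in> carrier M \<and> n \<in> carrier N} \<union>
       {e m (r \<odot>\<^bsub>N\<^esub> n) \<ominus>\<^bsub>E\<^esub> (r \<odot>\<^bsub>E\<^esub> e m n) | r m n.
          r \<in> carrier R \<and> m \<in> carrier M \<and> n \<in> carrier N}))"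

definition pure_tensor ::
  "('r, 'r) gmodule \<Rightarrow> ('r, 'm) gmodule \<Rightarrow> ('r, 'n) gmodule \<Rightarrow> 'm \<Rightarrow> 'n \<Rightarrow> ('m \<times> 'n \<Rightarrow> 'r) set" where
  "pure_tensor R M N m n = tensor_rel R M N +>\<^bsub>tensor_free R M N\<^esub> basis_elt R (m, n)"

text \<open>The degree \<open>j\<close> part of the tensor product is the additive group generated by the tensors
  of homogeneous elements whose degrees sum to \<open>j\<close>.\<close>

definition tensor ::
  "('r, 'r) gmodule \<Rightarrow> ('r, 'm) gmodule \<Rightarrow> ('r, 'n) gmodule
    \<Rightarrow> ('r, ('m \<times> 'n \<Rightarrow> 'r) set) gmodule" where
  "tensor R M N =
    (let T = quot_gmodule (tensor_free R M N) (tensor_rel R M N) in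
     T\<lparr>hcomp := (\<lambda>j. generate (add_monoid T)
         {pure_tensor R M N m n | m n s t. m \<in> hcomp M s \<and> n \<in> hcomp N t \<and> s + t = j})\<rparr>)"

text \<open>The map \<open>h \<otimes> id\<^sub>N\<close>. It is only determined on the carrier of \<open>M \<otimes> N\<close>.\<close>

definition tensor_map ::
  "('r, 'r) gmodule \<Rightarrow> ('r, 'm) gmodule \<Rightarrow> ('r, 'm') gmodule \<Rightarrow> ('r, 'n) gmodule
    \<Rightarrow> ('m \<Rightarrow> 'm') \<Rightarrow> ('m \<times> 'n \<Rightarrow> 'r) set \<Rightarrow> ('m' \<times> 'n \<Rightarrow> 'r) set" where
  "tensor_map R M M' N h =
    (SOME g. g \<in> LinearCombinations.module_hom R (tensor R M N) (tensor R M' N) \<and>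
       (\<forall>m\<in>carrier M. \<forall>n\<in>carrier N.
          g (pure_tensor R M N m n) = pure_tensor R M' N (h m) n))"

section \<open>Homology, free resolutions and Tor\<close>

text \<open>A complex is given by modules \<open>C i\<close> and maps \<open>d i\<close> from \<open>C (Suc i)\<close> to \<open>C i\<close>;
  it is continued by zero to the right of \<open>C 0\<close>.\<close>

fun cycles :: "(nat \<Rightarrow> ('r, 'm) gmodule) \<Rightarrow> (nat \<Rightarrow> 'm \<Rightarrow> 'm) \<Rightarrow> nat \<Rightarrow> 'm set" where
  "cycles C d 0 = carrier (C 0)"
| "cycles C d (Suc i) = {x \<in> carrier (C (Suc i)). d i x = \<zero>\<^bsub>C i\<^esub>}"

definition boundaries :: "(nat \<Rightarrow> ('r, 'm) gmodule) \<Rightarrow> (nat \<Rightarrow> 'm \<Rightarrow> 'm) \<Rightarrow> nat \<Rightarrow> 'm set" where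
  "boundaries C d i = d i ` carrier (C (Suc i))"

definition homology ::
  "(nat \<Rightarrow> ('r, 'm) gmodule) \<Rightarrow> (nat \<Rightarrow> 'm \<Rightarrow> 'm) \<Rightarrow> nat \<Rightarrow> ('r, 'm set) gmodule" where
  "homology C d i = quot_gmodule (sub_gmodule (C i) (cycles C d i)) (boundaries C d i)"

text \<open>
  Graded free resolutions of \<open>A\<close> over \<open>R\<close> with bases indexed by sets of natural numbers. Every finitely generated graded module over a polynomial ring in finitely many
  variables has such a resolution.
\<close>

definition free_resolution ::
  "('r, 'r) gmodule \<Rightarrow> ('r, 'a) gmodule
    \<Rightarrow> (nat \<Rightarrow> ('r, nat \<Rightarrow> 'r) gmodule) \<Rightarrow> (nat \<Rightarrow> (nat \<Rightarrow> 'r) \<Rightarrow> (nat \<Rightarrow> 'r)) \<Rightarrow> bool" where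
  "free_resolution R A F d \<longleftrightarrow>
     (\<forall>i. \<exists>B a. F i = free_gmodule R B a) \<and>
     (\<forall>i. d i \<in> ghom R (F (Suc i)) (F i)) \<and>
     (\<forall>i. cycles F d (Suc i) = boundaries F d (Suc i)) \<and>
     (\<exists>\<epsilon> \<in> ghom R (F 0) A. \<epsilon> ` carrier (F 0) = carrier A \<and>
        {x \<in> carrier (F 0). \<epsilon> x = \<zero>\<^bsub>A\<^esub>} = boundaries F d 0)"

text \<open>\<open>Tor\<^sub>i\<^sup>R(A, M)\<close> as the left derived functor of \<open>_ \<otimes> M\<close> at \<open>A\<close>; up to isomorphism of
  graded modules it does not depend on the chosen resolution.\<close>

definition tor ::
  "('r, 'r) gmodule \<Rightarrow> ('r, 'a) gmodule \<Rightarrow> ('r, 'm) gmodule \<Rightarrow> nat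
    \<Rightarrow> ('r, ((nat \<Rightarrow> 'r) \<times> 'm \<Rightarrow> 'r) set set) gmodule" where
  "tor R A M i =
    (let (F, d) = (SOME (F, d). free_resolution R A F d) in
     homology (\<lambda>i. tensor R (F i) M) (\<lambda>i. tensor_map R (F (Suc i)) (F i) M (d i)) i)"

section \<open>Polynomial rings and graded Betti numbers\<close>

type_synonym ('p, 'k) mpoly = "('p \<Rightarrow>\<^sub>0 nat) \<Rightarrow>\<^sub>0 'k"

text \<open>The polynomial ring with variables indexed by \<open>P\<close> and its standard grading, as a graded
  module over itself. A monomial is given by its exponents \<open>'p \<Rightarrow>\<^sub>0 nat\<close>.\<close>

definition mpoly_ring :: "'p set \<Rightarrow> (('p, 'k::field) mpoly, ('p, 'k) mpoly) gmodule" where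
  "mpoly_ring P =
    (let C = {f. \<forall>m \<in> Poly_Mapping.keys f. Poly_Mapping.keys m \<subseteq> P} in
     \<lparr>carrier = C, monoid.mult = (*), one = 1, ring.zero = 0, add = (+), smult = (*),
      hcomp = (\<lambda>j. {f \<in> C. \<forall>m \<in> Poly_Mapping.keys f. int (\<Sum>v\<in>Poly_Mapping.keys m. Poly_Mapping.lookup m v) = j})\<rparr>)"

text \<open>The field \<open>K = R / (x\<^sub>v | v \<in> P)\<close>, on which a polynomial acts through its constant
  coefficient.\<close>

definition residue_field :: "(('p, 'k::field) mpoly, 'k) gmodule" where
  "residue_field =
    \<lparr>carrier = UNIV, monoid.mult = (*), one = 1, ring.zero = 0, add = (+),
     smult = (\<lambda>f c. Poly_Mapping.lookup f 0 * c), hcomp = (\<lambda>j. if j = 0 then UNIV else {0})\<rparr>"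

text \<open>Restriction of scalars along the inclusion of \<open>K\<close> as the constant polynomials.\<close>

definition K_space :: "(('p, 'k::field) mpoly, 'm) gmodule \<Rightarrow> ('k, 'm) module" where
  "K_space M =
    \<lparr>carrier = carrier M, monoid.mult = monoid.mult M, one = one M,
     ring.zero = ring.zero M, add = add M,
     smult = (\<lambda>c x. Poly_Mapping.single 0 c \<odot>\<^bsub>M\<^esub> x)\<rparr>"

definition K_dim :: "('k::field, 'm) module \<Rightarrow> nat" where
  "K_dim V = vectorspace.dim (class_ring :: 'k ring) V"

definition K_fin_dim :: "('k::field, 'm) module \<Rightarrow> bool" where
  "K_fin_dim V \<longleftrightarrow> vectorspace.fin_dim (class_ring :: 'k ring) V"

definition tor_K ::
  "'p set \<Rightarrow> (('p, 'k::field) mpoly, 'm) gmodule \<Rightarrow> nat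
    \<Rightarrow> (('p, 'k) mpoly, ((nat \<Rightarrow> ('p, 'k) mpoly) \<times> 'm \<Rightarrow> ('p, 'k) mpoly) set set) gmodule" where
  "tor_K P M i = tor (mpoly_ring P) residue_field M i"

definition betti :: "'p set \<Rightarrow> (('p, 'k::field) mpoly, 'm) gmodule \<Rightarrow> nat \<Rightarrow> nat" where
  "betti P M i = K_dim (K_space (tor_K P M i))"

definition graded_betti ::
  "'p set \<Rightarrow> (('p, 'k::field) mpoly, 'm) gmodule \<Rightarrow> nat \<Rightarrow> int \<Rightarrow> nat" where
  "graded_betti P M i j =
    K_dim ((K_space (tor_K P M i))\<lparr>carrier := hcomp (tor_K P M i) j\<rparr>)"

section \<open>Depth\<close>

definition regular_sequence :: "('a, 'b) ring_scheme \<Rightarrow> 'a list \<Rightarrow> bool" where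
  "regular_sequence A xs \<longleftrightarrow>
     set xs \<subseteq> carrier A \<and>
     (\<forall>i < length xs. \<forall>y \<in> carrier A.
        xs ! i \<otimes>\<^bsub>A\<^esub> y \<in> Idl\<^bsub>A\<^esub> (set (take i xs)) \<longrightarrow> y \<in> Idl\<^bsub>A\<^esub> (set (take i xs))) \<and>
     Idl\<^bsub>A\<^esub> (set xs) \<noteq> carrier A"

text \<open>If the degree zero part of \<open>A\<close> is a field, the entries of a homogeneous regular sequence
  automatically have positive degree: a nonzero constant generates the unit ideal, and \<open>0\<close> is
  a zero divisor on every nonzero quotient.\<close>

definition depth :: "('r, 'm) gmodule \<Rightarrow> enat" where
  "depth A =
    Sup {enat (length xs) | xs. regular_sequence A xs \<and> (\<forall>x\<in>set xs. \<exists>j. x \<in> hcomp A j)}"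

section \<open>Stanley-Reisner rings\<close>

definition sqfree_monomial :: "'p set \<Rightarrow> ('p, 'k::field) mpoly" where
  "sqfree_monomial S = Poly_Mapping.single (\<Sum>v\<in>S. Poly_Mapping.single v 1) 1"

definition stanley_reisner_ideal :: "'p set \<Rightarrow> 'p set set \<Rightarrow> ('p, 'k::field) mpoly set" where
  "stanley_reisner_ideal P \<Delta> =
    Idl\<^bsub>(mpoly_ring P :: (('p, 'k) mpoly, ('p, 'k) mpoly) gmodule)\<^esub>
      (sqfree_monomial ` {S. S \<subseteq> P \<and> S \<notin> \<Delta>})"

definition stanley_reisner_ring ::
  "'p set \<Rightarrow> 'p set set \<Rightarrow> (('p, 'k::field) mpoly, ('p, 'k) mpoly set) gmodule" where
  "stanley_reisner_ring P \<Delta> = quot_gmodule (mpoly_ring P) (stanley_reisner_ideal P \<Delta>)"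

end

theory Submission
  imports Defs "HOL-Library.Function_Algebras"
begin

text \<open>
  Both halves of the theorem are read off the Koszul complex \<open>K\<close> of the variables, a free resolution
  of the residue field with basis \<open>e\<^sub>S\<close> in homological degree \<open>card S\<close> for \<open>S \<subseteq> P\<close>.

  \<^bold>\<open>Betti numbers.\<close> \<open>K\<close> and the ideal \<open>I\<close> of \<open>\<Lambda>\<close> are graded by exponent vectors. In multidegree
  \<open>m\<close> the complex \<open>K \<otimes> R/I\<close> is a cone, hence exact, as soon as some exponent is at least two, and for
  squarefree \<open>m\<close> with support \<open>W\<close> it is the cochain complex of the restriction of \<open>\<Lambda>\<close> to \<open>W\<close>: the
  basis element \<open>e\<^sub>S\<close> corresponds to the face \<open>W - S\<close>. Any two points are joined by an edge, and two
  lines share at most a point, so this restriction is a complete graph on \<open>W\<close> in which each \<open>l \<inter> W\<close>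
  is filled in. Cohomology can only sit on edges, that is, in \<open>card W = i + 2\<close>, which already gives
  \<open>\<beta>\<^sub>i = \<beta>\<^sub>i\<^sub>,\<^sub>i\<^sub>+\<^sub>2\<close>. Fix a point \<open>p\<close> of \<open>W\<close> and on each line \<open>l\<close> that misses \<open>p\<close> and meets \<open>W\<close> a point \<open>r\<close>
  of \<open>l \<inter> W\<close>. A cocycle is determined up to coboundaries by its values on the loops \<open>p\<close>, \<open>r\<close>, \<open>q\<close>
  for the other points \<open>q\<close> of \<open>l \<inter> W\<close>, and these values can be prescribed at will. The triples
  \<open>(W, l, q)\<close> form \<open>cycle_index i\<close>; the lemmas \<open>cycle_is_boundary\<close>, \<open>boundary_coord_zero\<close> and
  \<open>cycle_coord_surj\<close> make the loop values coordinates on the homology, and \<open>cycle_index_formula\<close>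
  counts them.

  \<^bold>\<open>From Koszul homology to Tor.\<close> \<open>Tor\<close> is computed from a graded free resolution \<open>F\<close> obtained by
  choice. The Koszul complex shows that one exists (\<open>free_resolution_exists\<close>). For every \<open>F\<close> the map
  \<open>x \<mapsto> x \<otimes> 1\<close> identifies \<open>F \<otimes> R/I\<close> with \<open>F / I F\<close>, so that a homology class is a vector \<open>x\<close> with
  \<open>d x\<close> in \<open>I F\<close>, taken modulo \<open>I F\<close> and the image of \<open>d\<close>. Comparison maps between \<open>F\<close> and \<open>K\<close> are inverse
  to each other up to homotopy (\<open>round_trip_homotopy\<close>), and the one out of \<open>K\<close> can be chosen homogeneous
  (\<open>graded_chain_map_exists\<close>). Therefore the loop coordinates carry over to \<open>F\<close>, together with the
  degree (\<open>tor_of_incidence_complex\<close>).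

  \<^bold>\<open>Depth.\<close> The elementary symmetric polynomials of degree one and two form a regular sequence. Both
  are tested on one line at a time: for the first, its restriction to a line is monic in any variable of the
  line; for the second, modulo the first it becomes, up to sign, a quadric that is monic in a variable.
  The quotients found on the single lines agree where lines meet and glue (\<open>e1_regular\<close>, \<open>e2_regular\<close>).
  No homogeneous regular sequence is longer. A regular element of the maximal ideal moves nonzero Koszul
  homology up by one degree (\<open>koszul_homology_shift\<close>), and Koszul homology vanishes above
  degree \<open>card P\<close>. If \<open>\<Lambda>\<close> is not a simplex, some line misses the point chosen in \<open>W = P\<close>, and its loops
  make the homology of \<open>R/I\<close> nonzero in degree \<open>card P - 2\<close>.
\<close>

section \<open>Polynomials\<close>

abbreviation coef :: "('a \<Rightarrow>\<^sub>0 'b::zero) \<Rightarrow> 'a \<Rightarrow> 'b" where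
  "coef \<equiv> Poly_Mapping.lookup"

abbreviation supp :: "('a \<Rightarrow>\<^sub>0 'b::zero) \<Rightarrow> 'a set" where
  "supp \<equiv> Poly_Mapping.keys"

abbreviation unit_exp :: "'p \<Rightarrow> 'p \<Rightarrow>\<^sub>0 nat" where
  "unit_exp v \<equiv> Poly_Mapping.single v 1"

abbreviation monom_mp :: "('p \<Rightarrow>\<^sub>0 nat) \<Rightarrow> 'k \<Rightarrow> ('p, 'k::field) mpoly" where
  "monom_mp \<equiv> Poly_Mapping.single"

text \<open>The carrier of the polynomial ring, as a set that can be reasoned about without the record around it.\<close>

definition polys :: "'p set \<Rightarrow> ('p, 'k::field) mpoly set" where
  "polys P = {f. \<forall>m\<in>supp f. supp m \<subseteq> P}"

lemma polys_iff: "f \<in> polys P \<longleftrightarrow> (\<forall>m. coef f m \<noteq> 0 \<longrightarrow> supp m \<subseteq> P)"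
  unfolding polys_def by (auto simp: in_keys_iff)

lemma polys_zero [simp]: "0 \<in> polys P"
  by (simp add: polys_def)

lemma polys_one [simp]: "1 \<in> polys P"
  by (simp add: polys_def)

lemma polys_add [simp]: "f \<in> polys P \<Longrightarrow> g \<in> polys P \<Longrightarrow> f + g \<in> polys P"
  unfolding polys_iff lookup_add by (metis add.right_neutral)

lemma polys_uminus [simp]: "f \<in> polys P \<Longrightarrow> - f \<in> polys P"
  by (simp add: polys_iff)

lemma polys_diff [simp]: "f \<in> polys P \<Longrightarrow> g \<in> polys P \<Longrightarrow> f - g \<in> polys P"
  using polys_add[of f P "- g"] by simp

lemma supp_add_exp: "supp (m + n) = supp m \<union> supp (n :: 'p \<Rightarrow>\<^sub>0 nat)"
  by (auto simp: in_keys_iff lookup_add)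

lemma polys_mult [simp]:
  assumes "f \<in> polys P" "g \<in> polys P" shows "f * g \<in> polys P"
  unfolding polys_def
proof (intro CollectI ballI)
  fix m assume "m \<in> supp (f * g)"
  then obtain a b where "m = a + b" "a \<in> supp f" "b \<in> supp g"
    using keys_mult[of f g] by blast
  with assms show "supp m \<subseteq> P"
    by (auto simp: polys_def supp_add_exp)
qed

lemma polys_sum [simp]: "(\<And>x. x \<in> A \<Longrightarrow> f x \<in> polys P) \<Longrightarrow> sum f A \<in> polys P"
  by (induction A rule: infinite_finite_induct) auto

lemma polys_monom: "supp m \<subseteq> P \<Longrightarrow> monom_mp m c \<in> polys P"
  by (simp add: polys_def)

lemma sum_monoms: "(\<Sum>m\<in>supp f. Poly_Mapping.single m (coef f m)) = f"
  by (rule poly_mapping_eqI) (simp add: lookup_sum lookup_single when_def sum.delta in_keys_iff)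

lemma coef_monom_mult_add: "coef (monom_mp a c * f) (a + n) = c * coef f n"
proof -
  have "coef (monom_mp a c * f) (a + n) = coef (\<Sum>m\<in>supp f. monom_mp (a + m) (c * coef f m)) (a + n)"
    by (subst sum_monoms[of f, symmetric]) (simp only: sum_distrib_left mult_single)
  also have "\<dots> = (\<Sum>m\<in>supp f. if m = n then c * coef f m else 0)"
    by (simp add: lookup_sum lookup_single when_def)
  also have "\<dots> = c * coef f n"
    by (simp add: sum.delta in_keys_iff)
  finally show ?thesis .
qed

lemma coef_monom_mult_other:
  assumes "\<And>k. n \<noteq> a + k" shows "coef (monom_mp a c * f) n = 0"
proof -
  have "n \<notin> supp (monom_mp a c * f)"
    using keys_mult[of "monom_mp a c" f] assms by (auto split: if_splits)
  then show ?thesis by (simp add: in_keys_iff)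
qed

lemma unit_exp_decomp:
  assumes "v \<in> supp n" shows "n = unit_exp v + (n - unit_exp v)"
  by (rule poly_mapping_eqI) (use assms in \<open>auto simp: lookup_add lookup_minus lookup_single when_def in_keys_iff\<close>)

lemma coef_var_mult:
  "coef (monom_mp (unit_exp v) c * f) n = (if v \<in> supp n then c * coef f (n - unit_exp v) else 0)"
proof (cases "v \<in> supp n")
  case True
  then show ?thesis
    using coef_monom_mult_add[of "unit_exp v" c f "n - unit_exp v"] unit_exp_decomp[OF True] by simp
next
  case False
  then have "\<And>k. n \<noteq> unit_exp v + k" by (auto simp: supp_add_exp)
  then show ?thesis using False coef_monom_mult_other[of n "unit_exp v" c f] by auto
qed

lemma coef_const_mult: "coef (monom_mp 0 c * f) n = c * coef f n"
  using coef_monom_mult_add[of 0 c f n] by simp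

definition sqfree_exp :: "'p set \<Rightarrow> 'p \<Rightarrow>\<^sub>0 nat" where
  "sqfree_exp S = (\<Sum>v\<in>S. unit_exp v)"

lemma coef_sqfree_exp: "finite S \<Longrightarrow> coef (sqfree_exp S) v = (if v \<in> S then 1 else 0)"
  unfolding sqfree_exp_def lookup_sum lookup_single when_def
  by (simp add: sum.delta')

lemma supp_sqfree_exp [simp]: "finite S \<Longrightarrow> supp (sqfree_exp S) = S"
  by (simp add: set_eq_iff in_keys_iff coef_sqfree_exp)

section \<open>The Koszul differential on multigraded strands\<close>

text \<open>The cancellation behind the vanishing of the square of a boundary, stated so that it also holds in
characteristic two.\<close>

lemma sum_off_diagonal_antisym:
  fixes f :: "'a \<Rightarrow> 'a \<Rightarrow> 'b::comm_monoid_add"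
  assumes "finite A" "\<forall>u\<in>A. \<forall>v\<in>A. u \<noteq> v \<longrightarrow> f u v + f v u = 0"
  shows "(\<Sum>u\<in>A. \<Sum>v\<in>A - {u}. f u v) = 0"
  using assms
proof (induction A rule: finite_induct)
  case (insert a A)
  have a: "insert a A - {a} = A" using insert.hyps by auto
  have "(\<Sum>u\<in>insert a A. \<Sum>v\<in>insert a A - {u}. f u v)
      = (\<Sum>v\<in>A. f a v) + (\<Sum>u\<in>A. \<Sum>v\<in>insert a A - {u}. f u v)"
    by (subst sum.insert[OF insert.hyps]) (simp only: a)
  also have "(\<Sum>u\<in>A. \<Sum>v\<in>insert a A - {u}. f u v) = (\<Sum>u\<in>A. f u a + (\<Sum>v\<in>A - {u}. f u v))"
  proof (rule sum.cong[OF refl])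
    fix u assume "u \<in> A"
    then have eq: "insert a A - {u} = insert a (A - {u})" using insert.hyps by auto
    show "(\<Sum>v\<in>insert a A - {u}. f u v) = f u a + (\<Sum>v\<in>A - {u}. f u v)"
      unfolding eq by (rule sum.insert) (use insert.hyps in auto)
  qed
  also have "\<dots> = (\<Sum>u\<in>A. f u a) + (\<Sum>u\<in>A. \<Sum>v\<in>A - {u}. f u v)"
    by (rule sum.distrib)
  also have "(\<Sum>u\<in>A. \<Sum>v\<in>A - {u}. f u v) = 0"
    by (rule insert.IH) (simp add: insert.prems)
  also have "(\<Sum>v\<in>A. f a v) + ((\<Sum>u\<in>A. f u a) + 0) = (\<Sum>v\<in>A. f a v + f v a)"
    by (simp add: sum.distrib)
  also have "\<dots> = 0"
  proof (rule sum.neutral, intro ballI)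
    fix v assume "v \<in> A"
    then have "a \<noteq> v" using insert.hyps by blast
    then show "f a v + f v a = 0" using \<open>v \<in> A\<close> by (intro insert.prems[rule_format]) simp_all
  qed
  finally show ?case .
qed simp

text \<open>The signs of the exterior algebra: multiplying the basis element of \<open>S\<close> by the generator of \<open>v\<close> gives \<open>\<epsilon> v S\<close>
times the basis element of \<open>insert v S\<close>. Described by their anticommutation rule, they involve no order of the points.\<close>

locale koszul_sign =
  fixes P :: "'p set" and \<epsilon> :: "'p \<Rightarrow> 'p set \<Rightarrow> 'k::field"
  assumes finite_P: "finite P"
    and sign_sq: "\<epsilon> v S * \<epsilon> v S = 1"
    and sign_anti: "u \<in> P \<Longrightarrow> v \<in> P \<Longrightarrow> S \<subseteq> P \<Longrightarrow> u \<noteq> v \<Longrightarrow> u \<notin> S \<Longrightarrow> v \<notin> S \<Longrightarrow>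
      \<epsilon> u S * \<epsilon> v (insert u S) = - (\<epsilon> v S * \<epsilon> u (insert v S))"

lemma koszul_sign_exists:
  fixes P :: "'p set"
  assumes "finite P"
  shows "\<exists>\<epsilon> :: 'p \<Rightarrow> 'p set \<Rightarrow> 'k::field. koszul_sign P \<epsilon>"
proof -
  obtain idx :: "'p \<Rightarrow> nat" where idx: "inj_on idx P"
    using assms finite_imp_inj_to_nat_seg by blast
  \<comment> \<open>The usual sign, counting the elements of \<open>S\<close> before \<open>v\<close> in some enumeration.\<close>
  define \<epsilon> :: "'p \<Rightarrow> 'p set \<Rightarrow> 'k" where "\<epsilon> v S = (- 1) ^ card {w\<in>S. idx w < idx v}" for v S
  have ins: "\<epsilon> v (insert u S) = (if idx u < idx v then - \<epsilon> v S else \<epsilon> v S)"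
    if "S \<subseteq> P" "u \<notin> S" for u v S
  proof -
    have fin: "finite S" using that assms finite_subset by blast
    have "{w \<in> insert u S. idx w < idx v} =
        (if idx u < idx v then insert u {w\<in>S. idx w < idx v} else {w\<in>S. idx w < idx v})"
      by auto
    then show ?thesis using that fin by (auto simp: \<epsilon>_def)
  qed
  have "koszul_sign P \<epsilon>"
  proof
    show "\<epsilon> v S * \<epsilon> v S = 1" for v S
      by (simp add: \<epsilon>_def)
    show "\<epsilon> u S * \<epsilon> v (insert u S) = - (\<epsilon> v S * \<epsilon> u (insert v S))"
      if h: "u \<in> P" "v \<in> P" "S \<subseteq> P" "u \<noteq> v" "u \<notin> S" "v \<notin> S" for u v S
    proof -
      have "idx u \<noteq> idx v" using idx h by (auto dest: inj_onD)
      then show ?thesis using ins[OF h(3,5), of v] ins[OF h(3,6), of u] by auto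
    qed
  qed (rule assms)
  then show ?thesis by blast
qed

context koszul_sign begin

text \<open>The Koszul differential in a single multidegree with support \<open>V\<close>, where all monomials have become scalars.
Read on complements \<open>V - S\<close> it is the simplicial coboundary.\<close>

definition strand_bd :: "'p set \<Rightarrow> ('p set \<Rightarrow> 'k) \<Rightarrow> 'p set \<Rightarrow> 'k" where
  "strand_bd V Z T = (\<Sum>v\<in>V - T. \<epsilon> v T * Z (insert v T))"

lemma sign_anti2:
  assumes "u \<in> P" "v \<in> P" "S \<subseteq> P" "u \<noteq> v" "u \<notin> S" "v \<notin> S"
  shows "\<epsilon> u (insert v S) * \<epsilon> v (insert u S) = - (\<epsilon> v S * \<epsilon> u S)"
proof -
  have "\<epsilon> u S * (\<epsilon> u S * \<epsilon> v (insert u S)) = - (\<epsilon> u S * \<epsilon> v S * \<epsilon> u (insert v S))"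
    using sign_anti[OF assms] by simp
  then have "\<epsilon> v (insert u S) = - (\<epsilon> u S * \<epsilon> v S * \<epsilon> u (insert v S))"
    using sign_sq[of u S] by (simp flip: mult.assoc)
  then have "\<epsilon> u (insert v S) * \<epsilon> v (insert u S)
      = - (\<epsilon> u S * \<epsilon> v S * (\<epsilon> u (insert v S) * \<epsilon> u (insert v S)))"
    by (simp add: mult_ac)
  then show ?thesis by (simp add: sign_sq)
qed

lemma strand_bd_cong:
  "(\<And>v. v \<in> V - T \<Longrightarrow> Z (insert v T) = Z' (insert v T)) \<Longrightarrow> strand_bd V Z T = strand_bd V Z' T"
  unfolding strand_bd_def by (rule sum.cong) auto

lemma strand_bd_strand_bd:
  assumes "V \<subseteq> P" "T \<subseteq> V"
  shows "strand_bd V (strand_bd V Z) T = 0"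
proof -
  have fin: "finite (V - T)" using assms finite_P finite_subset by blast
  have "strand_bd V (strand_bd V Z) T = (\<Sum>u\<in>V - T. \<Sum>v\<in>(V - T) - {u}.
      \<epsilon> u T * \<epsilon> v (insert u T) * Z (insert v (insert u T)))"
    unfolding strand_bd_def
  proof (rule sum.cong[OF refl])
    fix u assume "u \<in> V - T"
    have "V - insert u T = (V - T) - {u}" by blast
    then show "\<epsilon> u T * (\<Sum>v\<in>V - insert u T. \<epsilon> v (insert u T) * Z (insert v (insert u T))) =
      (\<Sum>v\<in>(V - T) - {u}. \<epsilon> u T * \<epsilon> v (insert u T) * Z (insert v (insert u T)))"
      by (simp add: sum_distrib_left mult.assoc)
  qed
  also have "\<dots> = 0"
  proof (rule sum_off_diagonal_antisym[OF fin], intro ballI impI)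
    fix u v assume uv: "u \<in> V - T" "v \<in> V - T" "u \<noteq> v"
    then have "\<epsilon> u T * \<epsilon> v (insert u T) + \<epsilon> v T * \<epsilon> u (insert v T) = 0"
      using sign_anti[of u v T] assms by (simp add: subset_iff)
    then show "\<epsilon> u T * \<epsilon> v (insert u T) * Z (insert v (insert u T))
      + \<epsilon> v T * \<epsilon> u (insert v T) * Z (insert u (insert v T)) = 0"
      by (simp add: insert_commute[of v u] flip: distrib_right)
  qed
  finally show ?thesis .
qed

text \<open>The contracting homotopy of a cone with apex \<open>c S\<close>. The apex may vary with \<open>S\<close>, because different regions of
the restricted complex are contracted to different points.\<close>

definition strand_cone :: "('p set \<Rightarrow> 'p) \<Rightarrow> ('p set \<Rightarrow> 'k) \<Rightarrow> 'p set \<Rightarrow> 'k" where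
  "strand_cone c Z S = (if c S \<in> S then \<epsilon> (c S) (S - {c S}) * Z (S - {c S}) else 0)"

text \<open>For a constant apex \<open>v0\<close> the boundary of the cone plus the cone of the boundary is the identity. To
evaluate this at \<open>S\<close>, the apex only needs to be \<open>v0\<close> on the neighbours of \<open>S\<close>, and the boundary of \<open>Z\<close> only
needs to vanish at \<open>S - {v0}\<close>.\<close>

lemma strand_bd_cone:
  assumes V: "V \<subseteq> P" and S: "S \<subseteq> V" and v0: "v0 \<in> V"
    and c: "\<And>u. u \<in> V - S \<Longrightarrow> c (insert u S) = v0"
    and cyc: "v0 \<in> S \<Longrightarrow> strand_bd V Z (S - {v0}) = 0"
  shows "strand_bd V (strand_cone c Z) S = Z S"
proof -
  have fin: "finite (V - S)" using assms finite_P finite_subset by blast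
  have eq: "strand_bd V (strand_cone c Z) S = (\<Sum>u\<in>V - S. \<epsilon> u S *
      (if v0 \<in> insert u S then \<epsilon> v0 (insert u S - {v0}) * Z (insert u S - {v0}) else 0))"
    unfolding strand_bd_def strand_cone_def by (rule sum.cong) (auto simp: c)
  show ?thesis
  proof (cases "v0 \<in> S")
    case False
    have "strand_bd V (strand_cone c Z) S = (\<Sum>u\<in>V - S. if u = v0 then Z S else 0)"
      unfolding eq
    proof (rule sum.cong[OF refl])
      fix u assume "u \<in> V - S"
      have "\<epsilon> v0 S * (\<epsilon> v0 S * Z S) = Z S" using sign_sq by (simp flip: mult.assoc)
      then show "\<epsilon> u S * (if v0 \<in> insert u S then \<epsilon> v0 (insert u S - {v0}) * Z (insert u S - {v0}) else 0)
        = (if u = v0 then Z S else 0)"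
        using False by auto
    qed
    also have "\<dots> = Z S" using fin v0 False by simp
    finally show ?thesis .
  next
    case True
    define T where "T = S - {v0}"
    have T: "insert v0 T = S" "v0 \<notin> T" "T \<subseteq> P" using True S V by (auto simp: T_def)
    have VT: "V - T = insert v0 (V - S)" using True v0 by (auto simp: T_def)
    have "0 = \<epsilon> v0 T * (\<epsilon> v0 T * Z S + (\<Sum>u\<in>V - S. \<epsilon> u T * Z (insert u T)))"
      using cyc[OF True] fin True T(1) unfolding strand_bd_def T_def[symmetric] VT by simp
    then have Z: "Z S = - (\<epsilon> v0 T * (\<Sum>u\<in>V - S. \<epsilon> u T * Z (insert u T)))"
      using sign_sq[of v0 T] by (simp add: distrib_left eq_neg_iff_add_eq_0 flip: mult.assoc)
    have "strand_bd V (strand_cone c Z) S = (\<Sum>u\<in>V - S. - (\<epsilon> v0 T * (\<epsilon> u T * Z (insert u T))))"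
      unfolding eq
    proof (rule sum.cong[OF refl])
      fix u assume u: "u \<in> V - S"
      then have *: "insert u S - {v0} = insert u T" "u \<noteq> v0" using True by (auto simp: T_def)
      have "\<epsilon> u (insert v0 T) * \<epsilon> v0 (insert u T) = - (\<epsilon> v0 T * \<epsilon> u T)"
        using sign_anti2[of u v0 T] u * T v0 V by auto
      then have "\<epsilon> u S * (\<epsilon> v0 (insert u T) * Z (insert u T)) = - (\<epsilon> v0 T * \<epsilon> u T) * Z (insert u T)"
        using T(1) by (simp flip: mult.assoc)
      then show "\<epsilon> u S * (if v0 \<in> insert u S then \<epsilon> v0 (insert u S - {v0}) * Z (insert u S - {v0}) else 0)
        = - (\<epsilon> v0 T * (\<epsilon> u T * Z (insert u T)))"
        using True * by (simp add: mult.assoc)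
    qed
    then show ?thesis by (simp add: Z sum_negf sum_distrib_left)
  qed
qed

end

section \<open>The Koszul complex\<close>

context koszul_sign begin

text \<open>The free module with basis \<open>e\<^sub>S\<close> for the \<open>i\<close>-subsets \<open>S\<close> of \<open>P\<close>: the term of the Koszul complex in homological degree \<open>i\<close>.\<close>

definition kchains :: "nat \<Rightarrow> ('p set \<Rightarrow> ('p, 'k) mpoly) set" where
  "kchains i = {z. \<forall>S. z S \<in> polys P \<and> (\<not> (S \<subseteq> P \<and> card S = i) \<longrightarrow> z S = 0)}"

definition kbd :: "('p set \<Rightarrow> ('p, 'k) mpoly) \<Rightarrow> 'p set \<Rightarrow> ('p, 'k) mpoly" where
  "kbd z T = (\<Sum>v\<in>P - T. monom_mp (unit_exp v) (\<epsilon> v T) * z (insert v T))"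

text \<open>The part of \<open>z\<close> in multidegree \<open>m\<close>. The subtraction is truncated, so the value is meaningful for
\<open>S \<subseteq> supp m\<close>.\<close>

definition strand :: "('p set \<Rightarrow> ('p, 'k) mpoly) \<Rightarrow> ('p \<Rightarrow>\<^sub>0 nat) \<Rightarrow> 'p set \<Rightarrow> 'k" where
  "strand z m S = coef (z S) (m - sqfree_exp S)"

lemma supp_diff_sqfree:
  assumes "finite S" "v \<notin> S" shows "v \<in> supp (m - sqfree_exp S) \<longleftrightarrow> v \<in> supp m"
  using assms by (simp add: in_keys_iff lookup_minus coef_sqfree_exp)

lemma sqfree_exp_insert: "finite S \<Longrightarrow> v \<notin> S \<Longrightarrow> sqfree_exp (insert v S) = unit_exp v + sqfree_exp S"
  by (simp add: sqfree_exp_def)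

lemma finite_sub: "S \<subseteq> P \<Longrightarrow> finite S"
  using finite_P finite_subset by blast

lemma strand_kbd:
  assumes "supp m \<subseteq> P" "T \<subseteq> P"
  shows "strand (kbd z) m T = strand_bd (supp m) (strand z m) T"
proof -
  have "strand (kbd z) m T = (\<Sum>v\<in>P - T. if v \<in> supp m
      then \<epsilon> v T * coef (z (insert v T)) (m - sqfree_exp T - unit_exp v) else 0)"
    unfolding strand_def kbd_def lookup_sum coef_var_mult
    using finite_sub[OF assms(2)] by (intro sum.cong) (auto simp: supp_diff_sqfree)
  also have "\<dots> = (\<Sum>v\<in>supp m - T. \<epsilon> v T * coef (z (insert v T)) (m - sqfree_exp T - unit_exp v))"
    using assms finite_P by (intro sum.mono_neutral_cong_right) auto
  also have "\<dots> = strand_bd (supp m) (strand z m) T"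
    unfolding strand_bd_def strand_def
    using finite_sub[OF assms(2)]
    by (intro sum.cong) (auto simp: sqfree_exp_insert diff_diff_add add.commute)
  finally show ?thesis .
qed

lemma kchainsD:
  assumes "z \<in> kchains i"
  shows "z S \<in> polys P" "\<not> (S \<subseteq> P \<and> card S = i) \<Longrightarrow> z S = 0"
  using assms by (auto simp: kchains_def)

lemma kbd_kchains:
  assumes "z \<in> kchains (Suc i)" shows "kbd z \<in> kchains i"
  unfolding kchains_def
proof (intro CollectI allI conjI impI)
  fix S
  show "kbd z S \<in> polys P"
    unfolding kbd_def using kchainsD(1)[OF assms]
    by (intro polys_sum polys_mult polys_monom) auto
  assume S: "\<not> (S \<subseteq> P \<and> card S = i)"
  show "kbd z S = 0"
    unfolding kbd_def
  proof (intro sum.neutral ballI)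
    fix v assume v: "v \<in> P - S"
    have "\<not> (insert v S \<subseteq> P \<and> card (insert v S) = Suc i)"
      using S v finite_sub[of S] by auto
    then have "z (insert v S) = 0" by (rule kchainsD(2)[OF assms])
    then show "monom_mp (unit_exp v) (\<epsilon> v S) * z (insert v S) = 0" by simp
  qed
qed

lemma kchains_eqI:
  assumes "z \<in> kchains i" "z' \<in> kchains i"
    and "\<And>m S. supp m \<subseteq> P \<Longrightarrow> S \<subseteq> supp m \<Longrightarrow> card S = i \<Longrightarrow> strand z m S = strand z' m S"
  shows "z = z'"
proof
  fix S
  show "z S = z' S"
  proof (cases "S \<subseteq> P \<and> card S = i")
    case True
    then have S: "S \<subseteq> P" "card S = i" and fin: "finite S" using finite_sub by simp_all
    show ?thesis
    proof (rule poly_mapping_eqI)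
      fix n
      show "coef (z S) n = coef (z' S) n"
      proof (cases "supp n \<subseteq> P")
        case s: True
        have "strand z (n + sqfree_exp S) S = strand z' (n + sqfree_exp S) S"
          by (rule assms(3)) (use S s fin in \<open>simp_all add: supp_add_exp\<close>)
        then show ?thesis by (simp add: strand_def)
      next
        case False
        have *: "coef f n = 0" if "f \<in> polys P" for f :: "('p, 'k) mpoly"
          using that False unfolding polys_iff by blast
        show ?thesis by (simp only: *[OF kchainsD(1)[OF assms(1)]] *[OF kchainsD(1)[OF assms(2)]])
      qed
    qed
  next
    case False
    then show ?thesis using kchainsD(2)[OF assms(1) False] kchainsD(2)[OF assms(2) False] by simp
  qed
qed

lemma kchains_zero: "0 \<in> kchains i"
  by (simp add: kchains_def)

lemma kbd_kbd:
  assumes "z \<in> kchains (Suc (Suc i))" shows "kbd (kbd z) = 0"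
proof (rule kchains_eqI)
  show "kbd (kbd z) \<in> kchains i" using assms by (intro kbd_kchains)
  show "0 \<in> kchains i" by (rule kchains_zero)
  fix m :: "'p \<Rightarrow>\<^sub>0 nat" and S assume m: "supp m \<subseteq> P" "S \<subseteq> supp m" "card S = i"
  have "strand (kbd (kbd z)) m S = strand_bd (supp m) (strand_bd (supp m) (strand z m)) S"
  proof (subst strand_kbd)
    show "strand_bd (supp m) (strand (kbd z) m) S = strand_bd (supp m) (strand_bd (supp m) (strand z m)) S"
      by (rule strand_bd_cong, rule strand_kbd) (use m in auto)
  qed (use m in auto)
  also have "\<dots> = 0" using m by (intro strand_bd_strand_bd)
  finally show "strand (kbd (kbd z)) m S = strand 0 m S" by (simp add: strand_def)
qed

text \<open>The cone construction applied in every multidegree at once, with an apex depending on the multidegree.\<close>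

definition kcone :: "(('p \<Rightarrow>\<^sub>0 nat) \<Rightarrow> 'p set \<Rightarrow> 'p) \<Rightarrow> ('p set \<Rightarrow> ('p, 'k) mpoly) \<Rightarrow> 'p set \<Rightarrow> ('p, 'k) mpoly" where
  "kcone c z S = (if S \<subseteq> P then Abs_poly_mapping (\<lambda>n. let v = c (n + sqfree_exp S) S in
     if v \<in> S then \<epsilon> v (S - {v}) * coef (z (S - {v})) (n + unit_exp v) else 0) else 0)"

lemma coef_kcone:
  assumes "S \<subseteq> P"
  shows "coef (kcone c z S) n = (let v = c (n + sqfree_exp S) S in
     if v \<in> S then \<epsilon> v (S - {v}) * coef (z (S - {v})) (n + unit_exp v) else 0)"
proof -
  let ?f = "\<lambda>n. let v = c (n + sqfree_exp S) S in
     if v \<in> S then \<epsilon> v (S - {v}) * coef (z (S - {v})) (n + unit_exp v) else 0"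
  have "{n. ?f n \<noteq> 0} \<subseteq> (\<Union>v\<in>S. (\<lambda>k. k - unit_exp v) ` supp (z (S - {v})))"
  proof
    fix n assume "n \<in> {n. ?f n \<noteq> 0}"
    then obtain v where "v \<in> S" "n + unit_exp v \<in> supp (z (S - {v}))"
      by (auto simp: Let_def in_keys_iff split: if_splits)
    moreover have "n = (n + unit_exp v) - unit_exp v" by simp
    ultimately show "n \<in> (\<Union>v\<in>S. (\<lambda>k. k - unit_exp v) ` supp (z (S - {v})))" by blast
  qed
  moreover have "finite \<dots>" using finite_sub[OF assms] by simp
  ultimately have "finite {n. ?f n \<noteq> 0}" by (rule finite_subset)
  then show ?thesis using assms by (simp add: kcone_def)
qed

lemma kcone_kchains:
  assumes "z \<in> kchains i" shows "kcone c z \<in> kchains (Suc i)"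
  unfolding kchains_def
proof (intro CollectI allI conjI impI)
  fix S
  show "kcone c z S \<in> polys P"
  proof (cases "S \<subseteq> P")
    case True
    show ?thesis
      unfolding polys_iff
    proof (intro allI impI)
      fix n assume "coef (kcone c z S) n \<noteq> 0"
      then obtain v where "v \<in> S" "coef (z (S - {v})) (n + unit_exp v) \<noteq> 0"
        unfolding coef_kcone[OF True] by (auto simp: Let_def split: if_splits)
      then have "supp (n + unit_exp v) \<subseteq> P" using kchainsD(1)[OF assms] by (auto simp: polys_iff)
      then show "supp n \<subseteq> P" by (auto simp: supp_add_exp)
    qed
  qed (simp add: kcone_def)
  assume S: "\<not> (S \<subseteq> P \<and> card S = Suc i)"
  show "kcone c z S = 0"
  proof (cases "S \<subseteq> P")
    case True
    show ?thesis
    proof (rule poly_mapping_eqI)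
      fix n
      show "coef (kcone c z S) n = coef 0 n"
      proof (cases "c (n + sqfree_exp S) S \<in> S")
        case c: True
        then have "card (S - {c (n + sqfree_exp S) S}) \<noteq> i"
          using S True finite_sub[OF True] by (metis card_Suc_Diff1)
        then have "z (S - {c (n + sqfree_exp S) S}) = 0" using kchainsD(2)[OF assms] by blast
        then show ?thesis unfolding coef_kcone[OF True] by (simp add: Let_def)
      next
        case False
        then show ?thesis unfolding coef_kcone[OF True] by (simp add: Let_def)
      qed
    qed
  qed (simp add: kcone_def)
qed

lemma strand_kcone:
  assumes "S \<subseteq> supp m" "supp m \<subseteq> P"
  shows "strand (kcone c z) m S = strand_cone (c m) (strand z m) S"
proof -
  have S: "S \<subseteq> P" using assms by simp
  have fin: "finite S" using finite_sub[OF S] .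
  have m: "m - sqfree_exp S + sqfree_exp S = m"
    by (rule poly_mapping_eqI) (use assms fin in \<open>auto simp: lookup_add lookup_minus coef_sqfree_exp in_keys_iff\<close>)
  have *: "m - sqfree_exp S + unit_exp v = m - sqfree_exp (S - {v})" if "v \<in> S" for v
    by (rule poly_mapping_eqI)
      (use assms fin that in \<open>auto simp: lookup_add lookup_minus coef_sqfree_exp in_keys_iff lookup_single when_def\<close>)
  show ?thesis
    unfolding strand_def coef_kcone[OF S] strand_cone_def m Let_def using * by auto
qed

text \<open>The criterion by which all boundaries in this development are found. Its hypotheses concern the one multidegree
\<open>m\<close> and the subset \<open>S\<close> only, so the apex can be chosen separately in each situation.\<close>

lemma strand_kbd_kcone:
  assumes m: "supp m \<subseteq> P" and S: "S \<subseteq> supp m" and v0: "v0 \<in> supp m"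
    and c: "\<And>u. u \<in> supp m - S \<Longrightarrow> c m (insert u S) = v0"
    and cyc: "v0 \<in> S \<Longrightarrow> strand (kbd z) m (S - {v0}) = 0"
  shows "strand (kbd (kcone c z)) m S = strand z m S"
proof -
  have "strand (kbd (kcone c z)) m S = strand_bd (supp m) (strand (kcone c z) m) S"
    using m S by (intro strand_kbd) auto
  also have "\<dots> = strand_bd (supp m) (strand_cone (c m) (strand z m)) S"
    using m S by (intro strand_bd_cong strand_kcone) auto
  also have "\<dots> = strand z m S"
  proof (rule strand_bd_cone[OF m S v0])
    show "strand_bd (supp m) (strand z m) (S - {v0}) = 0" if "v0 \<in> S"
      using cyc[OF that] m S by (subst strand_kbd[symmetric]) auto
  qed (use c in auto)
  finally show ?thesis .
qed

text \<open>Every multidegree with nonempty support is a cone over any point of the support.\<close>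

lemma koszul_exact:
  assumes z: "z \<in> kchains (Suc i)" and cyc: "kbd z = 0"
  shows "\<exists>w\<in>kchains (Suc (Suc i)). z = kbd w"
proof
  let ?c = "\<lambda>m S. SOME v. v \<in> supp m"
  show "kcone ?c z \<in> kchains (Suc (Suc i))" by (rule kcone_kchains[OF z])
  show "z = kbd (kcone ?c z)"
  proof (rule kchains_eqI[OF z])
    show "kbd (kcone ?c z) \<in> kchains (Suc i)" by (intro kbd_kchains kcone_kchains z)
    fix m :: "'p \<Rightarrow>\<^sub>0 nat" and S assume m: "supp m \<subseteq> P" "S \<subseteq> supp m" "card S = Suc i"
    then have "\<exists>v. v \<in> supp m" by (metis all_not_in_conv card.empty nat.distinct(1) subset_empty)
    then have v: "?c m S \<in> supp m" by (rule someI_ex)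
    show "strand z m S = strand (kbd (kcone ?c z)) m S"
      by (rule strand_kbd_kcone[OF m(1,2) v, symmetric]) (simp_all add: cyc strand_def)
  qed
qed

text \<open>In homological degree zero the multidegree \<open>0\<close> has empty support and is not a cone; it carries the constant
term.\<close>

lemma koszul_exact_0:
  assumes z: "z \<in> kchains 0" and cyc: "coef (z {}) 0 = 0"
  shows "\<exists>w\<in>kchains (Suc 0). z = kbd w"
proof
  let ?c = "\<lambda>m S. SOME v. v \<in> supp m"
  show "kcone ?c z \<in> kchains (Suc 0)" by (rule kcone_kchains[OF z])
  show "z = kbd (kcone ?c z)"
  proof (rule kchains_eqI[OF z])
    show k: "kbd (kcone ?c z) \<in> kchains 0" by (intro kbd_kchains kcone_kchains z)
    fix m :: "'p \<Rightarrow>\<^sub>0 nat" and S assume m: "supp m \<subseteq> P" "S \<subseteq> supp m" "card S = 0"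
    then have S: "S = {}" by (metis card_eq_0_iff finite_keys finite_subset)
    show "strand z m S = strand (kbd (kcone ?c z)) m S"
    proof (cases "supp m = {}")
      case True
      then have [simp]: "m = 0" by simp
      have "strand (kbd (kcone ?c z)) m S = 0"
        using m by (subst strand_kbd) (auto simp: strand_bd_def)
      then show ?thesis using S cyc by (simp add: strand_def sqfree_exp_def)
    next
      case False
      then have "\<exists>v. v \<in> supp m" by fastforce
      then have v: "?c m S \<in> supp m" by (rule someI_ex)
      show ?thesis
        by (rule strand_kbd_kcone[OF m(1,2) v, symmetric]) (simp_all add: S)
    qed
  qed
qed

end

section \<open>Koszul homology of the Stanley-Reisner ring\<close>

text \<open>Fixes a base point in every nonempty set. Applied to \<open>W\<close> and to \<open>l \<inter> W\<close> it yields the points \<open>p\<close> and \<open>r\<close> of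
the loops.\<close>

abbreviation pt :: "'p set \<Rightarrow> 'p" where "pt A \<equiv> SOME x. x \<in> A"

lemma pt_in: "x \<in> A \<Longrightarrow> pt A \<in> A"
  by (rule someI)

text \<open>The Stanley-Reisner ideal, described by the monomials that occur in its elements. This description makes
membership a condition on each multidegree separately.\<close>

definition nonface_ideal :: "'p set \<Rightarrow> 'p set set \<Rightarrow> ('p, 'k::field) mpoly set" where
  "nonface_ideal P \<Delta> = {f \<in> polys P. \<forall>m\<in>supp f. supp m \<notin> \<Delta>}"

lemma nonface_idealD: "f \<in> nonface_ideal P \<Delta> \<Longrightarrow> supp n \<in> \<Delta> \<Longrightarrow> coef f n = 0"
  by (auto simp: nonface_ideal_def in_keys_iff)

lemma nonface_idealI:
  "f \<in> polys P \<Longrightarrow> (\<And>n. supp n \<subseteq> P \<Longrightarrow> supp n \<in> \<Delta> \<Longrightarrow> coef f n = 0) \<Longrightarrow> f \<in> nonface_ideal P \<Delta>"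
  unfolding nonface_ideal_def polys_def by (auto simp: in_keys_iff)

lemma nonface_ideal_polys: "f \<in> nonface_ideal P \<Delta> \<Longrightarrow> f \<in> polys P"
  by (simp add: nonface_ideal_def)

lemma nonface_ideal_zero [simp]: "0 \<in> nonface_ideal P \<Delta>"
  by (simp add: nonface_ideal_def)

lemma nonface_ideal_add: "f \<in> nonface_ideal P \<Delta> \<Longrightarrow> g \<in> nonface_ideal P \<Delta> \<Longrightarrow> f + g \<in> nonface_ideal P \<Delta>"
  by (rule nonface_idealI) (simp_all add: nonface_idealD nonface_ideal_polys lookup_add)

locale finite_linear_space =
  fixes P :: "'p set" and L :: "'p set set"
  assumes linear_space: "linear_space P L" and card_P: "card P \<ge> 2"
begin

lemma finite_points: "finite P"
  using linear_space by (simp add: linear_space_def)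

lemma line_sub: "l \<in> L \<Longrightarrow> l \<subseteq> P"
  using linear_space by (auto simp: linear_space_def)

lemma finite_lines: "finite L"
  using linear_space finite_subset[of L "Pow P"] by (auto simp: linear_space_def)

lemma finite_line: "l \<in> L \<Longrightarrow> finite l"
  using line_sub finite_points finite_subset by blast

lemma card_line: "l \<in> L \<Longrightarrow> 2 \<le> card l"
  using linear_space by (simp add: linear_space_def)

lemma line_exists: "a \<in> P \<Longrightarrow> b \<in> P \<Longrightarrow> a \<noteq> b \<Longrightarrow> \<exists>l\<in>L. a \<in> l \<and> b \<in> l"
  using linear_space unfolding linear_space_def by blast

lemma line_unique:
  assumes "l \<in> L" "l' \<in> L" "a \<in> l" "a \<in> l'" "b \<in> l" "b \<in> l'" "a \<noteq> b"
  shows "l = l'"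
proof -
  have "\<exists>!l. l \<in> L \<and> a \<in> l \<and> b \<in> l"
    using assms linear_space line_sub unfolding linear_space_def by blast
  then show ?thesis using assms by blast
qed

definition \<Lambda> :: "'p set set" where "\<Lambda> = incidence_complex L"

lemma face_iff: "A \<in> \<Lambda> \<longleftrightarrow> (\<exists>l\<in>L. A \<subseteq> l)"
  by (simp add: \<Lambda>_def incidence_complex_def)

lemma face_sub: "A \<in> \<Lambda> \<Longrightarrow> B \<subseteq> A \<Longrightarrow> B \<in> \<Lambda>"
  by (auto simp: face_iff)

lemma pair_face:
  assumes "a \<in> P" "b \<in> P" shows "{a, b} \<in> \<Lambda>"
proof (cases "a = b")
  case True
  have "P \<noteq> {a}" using card_P by auto
  then obtain c where "c \<in> P" "c \<noteq> a" using assms by blast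
  then show ?thesis using line_exists[OF assms(1), of c] True by (auto simp: face_iff)
next
  case False
  then show ?thesis using line_exists[OF assms] by (auto simp: face_iff)
qed

text \<open>The restriction of \<open>\<Lambda>\<close> to any set of points is a complete graph, which makes it connected.\<close>

lemma face_card_le_2:
  assumes "A \<subseteq> P" "card A \<le> 2" shows "A \<in> \<Lambda>"
proof -
  have "P \<noteq> {}" using card_P by auto
  then obtain a0 where a0: "a0 \<in> P" by blast
  consider "card A = 0" | "card A = 1" | "card A = 2" using assms by linarith
  then show ?thesis
  proof cases
    case 1
    then have "A = {}" using finite_subset[OF assms(1) finite_points] by simp
    then show ?thesis using face_sub[OF pair_face[OF a0 a0]] by simp
  next
    case 2
    then obtain a where "A = {a}" by (auto simp: card_1_singleton_iff)
    then show ?thesis using pair_face[of a a] assms by simp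
  next
    case 3
    then obtain a b where "A = {a, b}" by (auto simp: card_2_iff)
    then show ?thesis using pair_face[of a b] assms by simp
  qed
qed

definition line_of :: "'p set \<Rightarrow> 'p set" where "line_of A = (SOME l. l \<in> L \<and> A \<subseteq> l)"

lemma line_of_eq:
  assumes "l \<in> L" "A \<subseteq> l" "2 \<le> card A" shows "line_of A = l"
proof -
  have "line_of A \<in> L \<and> A \<subseteq> line_of A"
    unfolding line_of_def by (rule someI_ex) (use assms in blast)
  moreover obtain a b where "a \<in> A" "b \<in> A" "a \<noteq> b"
    using assms(3) by (metis card_le_Suc0_iff_eq card.infinite not_less_eq_eq numeral_2_eq_2 zero_le)
  ultimately show ?thesis using assms line_unique by blast
qed

lemma face_line_unique:
  assumes "l \<in> L" "l' \<in> L" "A \<subseteq> l" "A \<subseteq> l'" "2 \<le> card A" shows "l = l'"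
  using line_of_eq assms by metis

end

locale koszul_linear_space = koszul_sign P \<epsilon> + finite_linear_space P L
  for P :: "'p set" and \<epsilon> :: "'p \<Rightarrow> 'p set \<Rightarrow> 'k::field" and L :: "'p set set"
begin

abbreviation I\<Lambda> :: "('p, 'k) mpoly set" where "I\<Lambda> \<equiv> nonface_ideal P \<Lambda>"

lemma sign_nz: "\<epsilon> v S \<noteq> 0"
  using sign_sq[of v S] by (metis mult_zero_left zero_neq_one)

lemma strand_zero_of_mem:
  "f S \<in> I\<Lambda> \<Longrightarrow> supp (m - sqfree_exp S) \<in> \<Lambda> \<Longrightarrow> strand f m S = 0"
  unfolding strand_def by (rule nonface_idealD)

text \<open>Congruence modulo the ideal is tested on strands, at those \<open>S\<close> whose complement in \<open>m\<close> is a face.\<close>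

lemma mem_of_strand_zero:
  assumes "f \<in> kchains i"
    and "\<And>m S. supp m \<subseteq> P \<Longrightarrow> S \<subseteq> supp m \<Longrightarrow> card S = i \<Longrightarrow> supp (m - sqfree_exp S) \<in> \<Lambda> \<Longrightarrow> strand f m S = 0"
  shows "f S \<in> I\<Lambda>"
proof (cases "S \<subseteq> P \<and> card S = i")
  case True
  then have fin: "finite S" using finite_sub by simp
  show ?thesis
  proof (rule nonface_idealI[OF kchainsD(1)[OF assms(1)]])
    fix n :: "'p \<Rightarrow>\<^sub>0 nat" assume n: "supp n \<subseteq> P" "supp n \<in> \<Lambda>"
    have "strand f (n + sqfree_exp S) S = 0"
      by (rule assms(2)) (use True fin n in \<open>simp_all add: supp_add_exp\<close>)
    then show "coef (f S) n = 0" by (simp add: strand_def)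
  qed
qed (simp add: kchainsD(2)[OF assms(1)])

lemma supp_sqfree_diff: "finite W \<Longrightarrow> S \<subseteq> W \<Longrightarrow> supp (sqfree_exp W - sqfree_exp S) = W - S"
  using finite_subset[of S W] by (auto simp: set_eq_iff in_keys_iff lookup_minus coef_sqfree_exp)

text \<open>The two kinds of multidegrees: squarefree ones carry the topology, the others are cones.\<close>

lemma sqfree_or_multiple:
  obtains "m = sqfree_exp (supp m)" | v where "2 \<le> coef m v"
proof (cases "\<exists>v. 2 \<le> coef m v")
  case False
  have "m = sqfree_exp (supp m)"
  proof (rule poly_mapping_eqI)
    fix v
    have "coef m v < 2" using False by (meson not_le)
    then show "coef m v = coef (sqfree_exp (supp m)) v" by (auto simp: coef_sqfree_exp in_keys_iff)
  qed
  then show ?thesis using that by blast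
qed (use that in blast)

text \<open>A triple \<open>(W, l, q)\<close> stands for the loop through \<open>pt W\<close>, \<open>pt (l \<inter> W)\<close> and \<open>q\<close>. In \<open>W\<close>, the edges at
\<open>pt W\<close> form a spanning tree; a line through \<open>pt W\<close> contributes no loop, and on any other line the edges at
\<open>pt (l \<inter> W)\<close> generate all edges since \<open>l \<inter> W\<close> is a simplex.\<close>

definition cycle_index :: "nat \<Rightarrow> ('p set \<times> 'p set \<times> 'p) set" where
  "cycle_index i = {(W, l, q). W \<subseteq> P \<and> card W = i + 2 \<and> l \<in> L \<and> pt W \<notin> l \<and> q \<in> l \<inter> W \<and> q \<noteq> pt (l \<inter> W)}"

text \<open>The value of a cocycle on a loop: the coefficient of its boundary at the triangle spanned by the loop. The
triangle is not a face, so this coefficient need not vanish for a cycle modulo the ideal.\<close>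

definition cycle_coord :: "('p set \<Rightarrow> ('p, 'k) mpoly) \<Rightarrow> 'p set \<times> 'p set \<times> 'p \<Rightarrow> 'k" where
  "cycle_coord z = (\<lambda>(W, l, q). strand (kbd z) (sqfree_exp W) (W - {pt W, pt (l \<inter> W), q}))"

definition cycles_mod :: "nat \<Rightarrow> ('p set \<Rightarrow> ('p, 'k) mpoly) set" where
  "cycles_mod i = {z \<in> kchains i. \<forall>S. kbd z S \<in> I\<Lambda>}"

text \<open>The apex of the contraction in multidegree \<open>m\<close>, seen from \<open>S\<close>. If some exponent is at least two, the variable
with that exponent is a global apex. Otherwise the face \<open>supp m - S\<close> decides: a face with at most one point is contracted to
the base point of the support along edges, a larger face to the base point of its line. The cone is evaluated at
\<open>insert u S\<close> to find the boundary at \<open>S\<close>, so here the face has one point less than the face under consideration.\<close>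

definition cone_point :: "('p \<Rightarrow>\<^sub>0 nat) \<Rightarrow> 'p set \<Rightarrow> 'p" where
  "cone_point m S = (if \<exists>v. 2 \<le> coef m v then SOME v. 2 \<le> coef m v
     else if card (supp m - S) \<le> 1 then pt (supp m) else pt (line_of (supp m - S) \<inter> supp m))"

text \<open>The triangles \<open>p a b\<close>, \<open>p r a\<close>, \<open>p r b\<close> and \<open>r a b\<close> bound a tetrahedron. The last one lies on \<open>l\<close>, so
the loop through \<open>p\<close>, \<open>a\<close>, \<open>b\<close> is a combination of the two coordinate loops.\<close>

lemma triangle_coord_zero:
  assumes z: "z \<in> cycles_mod i" and coord: "\<And>x. x \<in> cycle_index i \<Longrightarrow> cycle_coord z x = 0"
    and W: "W \<subseteq> P" "card W = i + 2" and l: "l \<in> L" "pt W \<notin> l"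
    and ab: "a \<in> l \<inter> W" "b \<in> l \<inter> W" "a \<noteq> b"
  shows "strand (kbd z) (sqfree_exp W) (W - {pt W, a, b}) = 0"
proof -
  define p r where "p = pt W" and "r = pt (l \<inter> W)"
  have p: "p \<in> W" "p \<notin> l" using ab l by (auto simp: p_def intro: pt_in)
  have r: "r \<in> l" "r \<in> W" using pt_in[OF ab(1)] by (auto simp: r_def)
  have fin: "finite W" using finite_sub[OF W(1)] .
  let ?s = "strand (kbd z) (sqfree_exp W)"
  have base: "?s (W - {p, r, q}) = 0" if "q \<in> l \<inter> W" "q \<noteq> r" for q
  proof -
    have "(W, l, q) \<in> cycle_index i" using that W l by (simp add: cycle_index_def r_def)
    then show ?thesis using coord by (force simp: cycle_coord_def p_def r_def)
  qed
  show ?thesis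
  proof (cases "a = r \<or> b = r")
    case True
    then show ?thesis
      using base[of a] base[of b] ab by (auto simp: p_def insert_commute)
  next
    case False
    define U where "U = W - {p, r, a, b}"
    have WU: "W - U = {p, r, a, b}" using p r ab by (auto simp: U_def)
    have ins: "insert p U = W - {r, a, b}" "insert r U = W - {p, a, b}"
      "insert a U = W - {p, r, b}" "insert b U = W - {p, r, a}"
      using p r ab False by (auto simp: U_def)
    have "?s (W - {r, a, b}) = 0"
    proof (rule strand_zero_of_mem)
      show "kbd z (W - {r, a, b}) \<in> I\<Lambda>" using z by (simp add: cycles_mod_def)
      have "W - (W - {r, a, b}) = {r, a, b}" using r ab by auto
      then show "supp (sqfree_exp W - sqfree_exp (W - {r, a, b})) \<in> \<Lambda>"
        using r ab l fin by (auto simp: supp_sqfree_diff face_iff)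
    qed
    moreover have "?s (W - {p, r, b}) = 0" "?s (W - {p, r, a}) = 0"
      using base[of a] base[of b] ab False by blast+
    ultimately have others: "?s (insert v U) = 0" if "v \<in> {p, a, b}" for v
      using that by (elim insertE emptyE) (simp_all add: ins)
    have "0 = strand_bd W (strand_bd W (strand z (sqfree_exp W))) U"
      by (rule strand_bd_strand_bd[symmetric]) (use W in \<open>auto simp: U_def\<close>)
    also have "\<dots> = strand_bd W ?s U"
    proof (rule strand_bd_cong)
      fix v assume "v \<in> W - U"
      then show "strand_bd W (strand z (sqfree_exp W)) (insert v U) = ?s (insert v U)"
        using W fin by (subst strand_kbd) (auto simp: U_def)
    qed
    also have "\<dots> = \<epsilon> r U * ?s (insert r U) + (\<Sum>v\<in>(W - U) - {r}. \<epsilon> v U * ?s (insert v U))"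
      unfolding strand_bd_def by (rule sum.remove) (auto simp: WU)
    also have "(\<Sum>v\<in>(W - U) - {r}. \<epsilon> v U * ?s (insert v U)) = 0"
    proof (rule sum.neutral, intro ballI)
      fix v assume "v \<in> W - U - {r}"
      then show "\<epsilon> v U * ?s (insert v U) = 0" using others[of v] by (auto simp: WU)
    qed
    finally have "\<epsilon> r U * ?s (insert r U) = 0" by simp
    then show ?thesis by (simp add: sign_nz ins p_def)
  qed
qed

text \<open>The bounding chain is the cone over \<open>cone_point\<close>. It bounds in every multidegree and at every face with three
or more points, because coning keeps a face on its line. At vertices the cone from the base point stays
inside the complete graph. At edges it does not, and the failure is the value on a loop.\<close>

lemma cycle_is_boundary:
  assumes i: "i \<ge> 1" and z: "z \<in> cycles_mod i"
    and coord: "\<And>x. x \<in> cycle_index i \<Longrightarrow> cycle_coord z x = 0"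
  shows "\<exists>w\<in>kchains (Suc i). \<forall>S. (z - kbd w) S \<in> I\<Lambda>"
proof (intro bexI allI)
  have zk: "z \<in> kchains i" and zc: "kbd z S \<in> I\<Lambda>" for S using z by (auto simp: cycles_mod_def)
  let ?w = "kcone cone_point z"
  show w: "?w \<in> kchains (Suc i)" by (rule kcone_kchains[OF zk])
  fix S
  show "(z - kbd ?w) S \<in> I\<Lambda>"
  proof (rule mem_of_strand_zero)
    show "z - kbd ?w \<in> kchains i"
      using zk kbd_kchains[OF w] by (simp add: kchains_def)
    fix m :: "'p \<Rightarrow>\<^sub>0 nat" and S
    assume m: "supp m \<subseteq> P" and S: "S \<subseteq> supp m" "card S = i" and A: "supp (m - sqfree_exp S) \<in> \<Lambda>"
    have finm: "finite (supp m)" and finS: "finite S" using finite_sub m S finite_subset by simp_all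
    have "strand (kbd ?w) m S = strand z m S"
    proof (cases m rule: sqfree_or_multiple)
      \<comment> \<open>The variable of \<open>v0\<close> still occurs in \<open>m - S\<close>, so \<open>S\<close> and \<open>S - {v0}\<close> have the same complementary face.\<close>
      case (2 v)
      define v0 where "v0 = (SOME v. 2 \<le> coef m v)"
      have v0: "2 \<le> coef m v0" unfolding v0_def by (rule someI) (rule 2)
      have c: "cone_point m T = v0" for T using 2 by (auto simp: cone_point_def v0_def)
      show ?thesis
      proof (rule strand_kbd_kcone[OF m S(1)])
        show "v0 \<in> supp m" using v0 by (simp add: in_keys_iff)
        show "cone_point m (insert u S) = v0" for u by (rule c)
        assume "v0 \<in> S"
        have "supp (m - sqfree_exp (S - {v0})) = supp (m - sqfree_exp S)"
          using v0 finS by (auto simp: set_eq_iff in_keys_iff lookup_minus coef_sqfree_exp)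
        then show "strand (kbd z) m (S - {v0}) = 0" using A by (intro strand_zero_of_mem zc) simp
      qed
    next
      case 1
      define W where "W = supp m"
      have mW: "m = sqfree_exp W" and finW: "finite W" and WP: "W \<subseteq> P" and SW: "S \<subseteq> W"
        using 1 finm m S by (simp_all add: W_def)
      define A where "A = W - S"
      have face: "A \<in> \<Lambda>" using A finW SW by (simp add: mW A_def supp_sqfree_diff)
      have finA: "finite A" using finW by (simp add: A_def)
      have SA: "S = W - A" using SW by (auto simp: A_def)
      have not_mult: "\<not> (\<exists>v. 2 \<le> coef m v)" using finW by (auto simp: mW coef_sqfree_exp)
      have cyc: "strand (kbd z) m (S - {v}) = 0" if "v \<in> W" "insert v A \<in> \<Lambda>" for v
      proof (rule strand_zero_of_mem)
        show "kbd z (S - {v}) \<in> I\<Lambda>" by (rule zc)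
        have "W - (S - {v}) = insert v A" using that SW by (auto simp: A_def)
        then show "supp (m - sqfree_exp (S - {v})) \<in> \<Lambda>"
          using that finW SW by (subst mW, subst supp_sqfree_diff) auto
      qed
      show ?thesis
      proof (cases "card A \<le> 2")
        case small: True
        define p where "p = pt W"
        have "W \<noteq> {}" using S i SW by auto
        then have p: "p \<in> W" by (auto simp: p_def intro: pt_in)
        show ?thesis
        proof (rule strand_kbd_kcone[OF m S(1)])
          show "p \<in> supp m" using p by (simp add: W_def)
          fix u assume u: "u \<in> supp m - S"
          then have "supp m - insert u S = A - {u}" "u \<in> A" by (auto simp: A_def W_def)
          moreover have "card (A - {u}) \<le> 1"
            using small card_Diff_singleton[OF \<open>u \<in> A\<close>] by linarith
          ultimately show "cone_point m (insert u S) = p"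
            using not_mult by (simp add: cone_point_def p_def W_def)
        next
          assume pS: "p \<in> S"
          \<comment> \<open>Coning from \<open>p\<close> turns an edge into a triangle, which may fail to be a face.\<close>
          show "strand (kbd z) m (S - {p}) = 0"
          proof (cases "card A = 2")
            case False
            then have "card (insert p A) \<le> 2" using small by (simp add: card_insert_if finA)
            moreover have "insert p A \<subseteq> P" using p WP by (auto simp: A_def)
            ultimately show ?thesis by (intro cyc p face_card_le_2)
          next
            case True
            then obtain a b where ab: "A = {a, b}" "a \<noteq> b" by (auto simp: card_2_iff)
            obtain l where l: "l \<in> L" "A \<subseteq> l" using face by (auto simp: face_iff)
            show ?thesis
            proof (cases "p \<in> l")
              case True
              then show ?thesis using l by (intro cyc p) (auto simp: face_iff)
            next
              case False
              have cardW: "card W = i + 2"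
                using True S(2) card_Diff_subset[OF finS SW] card_mono[OF finW SW] by (simp add: A_def)
              have "S - {p} = W - {pt W, a, b}" using SA ab by (auto simp: p_def)
              moreover have "strand (kbd z) (sqfree_exp W) (W - {pt W, a, b}) = 0"
                by (rule triangle_coord_zero[OF z coord WP cardW l(1)])
                  (use False l ab in \<open>auto simp: p_def A_def\<close>)
              ultimately show ?thesis by (simp add: mW)
            qed
          qed
        qed
      next
        case big: False
        obtain l where l: "l \<in> L" "A \<subseteq> l" using face by (auto simp: face_iff)
        define v0 where "v0 = pt (l \<inter> W)"
        obtain a where "a \<in> A" using big by fastforce
        then have "a \<in> l \<inter> W" using l by (auto simp: A_def)
        then have v0: "v0 \<in> l" "v0 \<in> W" using pt_in[of a "l \<inter> W"] by (auto simp: v0_def)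
        show ?thesis
        proof (rule strand_kbd_kcone[OF m S(1)])
          show "v0 \<in> supp m" using v0 by (simp add: W_def)
          show "strand (kbd z) m (S - {v0}) = 0" using v0 l by (intro cyc) (auto simp: face_iff)
          fix u assume u: "u \<in> supp m - S"
          then have eq: "supp m - insert u S = A - {u}" "u \<in> A" by (auto simp: A_def W_def)
          have card: "2 \<le> card (A - {u})" using big finA eq by simp
          then have "line_of (A - {u}) = l" using l by (intro line_of_eq) auto
          then show "cone_point m (insert u S) = v0"
            using not_mult card by (simp add: cone_point_def eq v0_def W_def)
        qed
      qed
    qed
    then show "strand (z - kbd ?w) m S = 0" by (simp add: strand_def lookup_minus)
  qed
qed

text \<open>All edges of the triangle are faces, so a chain that is a boundary modulo the ideal agrees with the boundary \<open>kbd w\<close>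
itself on the edges, and the value on the loop is a coefficient of \<open>kbd (kbd w)\<close>.\<close>

lemma boundary_coord_zero:
  assumes z: "z \<in> kchains i" and zw: "\<And>S. (z - kbd w) S \<in> I\<Lambda>" and x: "x \<in> cycle_index i"
  shows "cycle_coord z x = 0"
proof -
  obtain W l q where x': "x = (W, l, q)" by (cases x)
  have W: "W \<subseteq> P" "card W = i + 2" and l: "l \<in> L" and q: "q \<in> l" "q \<in> W"
    using x by (auto simp: cycle_index_def x')
  have finW: "finite W" using finite_sub W by simp
  define p r where "p = pt W" and "r = pt (l \<inter> W)"
  have p: "p \<in> W" using q by (auto simp: p_def intro: pt_in)
  have r: "r \<in> W" using pt_in[of q "l \<inter> W"] q by (auto simp: r_def)
  define T where "T = W - {p, r, q}"
  have WT: "W - T = {p, r, q}" using p r q by (auto simp: T_def)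
  have eq: "strand z (sqfree_exp W) (insert v T) = strand (kbd w) (sqfree_exp W) (insert v T)" if "v \<in> W - T" for v
  proof -
    have "W - insert v T = {p, r, q} - {v}" using WT by auto
    moreover have "card ({p, r, q} - {v}) \<le> 2"
    proof -
      have "card {p, r, q} \<le> 3" by (simp add: card_insert_if)
      then show ?thesis using that WT by simp
    qed
    ultimately have "W - insert v T \<in> \<Lambda>" using p r q W by (intro face_card_le_2) auto
    moreover have "insert v T \<subseteq> W" using that by (auto simp: T_def)
    ultimately have "strand (z - kbd w) (sqfree_exp W) (insert v T) = 0"
      by (intro strand_zero_of_mem zw) (simp add: supp_sqfree_diff finW)
    then show ?thesis by (simp add: strand_def lookup_minus)
  qed
  have TW: "T \<subseteq> W" by (auto simp: T_def)
  have "strand (kbd z) (sqfree_exp W) T = strand_bd W (strand z (sqfree_exp W)) T"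
    using W finW TW by (subst strand_kbd) auto
  also have "\<dots> = strand_bd W (strand_bd W (strand w (sqfree_exp W))) T"
  proof (rule strand_bd_cong)
    fix v assume v: "v \<in> W - T"
    then show "strand z (sqfree_exp W) (insert v T) = strand_bd W (strand w (sqfree_exp W)) (insert v T)"
      unfolding eq[OF v] using W finW TW by (subst strand_kbd) auto
  qed
  also have "\<dots> = 0" by (rule strand_bd_strand_bd[OF W(1) TW])
  finally show ?thesis by (simp add: cycle_coord_def x' T_def p_def r_def)
qed

text \<open>The coboundary of the indicator function of the vertex \<open>q\<close>.\<close>

definition line_cochain :: "'p set \<Rightarrow> 'p set \<Rightarrow> 'p \<Rightarrow> 'p set \<Rightarrow> 'k" where
  "line_cochain W l q S = strand_bd W (\<lambda>S'. if S' = W - {q} then 1 else 0) S"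

text \<open>A cocycle dual to a loop: the coboundary of the vertex \<open>q\<close>, cut down to the edges of \<open>l\<close>. On \<open>l\<close> it remains
a coboundary, and no triangle outside \<open>l\<close> that is a face has an edge in \<open>l\<close>.\<close>

definition basic_cycle :: "nat \<Rightarrow> 'p set \<times> 'p set \<times> 'p \<Rightarrow> 'p set \<Rightarrow> ('p, 'k) mpoly" where
  "basic_cycle i = (\<lambda>(W, l, q) S. if S \<subseteq> W \<and> card S = i \<and> W - S \<subseteq> l
     then monom_mp (sqfree_exp (W - S)) (line_cochain W l q S) else 0)"

lemma strand_basic_cycle:
  assumes "finite W" "S \<subseteq> supp m"
  shows "strand (basic_cycle i (W, l, q)) m S =
    (if m = sqfree_exp W \<and> card S = i \<and> W - S \<subseteq> l then line_cochain W l q S else 0)"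
proof (cases "S \<subseteq> W")
  case True
  have finS: "finite S" using True assms finite_subset by blast
  have "sqfree_exp (W - S) = m - sqfree_exp S \<longleftrightarrow> m = sqfree_exp W"
  proof
    assume h: "sqfree_exp (W - S) = m - sqfree_exp S"
    show "m = sqfree_exp W"
    proof (rule poly_mapping_eqI)
      fix v
      have "coef (sqfree_exp (W - S)) v = coef (m - sqfree_exp S) v" by (simp add: h)
      moreover have "v \<in> S \<Longrightarrow> coef m v \<noteq> 0" using assms by (auto simp: in_keys_iff)
      ultimately show "coef m v = coef (sqfree_exp W) v"
        using assms finS True by (auto simp: lookup_minus coef_sqfree_exp split: if_splits)
    qed
  next
    assume "m = sqfree_exp W"
    then show "sqfree_exp (W - S) = m - sqfree_exp S"
      using assms finS True
      by (intro poly_mapping_eqI) (auto simp: lookup_minus coef_sqfree_exp)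
  qed
  then have eq: "coef (monom_mp (sqfree_exp (W - S)) c) (m - sqfree_exp S) = (if m = sqfree_exp W then c else 0)"
    for c :: 'k
    by (simp only: lookup_single when_def)
  have "strand (basic_cycle i (W, l, q)) m S = (if card S = i \<and> W - S \<subseteq> l
      then coef (monom_mp (sqfree_exp (W - S)) (line_cochain W l q S)) (m - sqfree_exp S) else 0)"
    using True by (simp add: strand_def basic_cycle_def)
  then show ?thesis unfolding eq by auto
next
  case False
  then have "m \<noteq> sqfree_exp W" using assms by auto
  then show ?thesis using False by (simp add: strand_def basic_cycle_def)
qed

lemma basic_cycle_kchains:
  assumes "x \<in> cycle_index i" shows "basic_cycle i x \<in> kchains i"
proof -
  obtain W l q where x': "x = (W, l, q)" by (cases x)
  then have W: "W \<subseteq> P" using assms by (auto simp: cycle_index_def)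
  then have "finite W" using finite_sub by simp
  then show ?thesis using W
    by (auto simp: kchains_def basic_cycle_def x' intro!: polys_monom)
qed

text \<open>Two lines sharing an edge are equal. Hence a triangle that is a face either lies on \<open>l\<close>, where the cochain is a
coboundary, or has no edge on \<open>l\<close>, where the cochain vanishes.\<close>

lemma basic_cycle_cycles_mod:
  assumes i: "i \<ge> 1" and x: "x \<in> cycle_index i" shows "basic_cycle i x \<in> cycles_mod i"
proof -
  obtain W l q where x': "x = (W, l, q)" by (cases x)
  then have W: "W \<subseteq> P" "card W = i + 2" and l: "l \<in> L" using x by (auto simp: cycle_index_def)
  have finW: "finite W" using finite_sub[OF W(1)] .
  note k = basic_cycle_kchains[OF x]
  obtain i' where i': "i = Suc i'" using i by (cases i) auto
  have bd: "kbd (basic_cycle i x) \<in> kchains i'" using k by (auto simp: i' intro: kbd_kchains)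
  have "kbd (basic_cycle i x) S \<in> I\<Lambda>" for S
  proof (rule mem_of_strand_zero[OF bd])
    fix m :: "'p \<Rightarrow>\<^sub>0 nat" and T
    assume m: "supp m \<subseteq> P" and T: "T \<subseteq> supp m" "card T = i'" and A: "supp (m - sqfree_exp T) \<in> \<Lambda>"
    have eq: "strand (kbd (basic_cycle i x)) m T = strand_bd (supp m) (strand (basic_cycle i x) m) T"
      using m T by (subst strand_kbd) auto
    have str: "strand (basic_cycle i x) m (insert v T) =
      (if m = sqfree_exp W \<and> W - insert v T \<subseteq> l then line_cochain W l q (insert v T) else 0)"
      if "v \<in> supp m - T" for v
    proof -
      have "card (insert v T) = i" using that T finite_subset[OF T(1)] by (simp add: i')
      then show ?thesis using that T by (simp add: x' strand_basic_cycle finW)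
    qed
    show "strand (kbd (basic_cycle i x)) m T = 0"
    proof (cases "m = sqfree_exp W")
      case False
      then show ?thesis unfolding eq strand_bd_def using str by simp
    next
      case True
      then have sm: "supp m = W" and TW: "T \<subseteq> W" using finW T by simp_all
      have face: "W - T \<in> \<Lambda>" using A finW TW by (simp add: True supp_sqfree_diff)
      have cA: "card (W - T) = 3"
        using T(2) W(2) i' card_Diff_subset[OF finite_subset[OF TW finW] TW] by simp
      show ?thesis
      proof (cases "W - T \<subseteq> l")
        case sub: True
        have "strand_bd (supp m) (strand (basic_cycle i x) m) T = strand_bd W (line_cochain W l q) T"
          unfolding sm by (rule strand_bd_cong) (use sub str True finW in auto)
        also have "\<dots> = 0"
          unfolding line_cochain_def[abs_def] by (rule strand_bd_strand_bd[OF W(1) TW])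
        finally show ?thesis by (simp add: eq)
      next
        case nsub: False
        obtain l' where l': "l' \<in> L" "W - T \<subseteq> l'" using face by (auto simp: face_iff)
        have no: "\<not> W - insert v T \<subseteq> l" if "v \<in> W - T" for v
        proof
          assume "W - insert v T \<subseteq> l"
          moreover have "W - insert v T = (W - T) - {v}" by auto
          moreover have "card ((W - T) - {v}) = 2" using cA that by simp
          ultimately have "l = l'" using l l' by (intro face_line_unique[of l l' "W - insert v T"]) auto
          then show False using nsub l' by simp
        qed
        have "strand (basic_cycle i x) m (insert v T) = 0" if "v \<in> W - T" for v
          using str[of v] that sm no[OF that] by simp
        then show ?thesis unfolding eq strand_bd_def sm by simp
      qed
    qed
  qed
  then show ?thesis using k by (simp add: cycles_mod_def)
qed

text \<open>Of the edges of the loop \<open>p\<close>, \<open>r\<close>, \<open>q'\<close> only \<open>r q'\<close> avoids \<open>p\<close>, so the loop sees the cochain of \<open>(W, l, q)\<close> only if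
that edge lies on \<open>l\<close>; and there the coboundary of \<open>q\<close> is nonzero only on edges at \<open>q\<close>, while \<open>r \<noteq> q\<close>.\<close>

lemma coord_basic_cycle:
  assumes x: "x \<in> cycle_index i" and y: "y \<in> cycle_index i"
  shows "cycle_coord (basic_cycle i x) y = 0 \<longleftrightarrow> y \<noteq> x"
proof -
  obtain W l q where x': "x = (W, l, q)" by (cases x)
  have W: "W \<subseteq> P" "card W = i + 2" and l: "l \<in> L" "pt W \<notin> l" and q: "q \<in> l" "q \<in> W" "q \<noteq> pt (l \<inter> W)"
    using x by (auto simp: cycle_index_def x')
  obtain W' l' q' where y': "y = (W', l', q')" by (cases y)
  have W': "W' \<subseteq> P" "card W' = i + 2" and l': "l' \<in> L" "pt W' \<notin> l'"
    and q': "q' \<in> l'" "q' \<in> W'" "q' \<noteq> pt (l' \<inter> W')"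
    using y by (auto simp: cycle_index_def y')
  have fin: "finite W" "finite W'" using finite_sub W W' by auto
  define p r where "p = pt W'" and "r = pt (l' \<inter> W')"
  have p: "p \<in> W'" "p \<notin> l'" using q' l' by (auto simp: p_def intro: pt_in)
  have r: "r \<in> l'" "r \<in> W'" using pt_in[of q' "l' \<inter> W'"] q' by (auto simp: r_def)
  have rq': "r \<noteq> q'" using q' by (simp add: r_def)
  define T where "T = W' - {p, r, q'}"
  have WT: "W' - T = {p, r, q'}" using p r q' by (auto simp: T_def)
  have TW: "T \<subseteq> W'" by (auto simp: T_def)
  have cT: "card (insert v T) = i" if "v \<in> {p, r, q'}" for v
  proof -
    have "card {p, r, q'} = 3" using p r q' rq' by (auto simp: card_insert_if)
    then have "card T + 1 = i"
      using W' card_Diff_subset[of "{p, r, q'}" W'] p r q' card_mono[of W' "{p, r, q'}"] fin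
      by (simp add: T_def)
    moreover have "v \<notin> T" "finite T" using that fin by (auto simp: T_def)
    ultimately show ?thesis by simp
  qed
  have co: "cycle_coord (basic_cycle i x) y = strand_bd W' (strand (basic_cycle i x) (sqfree_exp W')) T"
  proof -
    have "cycle_coord (basic_cycle i x) y = strand (kbd (basic_cycle i x)) (sqfree_exp W') T"
      by (simp only: cycle_coord_def y' prod.case T_def p_def r_def)
    also have "\<dots> = strand_bd (supp (sqfree_exp W')) (strand (basic_cycle i x) (sqfree_exp W')) T"
      by (rule strand_kbd) (use W' fin TW in auto)
    finally show ?thesis using fin by simp
  qed
  have str: "strand (basic_cycle i x) (sqfree_exp W') (insert v T) =
      (if W' = W \<and> W - insert v T \<subseteq> l then line_cochain W l q (insert v T) else 0)"
    if "v \<in> W' - T" for v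
  proof -
    have iff: "sqfree_exp W' = sqfree_exp W \<longleftrightarrow> W' = W" using fin by (metis supp_sqfree_exp)
    have sub: "insert v T \<subseteq> supp (sqfree_exp W')" using that TW fin by auto
    have card: "card (insert v T) = i" using that WT by (intro cT) simp
    show ?thesis unfolding x' strand_basic_cycle[OF fin(1) sub] iff card by simp
  qed
  show ?thesis
  proof (cases "W' = W")
    case False
    then show ?thesis unfolding co strand_bd_def using str by (simp add: x' y')
  next
    case True
    note [simp] = True
    have "p \<notin> l" using l by (simp add: p_def)
    have "\<not> W - insert v T \<subseteq> l" if "v = r \<or> v = q'" for v
      using that p \<open>p \<notin> l\<close> r q' by (auto simp: T_def)
    then have co2: "cycle_coord (basic_cycle i x) y = \<epsilon> p T * strand (basic_cycle i x) (sqfree_exp W') (insert p T)"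
      unfolding co strand_bd_def WT
      using str WT p r q' fin
      by (subst sum.remove[of _ p]) (auto intro!: sum.neutral)
    have pWT: "p \<in> W' - T" unfolding WT by simp
    have ins: "insert p T = W - {r, q'}" using p r q' by (auto simp: T_def)
    have comp: "W - (W - {r, q'}) = {r, q'}" using r q' by auto
    show ?thesis
    proof (cases "l' = l")
      case False
      then have "\<not> {r, q'} \<subseteq> l" using line_unique[of l l' r q'] l l' r q' rq' by auto
      then show ?thesis using False str[OF pWT] unfolding co2 by (auto simp: ins comp x' y')
    next
      case ll: True
      have rq: "r \<noteq> q" using q ll by (simp add: r_def)
      have sub: "{r, q'} \<subseteq> l" using r q' ll by simp
      have v1: "insert r (W - {r, q'}) = W - {q'}" "insert q' (W - {r, q'}) = W - {r}" using r q' rq' by auto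
      have e1: "W - {q'} = W - {q} \<longleftrightarrow> q' = q" using q q' by auto
      have e2: "W - {r} \<noteq> W - {q}" using q r rq by auto
      have "line_cochain W l q (insert p T) = (if q' = q then \<epsilon> r (W - {r, q'}) else 0)"
        unfolding line_cochain_def strand_bd_def ins comp using rq' e1 e2 by (simp add: v1)
      moreover have "strand (basic_cycle i x) (sqfree_exp W') (insert p T) = line_cochain W l q (insert p T)"
        using str[OF pWT] sub by (simp add: ins comp)
      ultimately have "cycle_coord (basic_cycle i x) y = (if q' = q then \<epsilon> p T * \<epsilon> r (W - {r, q'}) else 0)"
        by (simp add: co2)
      then show ?thesis using sign_nz by (simp add: x' y' ll)
    qed
  qed
qed

end

definition tdeg :: "('p \<Rightarrow>\<^sub>0 nat) \<Rightarrow> nat" where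
  "tdeg n = (\<Sum>v\<in>supp n. coef n v)"

lemma tdeg_sqfree: "finite S \<Longrightarrow> tdeg (sqfree_exp S) = card S"
  unfolding tdeg_def by (simp add: coef_sqfree_exp)

context koszul_linear_space begin

lemma strand_add: "strand (z + z') m S = strand z m S + strand z' m S"
  by (simp add: strand_def lookup_add)

lemma kbd_add: "kbd (z + z') = kbd z + kbd z'"
  by (rule ext) (simp add: kbd_def distrib_left sum.distrib)

lemma kbd_scale: "kbd (\<lambda>S. r * z S) = (\<lambda>S. r * kbd z S)"
  by (rule ext) (simp add: kbd_def sum_distrib_left mult.left_commute)

lemma cycle_coord_add: "cycle_coord (z + z') x = cycle_coord z x + cycle_coord z' x"
  by (cases x) (simp add: cycle_coord_def kbd_add strand_add)

lemma cycle_coord_scale: "cycle_coord (\<lambda>S. monom_mp 0 c * z S) x = c * cycle_coord z x"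
  by (cases x) (simp add: cycle_coord_def kbd_scale strand_def coef_const_mult)

lemma cycle_coord_zero: "cycle_coord 0 x = 0"
  by (cases x) (simp add: cycle_coord_def kbd_def strand_def)

lemma kchains_add: "z \<in> kchains i \<Longrightarrow> z' \<in> kchains i \<Longrightarrow> z + z' \<in> kchains i"
  by (simp add: kchains_def)

lemma kchains_scale: "r \<in> polys P \<Longrightarrow> z \<in> kchains i \<Longrightarrow> (\<lambda>S. r * z S) \<in> kchains i"
  by (simp add: kchains_def)

lemma nonface_ideal_mult:
  assumes r: "r \<in> polys P" and f: "f \<in> I\<Lambda>" shows "r * f \<in> I\<Lambda>"
  unfolding nonface_ideal_def
proof (intro CollectI conjI ballI)
  show "r * f \<in> polys P" using r f by (simp add: nonface_ideal_def)
  fix n assume "n \<in> supp (r * f)"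
  then obtain a b where n: "n = a + b" "b \<in> supp f" using keys_mult[of r f] by blast
  then have "supp b \<notin> \<Lambda>" using f by (simp add: nonface_ideal_def)
  then show "supp n \<notin> \<Lambda>" using face_sub[of "supp n" "supp b"] by (auto simp: n supp_add_exp)
qed

lemma cycles_mod_add: "z \<in> cycles_mod i \<Longrightarrow> z' \<in> cycles_mod i \<Longrightarrow> z + z' \<in> cycles_mod i"
  by (simp add: cycles_mod_def kchains_add kbd_add nonface_ideal_add)

lemma cycles_mod_scale: "r \<in> polys P \<Longrightarrow> z \<in> cycles_mod i \<Longrightarrow> (\<lambda>S. r * z S) \<in> cycles_mod i"
  by (simp add: cycles_mod_def kchains_scale kbd_scale nonface_ideal_mult)

lemma cycles_mod_zero: "0 \<in> cycles_mod i"
  by (simp add: cycles_mod_def kchains_zero kbd_def)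

lemma finite_cycle_index: "finite (cycle_index i)"
proof (rule finite_subset)
  show "cycle_index i \<subseteq> Pow P \<times> L \<times> P" using line_sub by (auto simp: cycle_index_def)
  show "finite (Pow P \<times> L \<times> P)" using finite_points finite_lines by simp
qed

lemma basic_cycle_tdeg:
  assumes "x \<in> cycle_index i" "n \<in> supp (basic_cycle i x S)" shows "tdeg n = 2"
proof -
  obtain W l q where x: "x = (W, l, q)" by (cases x)
  have W: "W \<subseteq> P" "card W = i + 2" using assms(1) by (auto simp: x cycle_index_def)
  have S: "S \<subseteq> W" "card S = i" "n = sqfree_exp (W - S)"
    using assms(2) by (auto simp: x basic_cycle_def split: if_splits)
  have "finite W" using finite_sub W by simp
  then show ?thesis using S W by (simp add: tdeg_sqfree card_Diff_subset finite_subset)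
qed

text \<open>Combinations of the basic cycles realise all values. Their coefficients have degree two, which becomes the concentration
of \<open>Tor\<^sub>i\<close> in degree \<open>i + 2\<close>.\<close>

lemma cycle_coord_surj:
  assumes i: "i \<ge> 1"
  shows "\<exists>z\<in>cycles_mod i. (\<forall>x\<in>cycle_index i. cycle_coord z x = t x) \<and> (\<forall>S. \<forall>n\<in>supp (z S). tdeg n = 2)"
proof -
  have "\<exists>z\<in>cycles_mod i. (\<forall>x\<in>cycle_index i. cycle_coord z x = (if x \<in> Y then t x else 0)) \<and>
      (\<forall>S. \<forall>n\<in>supp (z S). tdeg n = 2)" if "finite Y" "Y \<subseteq> cycle_index i" for Y
    using that
  proof (induction Y rule: finite_induct)
    case empty
    show ?case
    proof (intro bexI[of _ 0] conjI ballI allI)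
      show "tdeg n = 2" if "n \<in> supp ((0 :: 'p set \<Rightarrow> ('p, 'k) mpoly) S)" for S n using that by simp
    qed (simp_all only: cycle_coord_zero cycles_mod_zero empty_iff if_False)
  next
    case (insert y Y)
    then obtain z where z: "z \<in> cycles_mod i"
      "\<And>x. x \<in> cycle_index i \<Longrightarrow> cycle_coord z x = (if x \<in> Y then t x else 0)"
      "\<And>S n. n \<in> supp (z S) \<Longrightarrow> tdeg n = 2" by auto
    have y: "y \<in> cycle_index i" using insert.prems by simp
    define b where "b = basic_cycle i y"
    define c where "c = t y / cycle_coord b y"
    have b: "b \<in> cycles_mod i" unfolding b_def by (rule basic_cycle_cycles_mod[OF i y])
    have nz: "cycle_coord b y \<noteq> 0" using coord_basic_cycle[OF y y] by (simp add: b_def)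
    let ?z = "z + (\<lambda>S. monom_mp 0 c * b S)"
    show ?case
    proof (intro bexI[of _ ?z] conjI ballI allI)
      show "?z \<in> cycles_mod i" by (intro cycles_mod_add z cycles_mod_scale b polys_monom) simp
      fix x assume x: "x \<in> cycle_index i"
      show "cycle_coord ?z x = (if x \<in> insert y Y then t x else 0)"
      proof (cases "x = y")
        case True
        then show ?thesis
          using z(2)[OF x] insert.hyps nz by (simp add: cycle_coord_add cycle_coord_scale c_def)
      next
        case False
        then have "cycle_coord b x = 0" using coord_basic_cycle[OF y x] by (simp add: b_def)
        then show ?thesis
          using z(2)[OF x] False by (simp add: cycle_coord_add cycle_coord_scale)
      qed
    next
      fix S n assume "n \<in> supp (?z S)"
      then have "coef (z S) n \<noteq> 0 \<or> coef (b S) n \<noteq> 0"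
        by (auto simp: in_keys_iff lookup_add coef_const_mult)
      then show "tdeg n = 2"
        using z(3)[of n S] basic_cycle_tdeg[OF y, of n S] by (auto simp: in_keys_iff b_def)
    qed
  qed
  from this[OF finite_cycle_index subset_refl] obtain z where "z \<in> cycles_mod i"
    "\<forall>x\<in>cycle_index i. cycle_coord z x = (if x \<in> cycle_index i then t x else 0)"
    "\<forall>S. \<forall>n\<in>supp (z S). tdeg n = 2" by blast
  then show ?thesis by (intro bexI[of _ z]) simp_all
qed

end

section \<open>Counting the loops\<close>

lemma card_subsets_containing:
  assumes "finite P" "q \<in> P"
  shows "card {W. W \<subseteq> P \<and> card W = Suc n \<and> q \<in> W} = (card P - 1) choose n"
proof -
  have "bij_betw (insert q) {W. W \<subseteq> P - {q} \<and> card W = n} {W. W \<subseteq> P \<and> card W = Suc n \<and> q \<in> W}"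
  proof (rule bij_betwI[where g = "\<lambda>W. W - {q}"])
    show "insert q \<in> {W. W \<subseteq> P - {q} \<and> card W = n} \<rightarrow> {W. W \<subseteq> P \<and> card W = Suc n \<and> q \<in> W}"
    proof
      fix W assume W: "W \<in> {W. W \<subseteq> P - {q} \<and> card W = n}"
      then have "finite W" "q \<notin> W" using assms finite_subset[of W P] by auto
      then show "insert q W \<in> {W. W \<subseteq> P \<and> card W = Suc n \<and> q \<in> W}" using W assms by auto
    qed
    show "(\<lambda>W. W - {q}) \<in> {W. W \<subseteq> P \<and> card W = Suc n \<and> q \<in> W} \<rightarrow> {W. W \<subseteq> P - {q} \<and> card W = n}"
      by auto
  qed auto
  then have "card {W. W \<subseteq> P \<and> card W = Suc n \<and> q \<in> W} = card {W. W \<subseteq> P - {q} \<and> card W = n}"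
    by (simp add: bij_betw_same_card)
  also have "\<dots> = (card P - 1) choose n" using assms by (simp add: n_subsets)
  finally show ?thesis .
qed

context finite_linear_space begin

text \<open>Every line has at least two points, so the sum over the sizes may start anywhere up to two.\<close>

lemma sum_lines_of_size:
  fixes f :: "nat \<Rightarrow> int"
  assumes "a \<le> 2"
  shows "(\<Sum>k = a..card P. f k * int (lines_of_size L k)) = (\<Sum>l\<in>L. f (card l))"
proof -
  have "(\<Sum>l\<in>L. f (card l)) = (\<Sum>k = a..card P. \<Sum>l\<in>{l \<in> L. card l = k}. f (card l))"
  proof (rule sum.group[symmetric])
    show "card ` L \<subseteq> {a..card P}"
      using assms card_line card_mono[OF finite_points line_sub] by fastforce
  qed (use finite_lines in auto)
  also have "\<dots> = (\<Sum>k = a..card P. f k * int (lines_of_size L k))"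
    by (rule sum.cong) (auto simp: lines_of_size_def)
  finally show ?thesis by simp
qed

text \<open>Every pair of points lies on one line. This makes the last bracket of the formula vanish.\<close>

lemma sum_card_pairs: "(\<Sum>l\<in>L. card l choose 2) = card P choose 2"
proof -
  have "{A. A \<subseteq> P \<and> card A = 2} = (\<Union>l\<in>L. {A. A \<subseteq> l \<and> card A = 2})" (is "?l = ?r")
  proof
    show "?r \<subseteq> ?l" using line_sub by auto
    show "?l \<subseteq> ?r"
      using face_card_le_2 by (auto simp: face_iff)
  qed
  then have "card P choose 2 = card (\<Union>l\<in>L. {A. A \<subseteq> l \<and> card A = 2})"
    using finite_points by (simp flip: n_subsets)
  also have "\<dots> = (\<Sum>l\<in>L. card {A. A \<subseteq> l \<and> card A = 2})"
  proof (rule card_UN_disjoint[OF finite_lines])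
    show "\<forall>l\<in>L. finite {A. A \<subseteq> l \<and> card A = 2}" using finite_line by auto
    show "\<forall>l\<in>L. \<forall>l'\<in>L. l \<noteq> l' \<longrightarrow> {A. A \<subseteq> l \<and> card A = 2} \<inter> {A. A \<subseteq> l' \<and> card A = 2} = {}"
    proof (intro ballI impI equals0I)
      fix l l' A assume "l \<in> L" "l' \<in> L" "l \<noteq> l'"
        "A \<in> {A. A \<subseteq> l \<and> card A = 2} \<inter> {A. A \<subseteq> l' \<and> card A = 2}"
      then show False using face_line_unique[of l l' A] by simp
    qed
  qed
  also have "\<dots> = (\<Sum>l\<in>L. card l choose 2)"
    by (rule sum.cong) (auto simp: n_subsets finite_line)
  finally show ?thesis by simp
qed

lemma sum_lines_through:
  assumes "W \<subseteq> P" "p \<in> W"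
  shows "(\<Sum>l\<in>{l \<in> L. p \<in> l}. card (l \<inter> W - {p})) = card W - 1"
proof -
  have fin: "finite W" using assms finite_points finite_subset by blast
  have "W - {p} = (\<Union>l\<in>{l \<in> L. p \<in> l}. l \<inter> W - {p})"
    using assms line_exists[of p] by blast
  then have "card (W - {p}) = card (\<Union>l\<in>{l \<in> L. p \<in> l}. l \<inter> W - {p})" by simp
  also have "\<dots> = (\<Sum>l\<in>{l \<in> L. p \<in> l}. card (l \<inter> W - {p}))"
  proof (rule card_UN_disjoint)
    show "\<forall>l\<in>{l \<in> L. p \<in> l}. \<forall>l'\<in>{l \<in> L. p \<in> l}. l \<noteq> l' \<longrightarrow> (l \<inter> W - {p}) \<inter> (l' \<inter> W - {p}) = {}"
      using line_unique by blast
  qed (use finite_lines fin in auto)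
  finally show ?thesis using assms fin by simp
qed

end

context koszul_linear_space begin

text \<open>For fixed \<open>W\<close> the loops number \<open>card (l \<inter> W) - 1\<close> summed over the lines that miss \<open>pt W\<close> and meet \<open>W\<close>. The lines
through \<open>pt W\<close> partition the other points of \<open>W\<close>, so extending the sum to all lines that meet \<open>W\<close> costs exactly
\<open>card W - 1\<close>. The choice of \<open>pt W\<close> has then disappeared, and the sum over \<open>W\<close> is binomial.\<close>

lemma card_cycle_index:
  "int (card (cycle_index i)) =
     (\<Sum>l\<in>L. int ((card P - card l) choose (i + 2))) - int (card P choose (i + 2)) * (- 1 + int (card L))
     + int ((card P - 1) choose (i + 1)) * (- int (card P) + (\<Sum>l\<in>L. int (card l)))"
proof -
  define n where "n = i + 2"
  define Ws where "Ws = {W. W \<subseteq> P \<and> card W = n}"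
  have finWs: "finite Ws" using finite_points by (simp add: Ws_def)
  have cWs: "card Ws = card P choose n" using finite_points by (simp add: Ws_def n_subsets)
  \<comment> \<open>The last summand corrects \<open>-1\<close> to \<open>0\<close> for lines that miss \<open>W\<close>; these produce the terms
    \<open>(card P - card l) choose (i + 2)\<close>.\<close>
  define g where "g l W = int (card (l \<inter> W)) - 1 + (if l \<inter> W = {} then 1 else 0)" for l W :: "'p set"
  have per: "int (card (SIGMA l:{l \<in> L. pt W \<notin> l}. l \<inter> W - {pt (l \<inter> W)})) = (\<Sum>l\<in>L. g l W) - (int n - 1)"
    if W: "W \<in> Ws" for W
  proof -
    have W': "W \<subseteq> P" "card W = n" "finite W" using W finite_points finite_subset by (auto simp: Ws_def)
    then have "W \<noteq> {}" by (auto simp: n_def)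
    then have p: "pt W \<in> W" by (auto intro: pt_in)
    have "card (SIGMA l:{l \<in> L. pt W \<notin> l}. l \<inter> W - {pt (l \<inter> W)})
        = (\<Sum>l\<in>{l \<in> L. pt W \<notin> l}. card (l \<inter> W - {pt (l \<inter> W)}))"
      using finite_lines finite_line by (intro card_SigmaI) auto
    also have "int \<dots> = (\<Sum>l\<in>{l \<in> L. pt W \<notin> l}. g l W)"
      unfolding of_nat_sum
    proof (rule sum.cong[OF refl])
      fix l assume "l \<in> {l \<in> L. pt W \<notin> l}"
      show "int (card (l \<inter> W - {pt (l \<inter> W)})) = g l W"
      proof (cases "l \<inter> W = {}")
        case False
        then have "pt (l \<inter> W) \<in> l \<inter> W" by (metis all_not_in_conv pt_in)
        moreover have "finite (l \<inter> W)" using W' by simp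
        ultimately have "card (l \<inter> W - {pt (l \<inter> W)}) + 1 = card (l \<inter> W)"
          by (metis Suc_eq_plus1 card_Suc_Diff1)
        then show ?thesis using False by (simp add: g_def)
      qed (simp add: g_def)
    qed
    also have "\<dots> = (\<Sum>l\<in>L. g l W) - (\<Sum>l\<in>{l \<in> L. pt W \<in> l}. g l W)"
    proof -
      have "L = {l \<in> L. pt W \<notin> l} \<union> {l \<in> L. pt W \<in> l}" by auto
      then have "(\<Sum>l\<in>L. g l W) = (\<Sum>l\<in>{l \<in> L. pt W \<notin> l}. g l W) + (\<Sum>l\<in>{l \<in> L. pt W \<in> l}. g l W)"
        using finite_lines by (subst sum.union_disjoint[symmetric]) (auto intro!: sum.cong)
      then show ?thesis by simp
    qed
    also have "(\<Sum>l\<in>{l \<in> L. pt W \<in> l}. g l W) = int (\<Sum>l\<in>{l \<in> L. pt W \<in> l}. card (l \<inter> W - {pt W}))"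
      unfolding of_nat_sum
    proof (rule sum.cong[OF refl])
      fix l assume l: "l \<in> {l \<in> L. pt W \<in> l}"
      then have "card (l \<inter> W - {pt W}) + 1 = card (l \<inter> W)"
        using p W' by (metis (mono_tags, lifting) IntI Suc_eq_plus1 card_Suc_Diff1 finite_Int mem_Collect_eq)
      then show "g l W = int (card (l \<inter> W - {pt W}))" using l p by (auto simp: g_def)
    qed
    also have "\<dots> = int n - 1"
      using sum_lines_through[OF W'(1) p] W' by (simp add: n_def)
    finally show ?thesis .
  qed
  have "cycle_index i = (SIGMA W:Ws. SIGMA l:{l \<in> L. pt W \<notin> l}. l \<inter> W - {pt (l \<inter> W)})"
    by (auto simp: cycle_index_def Ws_def n_def)
  also have "card \<dots> = (\<Sum>W\<in>Ws. card (SIGMA l:{l \<in> L. pt W \<notin> l}. l \<inter> W - {pt (l \<inter> W)}))"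
    using finite_lines finite_line finWs by (intro card_SigmaI) (auto intro!: finite_SigmaI)
  also have "int \<dots> = (\<Sum>W\<in>Ws. (\<Sum>l\<in>L. g l W) - (int n - 1))"
    unfolding of_nat_sum by (rule sum.cong[OF refl]) (rule per)
  also have "\<dots> = (\<Sum>W\<in>Ws. \<Sum>l\<in>L. g l W) - int (card P choose n) * (int n - 1)"
    by (simp add: sum_subtractf cWs)
  also have "(\<Sum>W\<in>Ws. \<Sum>l\<in>L. g l W) = (\<Sum>l\<in>L. \<Sum>W\<in>Ws. g l W)"
    by (rule sum.swap)
  also have "(\<Sum>l\<in>L. \<Sum>W\<in>Ws. g l W) = (\<Sum>l\<in>L. int (card l) * int ((card P - 1) choose (i + 1))
      - int (card P choose n) + int ((card P - card l) choose n))"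
  proof (rule sum.cong[OF refl])
    fix l assume l: "l \<in> L"
    have "(\<Sum>W\<in>Ws. card (l \<inter> W)) = (\<Sum>W\<in>Ws. \<Sum>q\<in>l. if q \<in> W then 1 else 0)"
      using finite_line[OF l] by (intro sum.cong) (auto simp: sum.If_cases)
    also have "\<dots> = (\<Sum>q\<in>l. \<Sum>W\<in>Ws. if q \<in> W then 1 else 0)" by (rule sum.swap)
    also have "\<dots> = (\<Sum>q\<in>l. (card P - 1) choose (i + 1))"
    proof (rule sum.cong[OF refl])
      fix q assume "q \<in> l"
      then have q: "q \<in> P" using line_sub l by auto
      have "(\<Sum>W\<in>Ws. if q \<in> W then 1 else 0) = card {W \<in> Ws. q \<in> W}"
        using finWs by (simp add: sum.If_cases Int_def)
      also have "{W \<in> Ws. q \<in> W} = {W. W \<subseteq> P \<and> card W = Suc (i + 1) \<and> q \<in> W}"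
        by (auto simp: Ws_def n_def)
      finally show "(\<Sum>W\<in>Ws. if q \<in> W then 1 else 0) = (card P - 1) choose (i + 1)"
        using card_subsets_containing[OF finite_points q] by simp
    qed
    finally have s1: "(\<Sum>W\<in>Ws. int (card (l \<inter> W))) = int (card l) * int ((card P - 1) choose (i + 1))"
      by (simp flip: of_nat_sum)
    have "(\<Sum>W\<in>Ws. if l \<inter> W = {} then 1 else 0 :: int) = int (card {W \<in> Ws. l \<inter> W = {}})"
      using finWs by (simp add: sum.If_cases Int_def)
    also have "{W \<in> Ws. l \<inter> W = {}} = {W. W \<subseteq> P - l \<and> card W = n}" by (auto simp: Ws_def)
    also have "card \<dots> = (card P - card l) choose n"
      using finite_points finite_line[OF l] line_sub[OF l] by (simp add: n_subsets card_Diff_subset)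
    finally have s2: "(\<Sum>W\<in>Ws. if l \<inter> W = {} then 1 else 0 :: int) = int ((card P - card l) choose n)" .
    show "(\<Sum>W\<in>Ws. g l W) = int (card l) * int ((card P - 1) choose (i + 1))
      - int (card P choose n) + int ((card P - card l) choose n)"
      unfolding g_def sum.distrib sum_subtractf s1 s2 by (simp add: cWs)
  qed
  also have "\<dots> = (\<Sum>l\<in>L. int (card l)) * int ((card P - 1) choose (i + 1))
      - int (card L) * int (card P choose n) + (\<Sum>l\<in>L. int ((card P - card l) choose n))"
    by (simp add: sum.distrib sum_subtractf sum_distrib_right)
  also have "int (card P choose n) * (int n - 1) = int (card P) * int ((card P - 1) choose (i + 1)) - int (card P choose n)"
  proof -
    obtain d where d: "card P = Suc d" using card_P by (cases "card P") auto
    have "n * (card P choose n) = card P * ((card P - 1) choose (i + 1))"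
      using Suc_times_binomial[of "i + 1" d] by (simp add: n_def d)
    then have "int n * int (card P choose n) = int (card P) * int ((card P - 1) choose (i + 1))"
      by (simp flip: of_nat_mult)
    then show ?thesis by (simp add: algebra_simps)
  qed
  finally show ?thesis by (simp add: n_def algebra_simps)
qed

lemma cycle_index_formula:
  "int (card (cycle_index i)) =
     (\<Sum>k = 1..card P. int ((card P - k) choose (i + 2)) * int (lines_of_size L k))
     - int (card P choose (i + 2)) * (- 1 + int (card L))
     + int ((card P - 1) choose (i + 1)) * (- int (card P) + (\<Sum>k = 2..card P. int k * int (lines_of_size L k)))
     - int ((card P - 2) choose i) * (- int (card P choose 2)
        + (\<Sum>k = 2..card P. int (k choose 2) * int (lines_of_size L k)))"
proof -
  have "(\<Sum>k = 2..card P. int (k choose 2) * int (lines_of_size L k)) = int (card P choose 2)"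
    using sum_lines_of_size[of 2 "\<lambda>k. int (k choose 2)"] by (simp add: sum_card_pairs flip: of_nat_sum)
  then show ?thesis
    using card_cycle_index[of i] sum_lines_of_size[of 2 int]
      sum_lines_of_size[of 1 "\<lambda>k. int ((card P - k) choose (i + 2))"] by simp
qed

end

section \<open>Free modules and the comparison of resolutions\<close>

text \<open>The free module on \<open>B\<close> as finitely supported functions. With the pointwise additive group on functions,
homological algebra needs no records.\<close>

definition free_mod :: "'p set \<Rightarrow> 'b set \<Rightarrow> ('b \<Rightarrow> ('p, 'k::field) mpoly) set" where
  "free_mod P B = {f. (\<forall>b. f b \<in> polys P) \<and> (\<forall>b. b \<notin> B \<longrightarrow> f b = 0) \<and> finite {b. f b \<noteq> 0}}"

definition scl :: "'r \<Rightarrow> ('b \<Rightarrow> 'r::times) \<Rightarrow> 'b \<Rightarrow> 'r" where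
  "scl r x = (\<lambda>b. r * x b)"

definition unitv :: "'b \<Rightarrow> 'b \<Rightarrow> 'r::zero_neq_one" where
  "unitv b = (\<lambda>b'. if b' = b then 1 else 0)"

definition lin :: "'p set \<Rightarrow> 'b set \<Rightarrow> 'c set \<Rightarrow> (('b \<Rightarrow> ('p, 'k::field) mpoly) \<Rightarrow> 'c \<Rightarrow> ('p, 'k) mpoly) \<Rightarrow> bool" where
  "lin P B C h \<longleftrightarrow> (\<forall>x\<in>free_mod P B. h x \<in> free_mod P C)
     \<and> (\<forall>x\<in>free_mod P B. \<forall>y\<in>free_mod P B. h (x + y) = h x + h y)
     \<and> (\<forall>r\<in>polys P. \<forall>x\<in>free_mod P B. h (scl r x) = scl r (h x))"

lemma sum_fun_eval: "sum f A c = (\<Sum>a\<in>A. f a c)" for f :: "'a \<Rightarrow> 'b \<Rightarrow> 'c::comm_monoid_add"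
  by (induction A rule: infinite_finite_induct) auto

lemma scl_apply [simp]: "scl r x b = r * x b"
  by (simp add: scl_def)

lemma free_modD: "x \<in> free_mod P B \<Longrightarrow> x b \<in> polys P" "x \<in> free_mod P B \<Longrightarrow> finite {b. x b \<noteq> 0}"
  "x \<in> free_mod P B \<Longrightarrow> b \<notin> B \<Longrightarrow> x b = 0"
  by (auto simp: free_mod_def)

lemma free_mod_zero: "0 \<in> free_mod P B"
  by (simp add: free_mod_def)

lemma free_mod_add:
  assumes "x \<in> free_mod P B" "y \<in> free_mod P B" shows "x + y \<in> free_mod P B"
proof -
  have "finite {b. (x + y) b \<noteq> 0}"
    by (rule finite_subset[of _ "{b. x b \<noteq> 0} \<union> {b. y b \<noteq> 0}"]) (use assms in \<open>auto simp: free_mod_def\<close>)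
  then show ?thesis using assms by (simp add: free_mod_def)
qed

lemma free_mod_scl:
  assumes "r \<in> polys P" "x \<in> free_mod P B" shows "scl r x \<in> free_mod P B"
proof -
  have "finite {b. scl r x b \<noteq> 0}"
    by (rule finite_subset[of _ "{b. x b \<noteq> 0}"]) (use assms in \<open>auto simp: free_mod_def\<close>)
  then show ?thesis using assms by (simp add: free_mod_def)
qed

lemma free_mod_uminus: "x \<in> free_mod P B \<Longrightarrow> - x \<in> free_mod P B"
  by (simp add: free_mod_def)

lemma free_mod_diff: "x \<in> free_mod P B \<Longrightarrow> y \<in> free_mod P B \<Longrightarrow> x - y \<in> free_mod P B"
  using free_mod_add[of x P B "- y"] free_mod_uminus[of y P B] by simp

lemma free_mod_unitv: "b \<in> B \<Longrightarrow> unitv b \<in> free_mod P B"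
  by (auto simp: free_mod_def unitv_def)

lemma free_mod_sum: "(\<And>j. j \<in> J \<Longrightarrow> f j \<in> free_mod P B) \<Longrightarrow> sum f J \<in> free_mod P B"
  by (induction J rule: infinite_finite_induct) (auto simp: free_mod_zero free_mod_add)

lemma
  assumes "lin P B C h"
  shows lin_closed: "x \<in> free_mod P B \<Longrightarrow> h x \<in> free_mod P C"
    and lin_add: "x \<in> free_mod P B \<Longrightarrow> y \<in> free_mod P B \<Longrightarrow> h (x + y) = h x + h y"
    and lin_scl: "r \<in> polys P \<Longrightarrow> x \<in> free_mod P B \<Longrightarrow> h (scl r x) = scl r (h x)"
  using assms by (auto simp: lin_def)

lemma lin_zero:
  assumes "lin P B C h" shows "h 0 = 0"
proof -
  have "h 0 = h 0 + h 0" using lin_add[OF assms free_mod_zero free_mod_zero] by simp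
  then show ?thesis by simp
qed

lemma lin_diff:
  assumes "lin P B C h" "x \<in> free_mod P B" "y \<in> free_mod P B"
  shows "h (x - y) = h x - h y"
proof -
  have "h x = h (x - y) + h y"
    using lin_add[OF assms(1) free_mod_diff[OF assms(2,3)] assms(3)] by simp
  then show ?thesis by simp
qed

lemma lin_sum:
  assumes "lin P B C h" "\<And>j. j \<in> J \<Longrightarrow> f j \<in> free_mod P B"
  shows "h (sum f J) = (\<Sum>j\<in>J. h (f j))"
  using assms(2)
  by (induction J rule: infinite_finite_induct)
    (auto simp: lin_zero[OF assms(1)] lin_add[OF assms(1)] free_mod_sum)

lemma lin_comp: "lin P B C h \<Longrightarrow> lin P C D k \<Longrightarrow> lin P B D (\<lambda>x. k (h x))"
  by (auto simp: lin_def)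

lemma scl_add: "scl r (x + y) = scl r x + scl r (y :: 'b \<Rightarrow> 'r::comm_ring_1)"
  by (rule ext) (simp add: distrib_left)

lemma scl_diff: "scl r (x - y) = scl r x - scl r (y :: 'b \<Rightarrow> 'r::comm_ring_1)"
  by (rule ext) (simp add: right_diff_distrib)

lemma lin_minus: "lin P B C h \<Longrightarrow> lin P B C k \<Longrightarrow> lin P B C (\<lambda>x. h x - k x)"
  unfolding lin_def by (auto simp: free_mod_diff scl_diff)

lemma lin_id: "lin P B B (\<lambda>x. x)"
  by (simp add: lin_def)

lemma free_mod_expand:
  assumes "x \<in> free_mod P B"
  shows "x = (\<Sum>b\<in>{b. x b \<noteq> 0}. scl (x b) (unitv b))"
proof
  fix c
  have "(\<Sum>b\<in>{b. x b \<noteq> 0}. scl (x b) (unitv b)) c = (\<Sum>b\<in>{b. x b \<noteq> 0}. if b = c then x b else 0)"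
    unfolding sum_fun_eval by (rule sum.cong) (auto simp: unitv_def)
  also have "\<dots> = x c" using free_modD(2)[OF assms] by simp
  finally show "x c = (\<Sum>b\<in>{b. x b \<noteq> 0}. scl (x b) (unitv b)) c" by simp
qed

lemma lin_expand:
  assumes "lin P B C h" "x \<in> free_mod P B"
  shows "h x = (\<Sum>b\<in>{b. x b \<noteq> 0}. scl (x b) (h (unitv b)))"
proof -
  have B: "b \<in> B" if "x b \<noteq> 0" for b using free_modD(3)[OF assms(2)] that by blast
  have "h x = h (\<Sum>b\<in>{b. x b \<noteq> 0}. scl (x b) (unitv b))"
    by (rule arg_cong[OF free_mod_expand[OF assms(2)]])
  also have "\<dots> = (\<Sum>b\<in>{b. x b \<noteq> 0}. h (scl (x b) (unitv b)))"
    by (rule lin_sum[OF assms(1)])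
      (use B assms free_modD(1)[OF assms(2)] in \<open>auto intro!: free_mod_scl free_mod_unitv\<close>)
  also have "\<dots> = (\<Sum>b\<in>{b. x b \<noteq> 0}. scl (x b) (h (unitv b)))"
    by (rule sum.cong[OF refl], rule lin_scl[OF assms(1)])
      (use B free_modD(1)[OF assms(2)] in \<open>auto intro!: free_mod_unitv\<close>)
  finally show ?thesis .
qed

lemma lin_eqI:
  assumes "lin P B C h" "lin P B D k" "\<And>b. b \<in> B \<Longrightarrow> h (unitv b) = k (unitv b)" "x \<in> free_mod P B"
  shows "h x = k x"
proof -
  have "b \<in> B" if "x b \<noteq> 0" for b using free_modD(3)[OF assms(4)] that by blast
  then show ?thesis
    unfolding lin_expand[OF assms(1,4)] lin_expand[OF assms(2,4)]
    by (intro sum.cong) (auto simp: assms(3))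
qed

text \<open>The universal property of the free module.\<close>

lemma lin_extend:
  fixes y :: "'b \<Rightarrow> 'c \<Rightarrow> ('p, 'k::field) mpoly"
  assumes y: "\<And>b. b \<in> B \<Longrightarrow> y b \<in> free_mod P C"
  shows "\<exists>h. lin P B C h \<and> (\<forall>b\<in>B. h (unitv b) = y b)"
proof -
  define h where "h x = (\<Sum>b\<in>{b. x b \<noteq> 0}. scl (x b) (y b))" for x :: "'b \<Rightarrow> ('p, 'k) mpoly"
  have ext: "h x = (\<Sum>b\<in>J. scl (x b) (y b))" if "finite J" "{b. x b \<noteq> 0} \<subseteq> J" for x J
    unfolding h_def using that
    by (intro sum.mono_neutral_left) (auto simp: scl_def fun_eq_iff)
  have "lin P B C h"
    unfolding lin_def
  proof (intro conjI ballI)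
    fix x :: "'b \<Rightarrow> ('p, 'k) mpoly" assume x: "x \<in> free_mod P B"
    have B: "b \<in> B" if "x b \<noteq> 0" for b using free_modD(3)[OF x] that by blast
    show "h x \<in> free_mod P C"
      unfolding h_def using B y free_modD(1)[OF x] by (intro free_mod_sum free_mod_scl) auto
    fix z :: "'b \<Rightarrow> ('p, 'k) mpoly" assume z: "z \<in> free_mod P B"
    let ?J = "{b. x b \<noteq> 0} \<union> {b. z b \<noteq> 0}"
    have fin: "finite ?J" using free_modD(2)[OF x] free_modD(2)[OF z] by simp
    have "h (x + z) = (\<Sum>b\<in>?J. scl ((x + z) b) (y b))" by (rule ext[OF fin]) auto
    also have "\<dots> = (\<Sum>b\<in>?J. scl (x b) (y b)) + (\<Sum>b\<in>?J. scl (z b) (y b))"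
      by (subst sum.distrib[symmetric], rule sum.cong) (auto simp: fun_eq_iff distrib_right)
    also have "\<dots> = h x + h z" using ext[OF fin, of x] ext[OF fin, of z] by auto
    finally show "h (x + z) = h x + h z" .
  next
    fix r :: "('p, 'k) mpoly" and x :: "'b \<Rightarrow> ('p, 'k) mpoly" assume x: "x \<in> free_mod P B"
    have eval: "scl r (\<Sum>b\<in>J. f b) = (\<Sum>b\<in>J. scl r (f b))" for f :: "'b \<Rightarrow> 'c \<Rightarrow> ('p, 'k) mpoly" and J
      by (simp add: fun_eq_iff sum_fun_eval sum_distrib_left)
    have "h (scl r x) = (\<Sum>b\<in>{b. x b \<noteq> 0}. scl (scl r x b) (y b))"
      by (rule ext) (use free_modD(2)[OF x] in auto)
    also have "\<dots> = scl r (h x)"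
      unfolding h_def eval by (rule sum.cong) (auto simp: fun_eq_iff mult.assoc)
    finally show "h (scl r x) = scl r (h x)" .
  qed
  moreover have "h (unitv b) = y b" for b
    using ext[of "{b}" "unitv b"] by (auto simp: unitv_def fun_eq_iff)
  ultimately show ?thesis by blast
qed

text \<open>Lets the augmentation act as the differential out of degree zero, so that exactness in degree zero is not a separate
case.\<close>

fun aug_cycle :: "(nat \<Rightarrow> ('b \<Rightarrow> 'r) \<Rightarrow> 'b \<Rightarrow> 'r::zero) \<Rightarrow> (('b \<Rightarrow> 'r) \<Rightarrow> 'k::zero) \<Rightarrow> nat \<Rightarrow> ('b \<Rightarrow> 'r) \<Rightarrow> bool" where
  "aug_cycle d \<eta> 0 x \<longleftrightarrow> \<eta> x = 0"
| "aug_cycle d \<eta> (Suc n) x \<longleftrightarrow> d n x = (\<lambda>_. 0)"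

text \<open>A free resolution of the residue field with augmentation \<open>\<eta>\<close>; polynomials act on the residue field through their
constant terms.\<close>

locale resolution =
  fixes P :: "'p set" and B :: "nat \<Rightarrow> 'b set"
    and d :: "nat \<Rightarrow> ('b \<Rightarrow> ('p, 'k::field) mpoly) \<Rightarrow> 'b \<Rightarrow> ('p, 'k) mpoly"
    and \<eta> :: "('b \<Rightarrow> ('p, 'k) mpoly) \<Rightarrow> 'k"
  assumes d_lin: "lin P (B (Suc i)) (B i) (d i)"
    and exact: "x \<in> free_mod P (B i) \<Longrightarrow> aug_cycle d \<eta> i x \<longleftrightarrow> (\<exists>y\<in>free_mod P (B (Suc i)). x = d i y)"
    and aug_add: "x \<in> free_mod P (B 0) \<Longrightarrow> y \<in> free_mod P (B 0) \<Longrightarrow> \<eta> (x + y) = \<eta> x + \<eta> y"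
    and aug_scl: "r \<in> polys P \<Longrightarrow> x \<in> free_mod P (B 0) \<Longrightarrow> \<eta> (scl r x) = coef r 0 * \<eta> x"
    and aug_surj: "\<exists>x\<in>free_mod P (B 0). \<eta> x = 1"
begin

lemma d_cycle: "x \<in> free_mod P (B (Suc i)) \<Longrightarrow> aug_cycle d \<eta> i (d i x)"
  using exact[OF lin_closed[OF d_lin]] by blast

lemma dd: "x \<in> free_mod P (B (Suc (Suc i))) \<Longrightarrow> d i (d (Suc i) x) = 0"
  using d_cycle[of x "Suc i"] by (simp add: zero_fun_def)

lemma aug_zero: "\<eta> 0 = 0"
proof -
  have "\<eta> (0 + 0) = \<eta> 0 + \<eta> 0" by (rule aug_add) (rule free_mod_zero)+
  then show ?thesis unfolding add_0_left by (metis add_cancel_left_left)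
qed

lemma aug_diff:
  assumes "x \<in> free_mod P (B 0)" "y \<in> free_mod P (B 0)" shows "\<eta> (x - y) = \<eta> x - \<eta> y"
  using aug_add[OF free_mod_diff[OF assms] assms(2)] by simp

lemma aug_sum: "(\<And>j. j \<in> J \<Longrightarrow> f j \<in> free_mod P (B 0)) \<Longrightarrow> \<eta> (sum f J) = (\<Sum>j\<in>J. \<eta> (f j))"
  by (induction J rule: infinite_finite_induct) (auto simp: aug_zero aug_add free_mod_sum)

lemma aug_expand:
  assumes x: "x \<in> free_mod P (B 0)"
  shows "\<eta> x = (\<Sum>b\<in>{b. x b \<noteq> 0}. coef (x b) 0 * \<eta> (unitv b))"
proof -
  have B: "b \<in> B 0" if "x b \<noteq> 0" for b using free_modD(3)[OF x] that by blast
  have "\<eta> x = \<eta> (\<Sum>b\<in>{b. x b \<noteq> 0}. scl (x b) (unitv b))"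
    by (rule arg_cong[OF free_mod_expand[OF x]])
  also have "\<dots> = (\<Sum>b\<in>{b. x b \<noteq> 0}. \<eta> (scl (x b) (unitv b)))"
    by (rule aug_sum) (use B free_modD(1)[OF x] in \<open>auto intro!: free_mod_scl free_mod_unitv\<close>)
  also have "\<dots> = (\<Sum>b\<in>{b. x b \<noteq> 0}. coef (x b) 0 * \<eta> (unitv b))"
    by (rule sum.cong[OF refl], rule aug_scl)
      (use B free_modD(1)[OF x] in \<open>auto intro!: free_mod_unitv\<close>)
  finally show ?thesis .
qed

lemma aug_onto: "\<exists>x\<in>free_mod P (B 0). \<eta> x = c"
proof -
  obtain x where x: "x \<in> free_mod P (B 0)" "\<eta> x = 1" using aug_surj by blast
  have c: "monom_mp 0 c \<in> polys P" by (rule polys_monom) simp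
  show ?thesis
    using free_mod_scl[OF c x(1)] aug_scl[OF c x(1)] x(2) by (intro bexI[of _ "scl (monom_mp 0 c) x"]) auto
qed

end

text \<open>Chain maps over the identity of the residue field.\<close>

definition chain_map where
  "chain_map P B d \<eta> C e \<theta> f \<longleftrightarrow> (\<forall>i. lin P (B i) (C i) (f i))
     \<and> (\<forall>i. \<forall>x\<in>free_mod P (B (Suc i)). f i (d i x) = e i (f (Suc i) x))
     \<and> (\<forall>x\<in>free_mod P (B 0). \<theta> (f 0 x) = \<eta> x)"

text \<open>The comparison theorem: images of basis elements are lifted one degree at a time. The predicate \<open>Q\<close> is
carried along the recursion; homogeneity of the lifts is obtained through it.\<close>

lemma chain_map_exists_with:
  fixes Q :: "nat \<Rightarrow> ('c \<Rightarrow> ('p, 'k::field) mpoly) \<Rightarrow> bool"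
  assumes F: "resolution P B d \<eta>" and G: "resolution P C e \<theta>"
    and init: "\<And>b. b \<in> B 0 \<Longrightarrow> \<exists>y\<in>free_mod P (C 0). \<theta> y = \<eta> (unitv b) \<and> Q 0 y"
    and step: "\<And>i h b. lin P (B i) (C i) h \<Longrightarrow> (\<forall>b\<in>B i. Q i (h (unitv b))) \<Longrightarrow> b \<in> B (Suc i) \<Longrightarrow>
      aug_cycle e \<theta> i (h (d i (unitv b))) \<Longrightarrow>
      \<exists>y\<in>free_mod P (C (Suc i)). h (d i (unitv b)) = e i y \<and> Q (Suc i) y"
  shows "\<exists>f. chain_map P B d \<eta> C e \<theta> f \<and> (\<forall>i. \<forall>b\<in>B i. Q i (f i (unitv b)))"
proof -
  interpret F: resolution P B d \<eta> by (rule F)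
  interpret G: resolution P C e \<theta> by (rule G)
  \<comment> \<open>The state of the recursion: a map in degree \<open>i\<close> that can be lifted once more.\<close>
  define R where "R i h \<longleftrightarrow> lin P (B i) (C i) h \<and> (\<forall>b\<in>B i. Q i (h (unitv b)))
     \<and> (\<forall>x\<in>free_mod P (B i). aug_cycle d \<eta> i x \<longrightarrow> aug_cycle e \<theta> i (h x))
     \<and> (i = 0 \<longrightarrow> (\<forall>x\<in>free_mod P (B 0). \<theta> (h x) = \<eta> x))" for i h
  have "\<exists>f. \<forall>i. R i (f i) \<and> (\<forall>x\<in>free_mod P (B (Suc i)). f i (d i x) = e i (f (Suc i) x))"
  proof (rule dependent_nat_choice)
    have "\<exists>y. \<forall>b\<in>B 0. y b \<in> free_mod P (C 0) \<and> \<theta> (y b) = \<eta> (unitv b) \<and> Q 0 (y b)"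
      using init by (intro bchoice) blast
    then obtain y where y: "\<And>b. b \<in> B 0 \<Longrightarrow> y b \<in> free_mod P (C 0)"
      "\<And>b. b \<in> B 0 \<Longrightarrow> \<theta> (y b) = \<eta> (unitv b)" "\<And>b. b \<in> B 0 \<Longrightarrow> Q 0 (y b)" by blast
    obtain h where h: "lin P (B 0) (C 0) h" "\<And>b. b \<in> B 0 \<Longrightarrow> h (unitv b) = y b"
      using lin_extend[of "B 0" y P "C 0"] y(1) by blast
    have aug: "\<theta> (h x) = \<eta> x" if x: "x \<in> free_mod P (B 0)" for x
    proof -
      have B: "b \<in> B 0" if "x b \<noteq> 0" for b using free_modD(3)[OF x] that by blast
      have "\<theta> (h x) = (\<Sum>b\<in>{b. x b \<noteq> 0}. \<theta> (scl (x b) (h (unitv b))))"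
        unfolding lin_expand[OF h(1) x]
        using B free_modD(1)[OF x] y h by (intro G.aug_sum free_mod_scl) auto
      also have "\<dots> = (\<Sum>b\<in>{b. x b \<noteq> 0}. coef (x b) 0 * \<eta> (unitv b))"
        using B free_modD(1)[OF x] y h by (intro sum.cong) (auto simp: G.aug_scl)
      also have "\<dots> = \<eta> x" by (rule F.aug_expand[OF x, symmetric])
      finally show ?thesis .
    qed
    then have "R 0 h" using h y by (simp add: R_def)
    then show "\<exists>h. R 0 h" by (rule exI[of "R 0"])
  next
    fix h i assume "R i h"
    then have h: "lin P (B i) (C i) h" "\<forall>b\<in>B i. Q i (h (unitv b))"
      "\<And>x. x \<in> free_mod P (B i) \<Longrightarrow> aug_cycle d \<eta> i x \<Longrightarrow> aug_cycle e \<theta> i (h x)"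
      by (auto simp: R_def)
    have cyc: "aug_cycle e \<theta> i (h (d i x))" if "x \<in> free_mod P (B (Suc i))" for x
      using that lin_closed[OF F.d_lin] F.d_cycle h(3) by blast
    have "\<exists>y. \<forall>b\<in>B (Suc i). y b \<in> free_mod P (C (Suc i)) \<and> h (d i (unitv b)) = e i (y b) \<and> Q (Suc i) (y b)"
      using step[OF h(1,2)] cyc[OF free_mod_unitv] by (intro bchoice) blast
    then obtain y where y: "\<And>b. b \<in> B (Suc i) \<Longrightarrow> y b \<in> free_mod P (C (Suc i))"
      "\<And>b. b \<in> B (Suc i) \<Longrightarrow> h (d i (unitv b)) = e i (y b)" "\<And>b. b \<in> B (Suc i) \<Longrightarrow> Q (Suc i) (y b)" by blast
    obtain k where k: "lin P (B (Suc i)) (C (Suc i)) k" "\<And>b. b \<in> B (Suc i) \<Longrightarrow> k (unitv b) = y b"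
      using lin_extend[of "B (Suc i)" y P "C (Suc i)"] y(1) by blast
    have comm: "h (d i x) = e i (k x)" if "x \<in> free_mod P (B (Suc i))" for x
      by (rule lin_eqI[OF lin_comp[OF F.d_lin h(1)] lin_comp[OF k(1) G.d_lin] _ that]) (simp add: k y)
    have "aug_cycle e \<theta> (Suc i) (k x)" if x: "x \<in> free_mod P (B (Suc i))" "aug_cycle d \<eta> (Suc i) x" for x
      using comm[OF x(1)] x(2) lin_zero[OF h(1)] by (simp add: zero_fun_def)
    then have "R (Suc i) k" using k y by (simp add: R_def)
    then show "\<exists>k. R (Suc i) k \<and> (\<forall>x\<in>free_mod P (B (Suc i)). h (d i x) = e i (k x))"
      using comm by blast
  qed
  then obtain f where "\<And>i. R i (f i)" "\<And>i x. x \<in> free_mod P (B (Suc i)) \<Longrightarrow> f i (d i x) = e i (f (Suc i) x)"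
    by blast
  then show ?thesis unfolding chain_map_def R_def by blast
qed

lemma chain_map_exists:
  assumes F: "resolution P B d \<eta>" and G: "resolution P C e \<theta>"
  shows "\<exists>f. chain_map P B d \<eta> C e \<theta> f"
proof -
  interpret F: resolution P B d \<eta> by (rule F)
  interpret G: resolution P C e \<theta> by (rule G)
  have "\<exists>f. chain_map P B d \<eta> C e \<theta> f \<and> (\<forall>i. \<forall>b\<in>B i. True)"
  proof (rule chain_map_exists_with[OF F G])
    show "\<exists>y\<in>free_mod P (C 0). \<theta> y = \<eta> (unitv b) \<and> True" for b
      using G.aug_onto by simp
    fix i h b
    assume h: "lin P (B i) (C i) h" and b: "b \<in> B (Suc i)" and c: "aug_cycle e \<theta> i (h (d i (unitv b)))"
    have "h (d i (unitv b)) \<in> free_mod P (C i)"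
      by (rule lin_closed[OF h lin_closed[OF F.d_lin free_mod_unitv[OF b]]])
    then show "\<exists>y\<in>free_mod P (C (Suc i)). h (d i (unitv b)) = e i y \<and> True"
      using G.exact c by simp
  qed
  then show ?thesis by blast
qed

text \<open>A chain map over zero is homotopic to zero, by the same recursion. It is used for the difference of a round trip and
the identity, and for multiplication by a polynomial without constant term.\<close>

lemma null_homotopic:
  assumes F: "resolution P B d \<eta>"
    and \<phi>: "\<And>i. lin P (B i) (B i) (\<phi> i)" "\<And>i x. x \<in> free_mod P (B (Suc i)) \<Longrightarrow> \<phi> i (d i x) = d i (\<phi> (Suc i) x)"
      "\<And>x. x \<in> free_mod P (B 0) \<Longrightarrow> \<eta> (\<phi> 0 x) = 0"
  shows "\<exists>s. (\<forall>i. lin P (B i) (B (Suc i)) (s i)) \<and>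
    (\<forall>i. \<forall>x\<in>free_mod P (B (Suc i)). \<phi> (Suc i) x = d (Suc i) (s (Suc i) x) + s i (d i x))"
proof -
  interpret F: resolution P B d \<eta> by (rule F)
  have lift: "\<exists>t. lin P D (B (Suc i)) t \<and> (\<forall>x\<in>free_mod P D. u x = d i (t x))"
    if u: "lin P D (B i) u" and c: "\<And>x. x \<in> free_mod P D \<Longrightarrow> aug_cycle d \<eta> i (u x)" for D :: "'b set" and i u
  proof -
    have "\<exists>y. \<forall>b\<in>D. y b \<in> free_mod P (B (Suc i)) \<and> u (unitv b) = d i (y b)"
    proof (intro bchoice ballI)
      fix b assume b: "b \<in> D"
      show "\<exists>y. y \<in> free_mod P (B (Suc i)) \<and> u (unitv b) = d i y"
        using F.exact[OF lin_closed[OF u free_mod_unitv[OF b]]] c[OF free_mod_unitv[OF b]] by blast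
    qed
    then obtain y where y: "\<And>b. b \<in> D \<Longrightarrow> y b \<in> free_mod P (B (Suc i))" "\<And>b. b \<in> D \<Longrightarrow> u (unitv b) = d i (y b)"
      by blast
    obtain t where t: "lin P D (B (Suc i)) t" "\<And>b. b \<in> D \<Longrightarrow> t (unitv b) = y b"
      using lin_extend[of D y P "B (Suc i)"] y(1) by blast
    have "u x = d i (t x)" if "x \<in> free_mod P D" for x
      by (rule lin_eqI[OF u lin_comp[OF t(1) F.d_lin] _ that]) (simp add: t y)
    then show ?thesis using t(1) by blast
  qed
  define R where "R i s \<longleftrightarrow> lin P (B i) (B (Suc i)) s
    \<and> (\<forall>y\<in>free_mod P (B i). aug_cycle d \<eta> i y \<longrightarrow> \<phi> i y = d i (s y))" for i s
  have "\<exists>s. \<forall>i. R i (s i) \<and> (\<forall>x\<in>free_mod P (B (Suc i)). \<phi> (Suc i) x = d (Suc i) (s (Suc i) x) + s i (d i x))"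
  proof (rule dependent_nat_choice)
    obtain s where "lin P (B 0) (B (Suc 0)) s" "\<forall>x\<in>free_mod P (B 0). \<phi> 0 x = d 0 (s x)"
      using lift[OF \<phi>(1)[of 0]] \<phi>(3) by auto
    then show "\<exists>s. R 0 s" by (auto simp: R_def)
  next
    fix s i assume "R i s"
    then have s: "lin P (B i) (B (Suc i)) s"
      "\<And>y. y \<in> free_mod P (B i) \<Longrightarrow> aug_cycle d \<eta> i y \<Longrightarrow> \<phi> i y = d i (s y)" by (auto simp: R_def)
    let ?u = "\<lambda>x. \<phi> (Suc i) x - s (d i x)"
    have u: "lin P (B (Suc i)) (B (Suc i)) ?u"
      by (rule lin_minus[OF \<phi>(1) lin_comp[OF F.d_lin s(1)]])
    have "aug_cycle d \<eta> (Suc i) (?u x)" if x: "x \<in> free_mod P (B (Suc i))" for x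
    proof -
      have dx: "d i x \<in> free_mod P (B i)" by (rule lin_closed[OF F.d_lin x])
      have "d i (?u x) = d i (\<phi> (Suc i) x) - d i (s (d i x))"
        by (rule lin_diff[OF F.d_lin lin_closed[OF \<phi>(1) x] lin_closed[OF s(1) dx]])
      also have "\<dots> = 0" using \<phi>(2)[OF x] s(2)[OF dx F.d_cycle[OF x]] by simp
      finally show ?thesis by (simp add: zero_fun_def)
    qed
    then obtain t where t: "lin P (B (Suc i)) (B (Suc (Suc i))) t"
      "\<And>x. x \<in> free_mod P (B (Suc i)) \<Longrightarrow> ?u x = d (Suc i) (t x)"
      using lift[OF u] by blast
    have eq: "\<phi> (Suc i) x = d (Suc i) (t x) + s (d i x)" if "x \<in> free_mod P (B (Suc i))" for x
      using t(2)[OF that] by (simp add: diff_eq_eq)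
    have "R (Suc i) t"
      unfolding R_def
    proof (intro conjI ballI impI t(1))
      fix y assume y: "y \<in> free_mod P (B (Suc i))" "aug_cycle d \<eta> (Suc i) y"
      then have "d i y = 0" by (simp add: zero_fun_def)
      then show "\<phi> (Suc i) y = d (Suc i) (t y)" using eq[OF y(1)] lin_zero[OF s(1)] by simp
    qed
    then show "\<exists>t. R (Suc i) t \<and> (\<forall>x\<in>free_mod P (B (Suc i)). \<phi> (Suc i) x = d (Suc i) (t x) + s (d i x))"
      using eq by blast
  qed
  then show ?thesis unfolding R_def by blast
qed

definition poly_ideal :: "'p set \<Rightarrow> ('p, 'k::field) mpoly set \<Rightarrow> bool" where
  "poly_ideal P J \<longleftrightarrow> J \<subseteq> polys P \<and> 0 \<in> J \<and> (\<forall>f\<in>J. \<forall>g\<in>J. f + g \<in> J) \<and> (\<forall>r\<in>polys P. \<forall>f\<in>J. r * f \<in> J)"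

lemma poly_idealD:
  assumes "poly_ideal P J"
  shows "f \<in> J \<Longrightarrow> f \<in> polys P" "0 \<in> J" "f \<in> J \<Longrightarrow> g \<in> J \<Longrightarrow> f + g \<in> J" "r \<in> polys P \<Longrightarrow> f \<in> J \<Longrightarrow> r * f \<in> J"
  using assms by (auto simp: poly_ideal_def)

lemma poly_ideal_uminus: "poly_ideal P J \<Longrightarrow> f \<in> J \<Longrightarrow> - f \<in> J"
  using poly_idealD(4)[of P J "- 1" f] by simp

lemma poly_ideal_diff: "poly_ideal P J \<Longrightarrow> f \<in> J \<Longrightarrow> g \<in> J \<Longrightarrow> f - g \<in> J"
  using poly_idealD(3)[of P J f "- g"] poly_ideal_uminus[of P J g] by simp

lemma poly_ideal_sum: "poly_ideal P J \<Longrightarrow> (\<And>j. j \<in> A \<Longrightarrow> f j \<in> J) \<Longrightarrow> sum f A \<in> J"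
  by (induction A rule: infinite_finite_induct) (auto simp: poly_idealD)

text \<open>A linear map is a matrix of polynomials, so it maps \<open>J F\<close> to \<open>J G\<close>.\<close>

lemma lin_preserves_ideal:
  assumes J: "poly_ideal P J" and h: "lin P B C h" and x: "x \<in> free_mod P B" "\<And>b. x b \<in> J"
  shows "h x c \<in> J"
proof -
  have B: "b \<in> B" if "x b \<noteq> 0" for b using free_modD(3)[OF x(1)] that by blast
  have "h x c = (\<Sum>b\<in>{b. x b \<noteq> 0}. h (unitv b) c * x b)"
    unfolding lin_expand[OF h x(1)] sum_fun_eval by (simp add: mult.commute)
  also have "\<dots> \<in> J"
    using B free_modD(1)[OF lin_closed[OF h free_mod_unitv]] x
    by (intro poly_ideal_sum[OF J] poly_idealD(4)[OF J]) auto
  finally show ?thesis .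
qed

text \<open>The homotopy \<open>s\<close> from the round trip to the identity gives the difference \<open>d (s x) + s (d x)\<close>. When \<open>d x\<close> has
entries in \<open>J\<close>, so has \<open>s (d x)\<close>: on homology modulo \<open>J\<close> the round trip is the identity.\<close>

lemma round_trip_homotopy:
  assumes F: "resolution P B d \<eta>" and G: "resolution P C e \<theta>"
    and f: "chain_map P B d \<eta> C e \<theta> f" and g: "chain_map P C e \<theta> B d \<eta> g"
    and J: "poly_ideal P J" and x: "x \<in> free_mod P (B (Suc i))" "\<And>b. d i x b \<in> J"
  shows "\<exists>w\<in>free_mod P (B (Suc (Suc i))). \<forall>b. (g (Suc i) (f (Suc i) x) - x - d (Suc i) w) b \<in> J"
proof -
  interpret F: resolution P B d \<eta> by (rule F)
  interpret G: resolution P C e \<theta> by (rule G)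
  have f': "lin P (B i) (C i) (f i)" "y \<in> free_mod P (B (Suc i)) \<Longrightarrow> f i (d i y) = e i (f (Suc i) y)"
    "y \<in> free_mod P (B 0) \<Longrightarrow> \<theta> (f 0 y) = \<eta> y" for i y using f by (auto simp: chain_map_def)
  have g': "lin P (C i) (B i) (g i)" "z \<in> free_mod P (C (Suc i)) \<Longrightarrow> g i (e i z) = d i (g (Suc i) z)"
    "z \<in> free_mod P (C 0) \<Longrightarrow> \<eta> (g 0 z) = \<theta> z" for i z using g by (auto simp: chain_map_def)
  define \<phi> where "\<phi> i x = g i (f i x) - x" for i x
  have "\<exists>s. (\<forall>i. lin P (B i) (B (Suc i)) (s i)) \<and>
    (\<forall>i. \<forall>x\<in>free_mod P (B (Suc i)). \<phi> (Suc i) x = d (Suc i) (s (Suc i) x) + s i (d i x))"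
  proof (rule null_homotopic[OF F])
    show "lin P (B i) (B i) (\<phi> i)" for i
      unfolding \<phi>_def[abs_def] by (rule lin_minus[OF lin_comp[OF f'(1) g'(1)] lin_id])
    show "\<phi> i (d i x) = d i (\<phi> (Suc i) x)" if x: "x \<in> free_mod P (B (Suc i))" for i x
      unfolding \<phi>_def f'(2)[OF x] g'(2)[OF lin_closed[OF f'(1) x]]
      by (rule lin_diff[OF F.d_lin lin_closed[OF g'(1) lin_closed[OF f'(1) x]] x, symmetric])
    show "\<eta> (\<phi> 0 x) = 0" if x: "x \<in> free_mod P (B 0)" for x
      unfolding \<phi>_def F.aug_diff[OF lin_closed[OF g'(1) lin_closed[OF f'(1) x]] x]
      using g'(3)[OF lin_closed[OF f'(1) x]] f'(3)[OF x] by simp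
  qed
  then obtain s where s: "\<And>i. lin P (B i) (B (Suc i)) (s i)"
    "\<And>i x. x \<in> free_mod P (B (Suc i)) \<Longrightarrow> \<phi> (Suc i) x = d (Suc i) (s (Suc i) x) + s i (d i x)" by blast
  show ?thesis
  proof (intro bexI allI)
    show "s (Suc i) x \<in> free_mod P (B (Suc (Suc i)))" by (rule lin_closed[OF s(1) x(1)])
    fix b
    have "g (Suc i) (f (Suc i) x) - x - d (Suc i) (s (Suc i) x) = s i (d i x)"
      using s(2)[OF x(1)] by (simp add: \<phi>_def)
    moreover have "s i (d i x) b \<in> J"
      by (rule lin_preserves_ideal[OF J s(1) lin_closed[OF F.d_lin x(1)] x(2)])
    ultimately show "(g (Suc i) (f (Suc i) x) - x - d (Suc i) (s (Suc i) x)) b \<in> J" by simp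
  qed
qed

section \<open>Graded modules as records\<close>

lemma mpoly_ring_simps [simp]:
  "carrier (mpoly_ring P) = polys P"
  "x \<otimes>\<^bsub>mpoly_ring P\<^esub> y = x * y"
  "\<one>\<^bsub>mpoly_ring P\<^esub> = 1"
  "\<zero>\<^bsub>mpoly_ring P\<^esub> = 0"
  "x \<oplus>\<^bsub>mpoly_ring P\<^esub> y = x + y"
  "x \<odot>\<^bsub>mpoly_ring P\<^esub> y = x * y"
  by (simp_all add: mpoly_ring_def polys_def Let_def)

lemma cring_mpoly_ring: "cring (mpoly_ring P)"
proof (rule cringI)
  show "abelian_group (mpoly_ring P)"
  proof (rule abelian_groupI)
    fix x assume "x \<in> carrier (mpoly_ring P)"
    then show "\<exists>y\<in>carrier (mpoly_ring P). y \<oplus>\<^bsub>mpoly_ring P\<^esub> x = \<zero>\<^bsub>mpoly_ring P\<^esub>"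
      by (intro bexI[of _ "- x"]) auto
  qed (auto simp: add.assoc add.commute)
  show "comm_monoid (mpoly_ring P)"
    by (rule comm_monoidI) (auto simp: mult.assoc mult.commute)
qed (auto simp: distrib_right)

lemma free_gmodule_simps [simp]:
  "carrier (free_gmodule (mpoly_ring P) B a) = free_mod P B"
  "x \<oplus>\<^bsub>free_gmodule (mpoly_ring P) B a\<^esub> y = x + y"
  "\<zero>\<^bsub>free_gmodule (mpoly_ring P) B a\<^esub> = 0"
  "r \<odot>\<^bsub>free_gmodule (mpoly_ring P) B a\<^esub> x = scl r x"
  by (auto simp: free_gmodule_def Let_def free_mod_def scl_def fun_eq_iff)

lemma hcomp_free_gmodule:
  "hcomp (free_gmodule (mpoly_ring P) B a) j =
    {f \<in> free_mod P B. \<forall>b\<in>B. f b \<in> hcomp (mpoly_ring P) (j - a b)}"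
  by (auto simp: free_gmodule_def Let_def free_mod_def)

lemma hcomp_mpoly_ring: "hcomp (mpoly_ring P) j = {f \<in> polys P. \<forall>m\<in>supp f. int (tdeg m) = j}"
  by (simp add: mpoly_ring_def Let_def polys_def tdeg_def)

text \<open>The image of a module under an additive and homogeneous map is a module. Quotients and tensor products satisfy
the axioms through this lemma, as their elements are images of vectors.\<close>

lemma module_transfer:
  assumes M: "module R M" and carr: "carrier N = h ` carrier M"
    and add: "\<And>x y. x \<in> carrier M \<Longrightarrow> y \<in> carrier M \<Longrightarrow> h x \<oplus>\<^bsub>N\<^esub> h y = h (x \<oplus>\<^bsub>M\<^esub> y)"
    and smult: "\<And>r x. r \<in> carrier R \<Longrightarrow> x \<in> carrier M \<Longrightarrow> r \<odot>\<^bsub>N\<^esub> h x = h (r \<odot>\<^bsub>M\<^esub> x)"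
    and zero: "\<zero>\<^bsub>N\<^esub> = h \<zero>\<^bsub>M\<^esub>"
  shows "module R N"
proof -
  interpret M: module R M by (rule M)
  show ?thesis
  proof (rule module_criteria)
    show "cring R" by (rule M.is_cring)
    show "\<forall>v\<in>carrier N. \<exists>w\<in>carrier N. v \<oplus>\<^bsub>N\<^esub> w = \<zero>\<^bsub>N\<^esub>"
    proof
      fix v assume "v \<in> carrier N"
      then obtain x where "x \<in> carrier M" "v = h x" by (auto simp: carr)
      then show "\<exists>w\<in>carrier N. v \<oplus>\<^bsub>N\<^esub> w = \<zero>\<^bsub>N\<^esub>"
        by (intro bexI[of _ "h (\<ominus>\<^bsub>M\<^esub> x)"]) (auto simp: carr add zero M.M.r_neg)
    qed
  qed (auto simp: carr add smult zero M.M.a_ac M.smult_assoc1 M.smult_l_distr M.smult_r_distr)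
qed

lemma module_free_gmodule: "module (mpoly_ring P) (free_gmodule (mpoly_ring P) B a)"
proof (rule module_criteria)
  show "\<forall>v\<in>carrier (free_gmodule (mpoly_ring P) B a). \<exists>w\<in>carrier (free_gmodule (mpoly_ring P) B a).
      v \<oplus>\<^bsub>free_gmodule (mpoly_ring P) B a\<^esub> w = \<zero>\<^bsub>free_gmodule (mpoly_ring P) B a\<^esub>"
  proof
    fix v assume "v \<in> carrier (free_gmodule (mpoly_ring P) B a)"
    then show "\<exists>w\<in>carrier (free_gmodule (mpoly_ring P) B a).
      v \<oplus>\<^bsub>free_gmodule (mpoly_ring P) B a\<^esub> w = \<zero>\<^bsub>free_gmodule (mpoly_ring P) B a\<^esub>"
      by (intro bexI[of _ "- v"]) (auto simp: free_mod_uminus)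
  qed
qed (auto simp: cring_mpoly_ring free_mod_add free_mod_zero free_mod_scl add.assoc add.commute
    fun_eq_iff mult.assoc distrib_right distrib_left)

lemma module_cong:
  assumes "module R M" "carrier N = carrier M" "\<And>x y. x \<oplus>\<^bsub>N\<^esub> y = x \<oplus>\<^bsub>M\<^esub> y"
    "\<And>r x. r \<odot>\<^bsub>N\<^esub> x = r \<odot>\<^bsub>M\<^esub> x" "\<zero>\<^bsub>N\<^esub> = \<zero>\<^bsub>M\<^esub>"
  shows "module R N"
  by (rule module_transfer[OF assms(1), where h = "\<lambda>x. x"]) (use assms in auto)

lemma module_sub_gmodule:
  assumes "module R M" "submodule R Z M" shows "module R (sub_gmodule M Z)"
  by (rule module_cong[OF module.submodule_is_module[OF assms]]) (auto simp: sub_gmodule_def)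

lemma sub_gmodule_simps [simp]:
  "carrier (sub_gmodule M Z) = Z" "x \<oplus>\<^bsub>sub_gmodule M Z\<^esub> y = x \<oplus>\<^bsub>M\<^esub> y"
  "\<zero>\<^bsub>sub_gmodule M Z\<^esub> = \<zero>\<^bsub>M\<^esub>" "r \<odot>\<^bsub>sub_gmodule M Z\<^esub> x = r \<odot>\<^bsub>M\<^esub> x"
  "hcomp (sub_gmodule M Z) j = Z \<inter> hcomp M j"
  by (simp_all add: sub_gmodule_def)

lemma submodule_abelian_subgroup:
  assumes "module R M" "submodule R N M" shows "abelian_subgroup N M"
proof -
  interpret M: module R M by (rule assms)
  interpret N: submodule R N M by (rule assms)
  have neg: "\<ominus>\<^bsub>M\<^esub> x \<in> N" if x: "x \<in> N" for x
  proof -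
    have "x \<in> carrier M" using x N.subset by blast
    then have "\<ominus>\<^bsub>M\<^esub> x = (\<ominus>\<^bsub>R\<^esub> \<one>\<^bsub>R\<^esub>) \<odot>\<^bsub>M\<^esub> x" by (rule M.smult_minus_1[symmetric])
    then show ?thesis using N.smult_closed[OF M.R.a_inv_closed[OF M.R.one_closed] x] by simp
  qed
  have ne: "N \<noteq> {}" using N.zero_closed by blast
  have "subgroup N (add_monoid M)"
    by (rule group.subgroupI[OF M.M.a_group])
      (use N.subset ne N.m_closed neg in \<open>auto simp: a_inv_def\<close>)
  then show ?thesis
    by (intro abelian_subgroupI3 additive_subgroup.intro M.M.abelian_group_axioms)
qed

locale submodule_quotient =
  fixes R :: "('r, 'c) ring_scheme" and M :: "('r, 'm) gmodule" and N :: "'m set"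
  assumes mod: "module R M" and sub: "submodule R N M"
begin

sublocale M: module R M by (rule mod)
sublocale N: submodule R N M by (rule sub)
sublocale A: abelian_subgroup N M by (rule submodule_abelian_subgroup[OF mod sub])

abbreviation coset where "coset x \<equiv> N +>\<^bsub>M\<^esub> x"

lemma carrier_quot: "carrier (quot_gmodule M N) = coset ` carrier M"
  by (auto simp: quot_gmodule_def FactRing_def A_RCOSETS_def')

lemma add_quot:
  "x \<in> carrier M \<Longrightarrow> y \<in> carrier M \<Longrightarrow> coset x \<oplus>\<^bsub>quot_gmodule M N\<^esub> coset y = coset (x \<oplus>\<^bsub>M\<^esub> y)"
  by (simp add: quot_gmodule_def FactRing_def A.a_rcos_sum)

lemma coset_eq_iff:
  assumes "x \<in> carrier M" "y \<in> carrier M" shows "coset x = coset y \<longleftrightarrow> x \<ominus>\<^bsub>M\<^esub> y \<in> N"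
proof
  assume h: "coset x = coset y"
  have "x \<in> coset y" using A.a_rcos_self[OF assms(1)] h by simp
  then show "x \<ominus>\<^bsub>M\<^esub> y \<in> N" using A.a_rcos_module_imp[OF assms(2)] by (simp add: a_minus_def)
next
  assume "x \<ominus>\<^bsub>M\<^esub> y \<in> N"
  then have "x \<in> coset y" using A.a_rcos_module_rev[OF assms(2,1)] by (simp add: a_minus_def)
  then show "coset x = coset y" using M.M.a_repr_independence[OF _ assms(2)] A.a_subgroup by metis
qed

lemma coset_zero: "coset \<zero>\<^bsub>M\<^esub> = N"
  using M.M.a_coset_add_zero[of N] N.subset by blast

lemma zero_quot: "\<zero>\<^bsub>quot_gmodule M N\<^esub> = coset \<zero>\<^bsub>M\<^esub>"
  by (simp add: quot_gmodule_def FactRing_def coset_zero)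

lemma coset_eq_zero: "x \<in> carrier M \<Longrightarrow> coset x = \<zero>\<^bsub>quot_gmodule M N\<^esub> \<longleftrightarrow> x \<in> N"
  unfolding zero_quot coset_zero using A.a_rcos_self A.a_rcos_const by blast

lemma smult_quot:
  assumes r: "r \<in> carrier R" and x: "x \<in> carrier M"
  shows "r \<odot>\<^bsub>quot_gmodule M N\<^esub> coset x = coset (r \<odot>\<^bsub>M\<^esub> x)"
proof -
  have "N <+>\<^bsub>M\<^esub> (\<lambda>x. r \<odot>\<^bsub>M\<^esub> x) ` coset x = coset (r \<odot>\<^bsub>M\<^esub> x)"
  proof
    show "N <+>\<^bsub>M\<^esub> (\<lambda>x. r \<odot>\<^bsub>M\<^esub> x) ` coset x \<subseteq> coset (r \<odot>\<^bsub>M\<^esub> x)"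
    proof
      fix t assume "t \<in> N <+>\<^bsub>M\<^esub> (\<lambda>x. r \<odot>\<^bsub>M\<^esub> x) ` coset x"
      then obtain n k where n: "n \<in> N" "k \<in> N" "t = n \<oplus>\<^bsub>M\<^esub> r \<odot>\<^bsub>M\<^esub> (k \<oplus>\<^bsub>M\<^esub> x)"
        by (auto simp: set_add_def' a_r_coset_def')
      have c: "n \<in> carrier M" "k \<in> carrier M" using n N.subset by auto
      have "t = (n \<oplus>\<^bsub>M\<^esub> r \<odot>\<^bsub>M\<^esub> k) \<oplus>\<^bsub>M\<^esub> r \<odot>\<^bsub>M\<^esub> x"
        using n c r x by (simp add: M.smult_r_distr M.M.a_assoc)
      moreover have "n \<oplus>\<^bsub>M\<^esub> r \<odot>\<^bsub>M\<^esub> k \<in> N" using n r by auto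
      ultimately show "t \<in> coset (r \<odot>\<^bsub>M\<^esub> x)" by (auto simp: a_r_coset_def')
    qed
    show "coset (r \<odot>\<^bsub>M\<^esub> x) \<subseteq> N <+>\<^bsub>M\<^esub> (\<lambda>x. r \<odot>\<^bsub>M\<^esub> x) ` coset x"
    proof
      fix t assume "t \<in> coset (r \<odot>\<^bsub>M\<^esub> x)"
      then obtain n where "n \<in> N" "t = n \<oplus>\<^bsub>M\<^esub> r \<odot>\<^bsub>M\<^esub> x" by (auto simp: a_r_coset_def')
      moreover have "x \<in> coset x" by (rule A.a_rcos_self[OF x])
      ultimately show "t \<in> N <+>\<^bsub>M\<^esub> (\<lambda>x. r \<odot>\<^bsub>M\<^esub> x) ` coset x" by (auto simp: set_add_def')
    qed
  qed
  then show ?thesis by (simp add: quot_gmodule_def)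
qed

lemma module_quot: "module R (quot_gmodule M N)"
  by (rule module_transfer[OF mod, where h = coset])
    (simp_all add: carrier_quot add_quot smult_quot zero_quot)

lemma hcomp_quot: "hcomp (quot_gmodule M N) j = coset ` hcomp M j"
  by (simp add: quot_gmodule_def)

end

section \<open>Dimension by coordinates\<close>

lemma K_space_simps [simp]:
  "carrier (K_space M) = carrier M" "x \<oplus>\<^bsub>K_space M\<^esub> y = x \<oplus>\<^bsub>M\<^esub> y" "\<zero>\<^bsub>K_space M\<^esub> = \<zero>\<^bsub>M\<^esub>"
  "c \<odot>\<^bsub>K_space M\<^esub> x = monom_mp 0 c \<odot>\<^bsub>M\<^esub> x"
  by (simp_all add: K_space_def)

lemma vectorspace_K_space:
  fixes M :: "(('p, 'k::field) mpoly, 'm) gmodule"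
  assumes "module (mpoly_ring P) M" shows "vectorspace (class_ring :: 'k ring) (K_space M)"
proof -
  interpret M: module "mpoly_ring P" M by (rule assms)
  have c: "monom_mp 0 a \<in> polys P" for a :: 'k by (rule polys_monom) simp
  have "module (class_ring :: 'k ring) (K_space M)"
  proof (rule module_criteria)
    show "cring (class_ring :: 'k ring)" by (rule class_cring.cring_axioms)
    show "\<forall>v\<in>carrier (K_space M). \<exists>w\<in>carrier (K_space M). v \<oplus>\<^bsub>K_space M\<^esub> w = \<zero>\<^bsub>K_space M\<^esub>"
      using M.M.r_neg M.M.a_inv_closed by auto
    show "\<forall>a b v. a \<in> carrier (class_ring :: 'k ring) \<and> b \<in> carrier (class_ring :: 'k ring) \<and> v \<in> carrier (K_space M) \<longrightarrow>
      (a \<otimes>\<^bsub>class_ring\<^esub> b) \<odot>\<^bsub>K_space M\<^esub> v = a \<odot>\<^bsub>K_space M\<^esub> (b \<odot>\<^bsub>K_space M\<^esub> v)"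
    proof (intro allI impI)
      fix a b :: 'k and v assume "a \<in> carrier (class_ring :: 'k ring) \<and> b \<in> carrier (class_ring :: 'k ring) \<and> v \<in> carrier (K_space M)"
      then have v: "v \<in> carrier M" by simp
      have "(monom_mp 0 (a * b) :: ('p, 'k) mpoly) = monom_mp 0 a * monom_mp 0 b" by (simp add: mult_single)
      then show "(a \<otimes>\<^bsub>class_ring\<^esub> b) \<odot>\<^bsub>K_space M\<^esub> v = a \<odot>\<^bsub>K_space M\<^esub> (b \<odot>\<^bsub>K_space M\<^esub> v)"
        using M.smult_assoc1[of "monom_mp 0 a" "monom_mp 0 b" v] v c by simp
    qed
    show "\<forall>v\<in>carrier (K_space M). \<one>\<^bsub>class_ring\<^esub> \<odot>\<^bsub>K_space M\<^esub> v = v"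
      using M.smult_one by simp
    show "\<forall>a b v. a \<in> carrier (class_ring :: 'k ring) \<and> b \<in> carrier (class_ring :: 'k ring) \<and> v \<in> carrier (K_space M) \<longrightarrow>
      (a \<oplus>\<^bsub>class_ring\<^esub> b) \<odot>\<^bsub>K_space M\<^esub> v = a \<odot>\<^bsub>K_space M\<^esub> v \<oplus>\<^bsub>K_space M\<^esub> b \<odot>\<^bsub>K_space M\<^esub> v"
      using M.smult_l_distr c by (simp add: single_add)
  qed (use M.smult_closed M.smult_r_distr M.M.a_assoc M.M.a_comm c in auto)
  then show ?thesis
    by (simp add: vectorspace_def class_field.field_axioms)
qed

text \<open>Vectors with the coordinates of unit vectors exist by surjectivity and form a basis. Stated this way, the dimension
can be computed without exhibiting an isomorphism to a function space.\<close>

lemma dim_by_coordinates: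
  fixes V :: "('k::field, 'v) module" and I :: "'x set" and \<theta> :: "'v \<Rightarrow> 'x \<Rightarrow> 'k"
  assumes V: "vectorspace (class_ring :: 'k ring) V" and fin: "finite I"
    and add: "\<And>u v i. u \<in> carrier V \<Longrightarrow> v \<in> carrier V \<Longrightarrow> i \<in> I \<Longrightarrow> \<theta> (u \<oplus>\<^bsub>V\<^esub> v) i = \<theta> u i + \<theta> v i"
    and smult: "\<And>c v i. v \<in> carrier V \<Longrightarrow> i \<in> I \<Longrightarrow> \<theta> (c \<odot>\<^bsub>V\<^esub> v) i = c * \<theta> v i"
    and inj: "\<And>v. v \<in> carrier V \<Longrightarrow> (\<And>i. i \<in> I \<Longrightarrow> \<theta> v i = 0) \<Longrightarrow> v = \<zero>\<^bsub>V\<^esub>"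
    and surj: "\<And>t. \<exists>v\<in>carrier V. \<forall>i\<in>I. \<theta> v i = t i"
  shows "K_fin_dim V" "K_dim V = card I"
proof -
  interpret V: vectorspace "class_ring :: 'k ring" V by (rule V)
  have "\<exists>e. \<forall>i. e i \<in> carrier V \<and> (\<forall>j\<in>I. \<theta> (e i) j = (if j = i then 1 else 0))"
  proof (intro choice allI)
    fix i
    show "\<exists>v. v \<in> carrier V \<and> (\<forall>j\<in>I. \<theta> v j = (if j = i then 1 else 0))"
      using surj[of "\<lambda>j. if j = i then 1 else 0"] by blast
  qed
  then obtain e where e: "\<And>i. e i \<in> carrier V" "\<And>i j. j \<in> I \<Longrightarrow> \<theta> (e i) j = (if j = i then 1 else 0)"
    by blast
  have inj_e: "inj_on e I"
  proof (rule inj_onI)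
    fix i j assume ij: "i \<in> I" "j \<in> I" "e i = e j"
    have "\<theta> (e i) i = 1" using e(2)[OF ij(1), of i] by simp
    moreover have "\<theta> (e j) i = (if i = j then 1 else 0)" by (rule e(2)[OF ij(1)])
    ultimately show "i = j" using ij(3) by (simp split: if_splits)
  qed
  have zero: "\<theta> \<zero>\<^bsub>V\<^esub> i = 0" if "i \<in> I" for i
    using add[OF V.M.zero_closed V.M.zero_closed that] V.M.r_zero[OF V.M.zero_closed]
    by (metis add_cancel_left_left)
  have sum: "\<theta> (finsum V f J) i = (\<Sum>j\<in>J. \<theta> (f j) i)" if "finite J" "f \<in> J \<rightarrow> carrier V" "i \<in> I"
    for f :: "'v \<Rightarrow> 'v" and J :: "'v set" and i
    using that
  proof (induction J rule: finite_induct)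
    case empty
    then show ?case by (simp add: zero)
  next
    case (insert x F)
    then have "f \<in> F \<rightarrow> carrier V" "f x \<in> carrier V" by auto
    then show ?case using insert by (simp add: add V.M.finsum_insert V.M.finsum_closed)
  qed
  define A where "A = e ` I"
  have A: "finite A" "A \<subseteq> carrier V" "card A = card I"
    using fin e(1) inj_e by (auto simp: A_def card_image)
  have lc: "\<theta> (V.lincomb a A) i = a (e i)" if i: "i \<in> I" for a i
  proof -
    have "\<theta> (V.lincomb a A) i = (\<Sum>u\<in>A. \<theta> (a u \<odot>\<^bsub>V\<^esub> u) i)"
      unfolding V.lincomb_def using A i by (intro sum) (auto intro!: V.smult_closed)
    also have "\<dots> = (\<Sum>u\<in>A. a u * \<theta> u i)"
      using A i by (intro sum.cong) (auto intro!: smult)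
    also have "\<dots> = (\<Sum>j\<in>I. a (e j) * \<theta> (e j) i)"
      unfolding A_def by (rule sum.reindex_cong[OF inj_e]) auto
    also have "\<dots> = (\<Sum>j\<in>I. if i = j then a (e j) else 0)"
      using i by (intro sum.cong) (auto simp: e)
    also have "\<dots> = a (e i)" using i fin by simp
    finally show ?thesis .
  qed
  have lin: "V.lin_indpt A"
  proof (rule V.finite_lin_indpt2[OF A(1,2)])
    fix a assume "V.lincomb a A = \<zero>\<^bsub>V\<^esub>"
    then have "a (e i) = 0" if "i \<in> I" for i using lc[OF that, of a] zero[OF that] by simp
    then show "\<forall>v\<in>A. a v = \<zero>\<^bsub>class_ring\<^esub>" by (auto simp: A_def)
  qed
  have gen: "V.gen_set A"
  proof
    show "V.span A \<subseteq> carrier V" by (rule V.span_is_subset2[OF A(2)])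
    show "carrier V \<subseteq> V.span A"
    proof
      fix w assume w: "w \<in> carrier V"
      define a where "a u = \<theta> w (inv_into I e u)" for u
      have lcc: "V.lincomb a A \<in> carrier V" using A by (intro V.lincomb_closed) auto
      have "w \<oplus>\<^bsub>V\<^esub> (- 1) \<odot>\<^bsub>V\<^esub> V.lincomb a A = \<zero>\<^bsub>V\<^esub>"
      proof (rule inj)
        show "w \<oplus>\<^bsub>V\<^esub> (- 1) \<odot>\<^bsub>V\<^esub> V.lincomb a A \<in> carrier V" using w lcc by (auto intro!: V.smult_closed)
        fix i assume i: "i \<in> I"
        have "a (e i) = \<theta> w i" using i inj_e by (simp add: a_def)
        then show "\<theta> (w \<oplus>\<^bsub>V\<^esub> (- 1) \<odot>\<^bsub>V\<^esub> V.lincomb a A) i = 0"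
          using add[OF w _ i, of "(- 1) \<odot>\<^bsub>V\<^esub> V.lincomb a A"] lcc smult[OF lcc i, of "- 1"] lc[OF i, of a]
          by (auto simp: V.smult_closed)
      qed
      moreover have "(- 1) \<odot>\<^bsub>V\<^esub> V.lincomb a A = \<ominus>\<^bsub>V\<^esub> V.lincomb a A"
        using V.smult_minus_1[OF lcc] by (simp add: class_ring_simps)
      ultimately have "w = V.lincomb a A"
        using w lcc V.M.minus_equality[of w "\<ominus>\<^bsub>V\<^esub> V.lincomb a A"] V.M.minus_minus by fastforce
      then show "w \<in> V.span A" unfolding V.span_def using A by auto
    qed
  qed
  show "K_fin_dim V" unfolding K_fin_dim_def V.fin_dim_def using A gen by blast
  have "V.basis A" unfolding V.basis_def using lin gen A by blast
  then show "K_dim V = card I" unfolding K_dim_def using V.dim_basis[of A] A by simp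
qed

section \<open>Tensoring a free module with a cyclic module\<close>

lemma module_mpoly_ring: "module (mpoly_ring P) (mpoly_ring P)"
proof -
  interpret cring "mpoly_ring P" by (rule cring_mpoly_ring)
  show ?thesis
    by (rule module_criteria)
      (auto simp: cring_mpoly_ring mult.assoc distrib_left distrib_right add.assoc add.commute
        intro: bexI[of _ "- _"])
qed

lemma submodule_poly_ideal:
  assumes "poly_ideal P J" shows "submodule (mpoly_ring P) J (mpoly_ring P)"
  by (rule submodule.intro[OF module_mpoly_ring]) (use poly_idealD[OF assms] in auto)

lemma a_minus_mpoly_ring:
  assumes "x \<in> polys P" "y \<in> polys P" shows "x \<ominus>\<^bsub>mpoly_ring P\<^esub> y = x - y"
proof -
  interpret cring "mpoly_ring P" by (rule cring_mpoly_ring)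
  have "\<ominus>\<^bsub>mpoly_ring P\<^esub> y = - y" using minus_equality[of "- y" y] assms by simp
  then show ?thesis by (simp add: a_minus_def)
qed

lemma a_minus_free_gmodule:
  assumes "x \<in> free_mod P B" "y \<in> free_mod P B"
  shows "x \<ominus>\<^bsub>free_gmodule (mpoly_ring P) B a\<^esub> y = x - y"
proof -
  interpret module "mpoly_ring P" "free_gmodule (mpoly_ring P) B a" by (rule module_free_gmodule)
  have "\<ominus>\<^bsub>free_gmodule (mpoly_ring P) B a\<^esub> y = - y"
    using M.minus_equality[of "- y" y] assms by (simp add: free_mod_uminus)
  then show ?thesis by (simp add: a_minus_def)
qed

lemma basis_elt_mpoly_ring: "basis_elt (mpoly_ring P) b = unitv b"
  by (auto simp: basis_elt_def unitv_def fun_eq_iff)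

text \<open>The tensor product of a free module \<open>F\<close> with the cyclic module \<open>R/J\<close>. It will be identified with \<open>F / J F\<close>.\<close>

locale cyclic_tensor =
  fixes P :: "'p set" and J :: "('p, 'k::field) mpoly set" and B :: "'b set" and a :: "'b \<Rightarrow> int"
  assumes J: "poly_ideal P J"
begin

abbreviation "R \<equiv> mpoly_ring P :: (('p, 'k) mpoly, ('p, 'k) mpoly) gmodule"
abbreviation "F \<equiv> free_gmodule R B a"
abbreviation "M \<equiv> quot_gmodule R J"
abbreviation "E \<equiv> tensor_free R F M"
abbreviation "N \<equiv> tensor_rel R F M"
abbreviation "T \<equiv> tensor R F M"
abbreviation "D \<equiv> free_mod P B \<times> carrier M"

sublocale QM: submodule_quotient R R J
  by (rule submodule_quotient.intro[OF module_mpoly_ring submodule_poly_ideal[OF J]])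

abbreviation \<kappa> :: "('p, 'k) mpoly \<Rightarrow> ('p, 'k) mpoly set" where "\<kappa> r \<equiv> J +>\<^bsub>R\<^esub> r"

lemma carrier_M: "carrier M = \<kappa> ` polys P"
  using QM.carrier_quot by simp

lemma \<kappa>_eq_iff: "r \<in> polys P \<Longrightarrow> s \<in> polys P \<Longrightarrow> \<kappa> r = \<kappa> s \<longleftrightarrow> r - s \<in> J"
  using QM.coset_eq_iff[of r s] by (simp add: a_minus_mpoly_ring)

lemma \<kappa>_add: "r \<in> polys P \<Longrightarrow> s \<in> polys P \<Longrightarrow> \<kappa> r \<oplus>\<^bsub>M\<^esub> \<kappa> s = \<kappa> (r + s)"
  using QM.add_quot[of r s] by simp

lemma \<kappa>_smult: "r \<in> polys P \<Longrightarrow> s \<in> polys P \<Longrightarrow> r \<odot>\<^bsub>M\<^esub> \<kappa> s = \<kappa> (r * s)"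
  using QM.smult_quot[of r s] by simp

lemma carrier_E: "carrier E = free_mod P D"
  by (simp add: tensor_free_def)

lemma E_simps [simp]: "x \<oplus>\<^bsub>E\<^esub> y = x + y" "\<zero>\<^bsub>E\<^esub> = 0" "r \<odot>\<^bsub>E\<^esub> x = scl r x"
  by (simp_all add: tensor_free_def)

lemma module_E: "module R E"
  unfolding tensor_free_def by (rule module_free_gmodule)

lemma a_minus_E: "x \<in> free_mod P D \<Longrightarrow> y \<in> free_mod P D \<Longrightarrow> x \<ominus>\<^bsub>E\<^esub> y = x - y"
  using a_minus_free_gmodule[of x P D y "\<lambda>_. 0"] by (simp add: tensor_free_def)

definition rels :: "(('b \<Rightarrow> ('p, 'k) mpoly) \<times> ('p, 'k) mpoly set \<Rightarrow> ('p, 'k) mpoly) set" where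
  "rels = {unitv (m + m', n) - (unitv (m, n) + unitv (m', n)) | m m' n.
          m \<in> free_mod P B \<and> m' \<in> free_mod P B \<and> n \<in> carrier M} \<union>
       {unitv (m, n \<oplus>\<^bsub>M\<^esub> n') - (unitv (m, n) + unitv (m, n')) | m n n'.
          m \<in> free_mod P B \<and> n \<in> carrier M \<and> n' \<in> carrier M} \<union>
       {unitv (scl r m, n) - scl r (unitv (m, n)) | r m n.
          r \<in> polys P \<and> m \<in> free_mod P B \<and> n \<in> carrier M} \<union>
       {unitv (m, r \<odot>\<^bsub>M\<^esub> n) - scl r (unitv (m, n)) | r m n.
          r \<in> polys P \<and> m \<in> free_mod P B \<and> n \<in> carrier M}"

lemma M_closed: "n \<in> carrier M \<Longrightarrow> n' \<in> carrier M \<Longrightarrow> n \<oplus>\<^bsub>M\<^esub> n' \<in> carrier M"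
    "r \<in> polys P \<Longrightarrow> n \<in> carrier M \<Longrightarrow> r \<odot>\<^bsub>M\<^esub> n \<in> carrier M"
  by (auto simp: carrier_M \<kappa>_add \<kappa>_smult)

lemma unitv_E: "m \<in> free_mod P B \<Longrightarrow> n \<in> carrier M \<Longrightarrow> unitv (m, n) \<in> free_mod P D"
  by (rule free_mod_unitv) simp

lemma N_eq: "N = module.span R E rels"
proof -
  have "{basis_elt R (m \<oplus>\<^bsub>F\<^esub> m', n) \<ominus>\<^bsub>E\<^esub> (basis_elt R (m, n) \<oplus>\<^bsub>E\<^esub> basis_elt R (m', n)) | m m' n.
          m \<in> carrier F \<and> m' \<in> carrier F \<and> n \<in> carrier M} \<union>
       {basis_elt R (m, n \<oplus>\<^bsub>M\<^esub> n') \<ominus>\<^bsub>E\<^esub> (basis_elt R (m, n) \<oplus>\<^bsub>E\<^esub> basis_elt R (m, n')) | m n n'.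
          m \<in> carrier F \<and> n \<in> carrier M \<and> n' \<in> carrier M} \<union>
       {basis_elt R (r \<odot>\<^bsub>F\<^esub> m, n) \<ominus>\<^bsub>E\<^esub> (r \<odot>\<^bsub>E\<^esub> basis_elt R (m, n)) | r m n.
          r \<in> carrier R \<and> m \<in> carrier F \<and> n \<in> carrier M} \<union>
       {basis_elt R (m, r \<odot>\<^bsub>M\<^esub> n) \<ominus>\<^bsub>E\<^esub> (r \<odot>\<^bsub>E\<^esub> basis_elt R (m, n)) | r m n.
          r \<in> carrier R \<and> m \<in> carrier F \<and> n \<in> carrier M} = rels"
    unfolding rels_def
    by (intro arg_cong2[where f = "(\<union>)"] Collect_cong ex_cong1 rev_conj_cong)
      (auto simp: basis_elt_mpoly_ring a_minus_E unitv_E free_mod_add free_mod_scl M_closed)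
  then show ?thesis unfolding tensor_rel_def Let_def by simp
qed

lemma rels_sub: "rels \<subseteq> carrier E"
  unfolding rels_def carrier_E
  by (auto intro!: free_mod_diff free_mod_add free_mod_scl unitv_E M_closed)

lemma submodule_N: "submodule R N E"
  unfolding N_eq by (rule module.span_is_submodule[OF module_E rels_sub])

lemma rels_N: "rels \<subseteq> N"
  unfolding N_eq by (rule module.in_own_span[OF module_E rels_sub])

sublocale QE: submodule_quotient R E N
  by (rule submodule_quotient.intro[OF module_E submodule_N])

lemma T_simps:
  "carrier T = carrier (quot_gmodule E N)" "\<zero>\<^bsub>T\<^esub> = \<zero>\<^bsub>quot_gmodule E N\<^esub>"
  "x \<oplus>\<^bsub>T\<^esub> y = x \<oplus>\<^bsub>quot_gmodule E N\<^esub> y" "r \<odot>\<^bsub>T\<^esub> x = r \<odot>\<^bsub>quot_gmodule E N\<^esub> x"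
  by (simp_all add: tensor_def Let_def)

lemma module_T: "module R T"
  by (rule module_cong[OF QE.module_quot]) (simp_all add: T_simps)

abbreviation pure where "pure m n \<equiv> pure_tensor R F M m n"

lemma pure_eq: "pure m n = QE.coset (unitv (m, n))"
  by (simp add: pure_tensor_def basis_elt_mpoly_ring)

lemma coset_eqI:
  assumes "x - y \<in> N" "x \<in> free_mod P D" "y \<in> free_mod P D" shows "QE.coset x = QE.coset y"
  using QE.coset_eq_iff[of x y] assms by (simp add: carrier_E a_minus_E)

lemma coset_smult:
  assumes "r \<in> polys P" "x \<in> free_mod P D" shows "QE.coset (scl r x) = r \<odot>\<^bsub>T\<^esub> QE.coset x"
proof -
  have "r \<odot>\<^bsub>quot_gmodule E N\<^esub> QE.coset x = QE.coset (r \<odot>\<^bsub>E\<^esub> x)"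
    by (rule QE.smult_quot) (use assms in \<open>simp_all add: carrier_E\<close>)
  then show ?thesis by (simp only: T_simps E_simps)
qed

lemma coset_add:
  assumes "x \<in> free_mod P D" "y \<in> free_mod P D" shows "QE.coset (x + y) = QE.coset x \<oplus>\<^bsub>T\<^esub> QE.coset y"
proof -
  have "QE.coset x \<oplus>\<^bsub>quot_gmodule E N\<^esub> QE.coset y = QE.coset (x \<oplus>\<^bsub>E\<^esub> y)"
    by (rule QE.add_quot) (use assms in \<open>simp_all add: carrier_E\<close>)
  then show ?thesis by (simp only: T_simps E_simps)
qed

lemma pure_in_T: "m \<in> free_mod P B \<Longrightarrow> n \<in> carrier M \<Longrightarrow> pure m n \<in> carrier T"
  by (auto simp: T_simps QE.carrier_quot pure_eq carrier_E unitv_E)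

lemma pure_add_left:
  assumes "m \<in> free_mod P B" "m' \<in> free_mod P B" "n \<in> carrier M"
  shows "pure (m + m') n = pure m n \<oplus>\<^bsub>T\<^esub> pure m' n"
proof -
  have "unitv (m + m', n) - (unitv (m, n) + unitv (m', n)) \<in> N"
    using assms by (intro subsetD[OF rels_N]) (unfold rels_def, blast)
  then have "QE.coset (unitv (m + m', n)) = QE.coset (unitv (m, n) + unitv (m', n))"
    by (rule coset_eqI) (use assms in \<open>auto intro!: free_mod_add unitv_E\<close>)
  then show ?thesis
    using assms QE.add_quot[of "unitv (m, n)" "unitv (m', n)"]
    by (simp add: pure_eq T_simps carrier_E unitv_E)
qed

lemma pure_smult_left:
  assumes "r \<in> polys P" "m \<in> free_mod P B" "n \<in> carrier M"
  shows "pure (scl r m) n = r \<odot>\<^bsub>T\<^esub> pure m n"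
proof -
  have "unitv (scl r m, n) - scl r (unitv (m, n)) \<in> N"
    using assms by (intro subsetD[OF rels_N]) (unfold rels_def, blast)
  then have "QE.coset (unitv (scl r m, n)) = QE.coset (scl r (unitv (m, n)))"
    by (rule coset_eqI) (use assms in \<open>auto intro!: free_mod_scl unitv_E\<close>)
  then show ?thesis
    using assms QE.smult_quot[of r "unitv (m, n)"] by (simp add: pure_eq T_simps carrier_E unitv_E)
qed

lemma pure_smult_right:
  assumes "r \<in> polys P" "m \<in> free_mod P B" "n \<in> carrier M"
  shows "pure m (r \<odot>\<^bsub>M\<^esub> n) = r \<odot>\<^bsub>T\<^esub> pure m n"
proof -
  have "unitv (m, r \<odot>\<^bsub>M\<^esub> n) - scl r (unitv (m, n)) \<in> N"
    using assms by (intro subsetD[OF rels_N]) (unfold rels_def, blast)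
  then have "QE.coset (unitv (m, r \<odot>\<^bsub>M\<^esub> n)) = QE.coset (scl r (unitv (m, n)))"
    by (rule coset_eqI) (use assms in \<open>auto intro!: free_mod_scl unitv_E M_closed\<close>)
  then show ?thesis
    using assms QE.smult_quot[of r "unitv (m, n)"] by (simp add: pure_eq T_simps carrier_E unitv_E)
qed

text \<open>The map inducing the isomorphism from \<open>F / J F\<close>.\<close>

definition \<psi> :: "('b \<Rightarrow> ('p, 'k) mpoly) \<Rightarrow> (('b \<Rightarrow> ('p, 'k) mpoly) \<times> ('p, 'k) mpoly set \<Rightarrow> ('p, 'k) mpoly) set" where
  "\<psi> x = pure x (\<kappa> 1)"

lemma \<kappa>_in: "r \<in> polys P \<Longrightarrow> \<kappa> r \<in> carrier M"
  by (simp add: carrier_M)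

lemma \<psi>_in: "x \<in> free_mod P B \<Longrightarrow> \<psi> x \<in> carrier T"
  by (simp add: \<psi>_def pure_in_T \<kappa>_in)

lemma \<psi>_add: "x \<in> free_mod P B \<Longrightarrow> y \<in> free_mod P B \<Longrightarrow> \<psi> x \<oplus>\<^bsub>T\<^esub> \<psi> y = \<psi> (x + y)"
  by (simp add: \<psi>_def pure_add_left \<kappa>_in)

lemma \<psi>_smult: "r \<in> polys P \<Longrightarrow> x \<in> free_mod P B \<Longrightarrow> r \<odot>\<^bsub>T\<^esub> \<psi> x = \<psi> (scl r x)"
  by (simp add: \<psi>_def pure_smult_left \<kappa>_in)

text \<open>Every pure tensor is in the image, since \<open>x \<otimes> r = r x \<otimes> 1\<close>.\<close>

lemma pure_\<kappa>:
  assumes "x \<in> free_mod P B" "r \<in> polys P" shows "pure x (\<kappa> r) = \<psi> (scl r x)"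
proof -
  have "r \<odot>\<^bsub>M\<^esub> \<kappa> 1 = \<kappa> r" using \<kappa>_smult[OF assms(2) polys_one] by simp
  then have "pure x (\<kappa> r) = r \<odot>\<^bsub>T\<^esub> \<psi> x"
    using pure_smult_right[OF assms(2,1) \<kappa>_in[OF polys_one]] by (simp only: \<psi>_def)
  then show ?thesis by (simp only: \<psi>_smult[OF assms(2,1)])
qed

lemma \<psi>_zero: "\<zero>\<^bsub>T\<^esub> = \<psi> 0"
proof -
  interpret T: module R T by (rule module_T)
  have "\<psi> 0 \<oplus>\<^bsub>T\<^esub> \<psi> 0 = \<psi> 0" using \<psi>_add[OF free_mod_zero free_mod_zero] by simp
  then show ?thesis
    using \<psi>_in[OF free_mod_zero] T.M.add.l_cancel_one' by force
qed

lemma \<psi>_surj: "carrier T = \<psi> ` free_mod P B"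
proof
  show "\<psi> ` free_mod P B \<subseteq> carrier T" using \<psi>_in by auto
  show "carrier T \<subseteq> \<psi> ` free_mod P B"
  proof
    fix t assume "t \<in> carrier T"
    then obtain f where f: "f \<in> free_mod P D" "t = QE.coset f"
      by (auto simp: T_simps QE.carrier_quot carrier_E)
    have fb: "b \<in> D" if "f b \<noteq> 0" for b using free_modD(3)[OF f(1)] that by blast
    have "(\<Sum>b\<in>S. scl (f b) (unitv b)) \<in> free_mod P D \<and> QE.coset (\<Sum>b\<in>S. scl (f b) (unitv b)) \<in> \<psi> ` free_mod P B"
      if "finite S" "S \<subseteq> {b. f b \<noteq> 0}" for S
      using that
    proof (induction S rule: finite_induct)
      case empty
      have "QE.coset 0 = \<psi> 0"
        using \<psi>_zero by (simp add: T_simps QE.zero_quot)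
      then have "QE.coset 0 \<in> \<psi> ` free_mod P B" using free_mod_zero by (rule image_eqI)
      then show ?case unfolding sum.empty by (intro conjI free_mod_zero)
    next
      case (insert b S)
      let ?s = "\<Sum>b\<in>S. scl (f b) (unitv b)"
      have "f b \<noteq> 0" using insert.prems by simp
      then have bD: "b \<in> D" by (rule fb)
      obtain m n where b1: "b = (m, n)" by (cases b)
      then have b: "b = (m, n)" "m \<in> free_mod P B" "n \<in> carrier M" using bD by simp_all
      obtain r where r: "r \<in> polys P" "n = \<kappa> r" using b(3) unfolding carrier_M by blast
      have "S \<subseteq> {b. f b \<noteq> 0}" using insert.prems by simp
      from insert.IH[OF this] obtain x where x: "x \<in> free_mod P B" "QE.coset ?s = \<psi> x"
        and s: "?s \<in> free_mod P D" by blast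
      have fp: "f b \<in> polys P" by (rule free_modD(1)[OF f(1)])
      have u: "unitv b \<in> free_mod P D" using b by (simp add: unitv_E)
      have su: "scl (f b) (unitv b) \<in> free_mod P D" by (rule free_mod_scl[OF fp u])
      have "pure m n = QE.coset (unitv b)" by (simp only: pure_eq b1)
      then have "QE.coset (scl (f b) (unitv b)) = f b \<odot>\<^bsub>T\<^esub> pure m n"
        by (simp only: coset_smult[OF fp u])
      also have "\<dots> = \<psi> (scl (f b) (scl r m))"
        unfolding r(2) pure_\<kappa>[OF b(2) r(1)] by (rule \<psi>_smult[OF fp free_mod_scl[OF r(1) b(2)]])
      finally have e: "QE.coset (scl (f b) (unitv b)) = \<psi> (scl (f b) (scl r m))" .
      have y: "scl (f b) (scl r m) \<in> free_mod P B" by (intro free_mod_scl fp r b)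
      have "QE.coset (scl (f b) (unitv b) + ?s) = \<psi> (scl (f b) (scl r m)) \<oplus>\<^bsub>T\<^esub> \<psi> x"
        by (simp only: coset_add[OF su s] e x(2))
      also have "\<dots> = \<psi> (scl (f b) (scl r m) + x)" by (rule \<psi>_add[OF y x(1)])
      finally have "QE.coset (scl (f b) (unitv b) + ?s) \<in> \<psi> ` free_mod P B"
        using free_mod_add[OF y x(1)] by (rule image_eqI)
      then show ?case
        unfolding sum.insert[OF insert.hyps] by (intro conjI free_mod_add[OF su s])
    qed
    then have "QE.coset (\<Sum>b\<in>{b. f b \<noteq> 0}. scl (f b) (unitv b)) \<in> \<psi> ` free_mod P B"
      using free_modD(2)[OF f(1)] by blast
    then show "t \<in> \<psi> ` free_mod P B"
      using f(2) free_mod_expand[OF f(1)] by simp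
  qed
qed

definition rep :: "('p, 'k) mpoly set \<Rightarrow> ('p, 'k) mpoly" where
  "rep Y = (SOME r. r \<in> polys P \<and> Y = \<kappa> r)"

lemma rep: "Y \<in> carrier M \<Longrightarrow> rep Y \<in> polys P \<and> Y = \<kappa> (rep Y)"
  unfolding rep_def by (rule someI_ex) (auto simp: carrier_M)

text \<open>Detects the kernel of \<open>\<psi>\<close>: the map that sends the pure tensor of \<open>m\<close> and the class of \<open>r\<close> to \<open>r m\<close> is bilinear modulo \<open>J F\<close>,
though not before, because representatives are chosen arbitrarily. Hence it sends all tensor relations to \<open>J F\<close>.\<close>

lemma N_functional:
  assumes h: "lin P D B h" and hu: "\<And>m n. m \<in> free_mod P B \<Longrightarrow> n \<in> carrier M \<Longrightarrow> h (unitv (m, n)) = scl (rep n) m"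
    and f: "f \<in> N"
  shows "h f b \<in> J"
proof -
  define S where "S = {f \<in> free_mod P D. \<forall>b. h f b \<in> J}"
  have "submodule R S E"
  proof (rule submodule.intro[OF module_E])
    show "S \<subseteq> carrier E" by (auto simp: S_def carrier_E)
    show "\<zero>\<^bsub>E\<^esub> \<in> S" by (simp add: S_def free_mod_zero lin_zero[OF h] poly_idealD[OF J])
    show "v \<oplus>\<^bsub>E\<^esub> w \<in> S" if "v \<in> S" "w \<in> S" for v w
      using that by (simp add: S_def free_mod_add lin_add[OF h] poly_idealD[OF J])
    show "c \<odot>\<^bsub>E\<^esub> v \<in> S" if "c \<in> carrier R" "v \<in> S" for c v
      using that by (simp add: S_def free_mod_scl lin_scl[OF h] poly_idealD[OF J])
  qed
  moreover have "rels \<subseteq> S"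
  proof -
    have in_S: "x - y \<in> S" if "x \<in> free_mod P D" "y \<in> free_mod P D" "\<And>b. h x b - h y b \<in> J" for x y
      using that by (simp add: S_def free_mod_diff lin_diff[OF h])
    have rp: "rep n \<in> polys P" "n = \<kappa> (rep n)" if "n \<in> carrier M" for n using rep[OF that] by auto
    have 1: "unitv (m + m', n) - (unitv (m, n) + unitv (m', n)) \<in> S"
      if "m \<in> free_mod P B" "m' \<in> free_mod P B" "n \<in> carrier M" for m m' n
      using that by (intro in_S free_mod_add unitv_E)
        (simp_all add: lin_add[OF h] unitv_E hu free_mod_add distrib_left poly_idealD[OF J])
    have 2: "unitv (m, n \<oplus>\<^bsub>M\<^esub> n') - (unitv (m, n) + unitv (m, n')) \<in> S"
      if "m \<in> free_mod P B" "n \<in> carrier M" "n' \<in> carrier M" for m n n'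
    proof (intro in_S free_mod_add unitv_E that M_closed)
      fix b
      have "\<kappa> (rep (n \<oplus>\<^bsub>M\<^esub> n')) = \<kappa> (rep n + rep n')"
        using rp[OF M_closed(1)[OF that(2,3)]] rp[OF that(2)] rp[OF that(3)] \<kappa>_add by metis
      then have "rep (n \<oplus>\<^bsub>M\<^esub> n') - (rep n + rep n') \<in> J"
        using rp[OF M_closed(1)[OF that(2,3)]] rp[OF that(2)] rp[OF that(3)] by (subst (asm) \<kappa>_eq_iff) auto
      then have "m b * (rep (n \<oplus>\<^bsub>M\<^esub> n') - (rep n + rep n')) \<in> J"
        by (intro poly_idealD(4)[OF J] free_modD(1)[OF that(1)])
      then show "h (unitv (m, n \<oplus>\<^bsub>M\<^esub> n')) b - h (unitv (m, n) + unitv (m, n')) b \<in> J"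
        using that by (simp add: lin_add[OF h] unitv_E hu M_closed algebra_simps)
    qed
    have 3: "unitv (scl r m, n) - scl r (unitv (m, n)) \<in> S"
      if "r \<in> polys P" "m \<in> free_mod P B" "n \<in> carrier M" for r m n
      using that by (intro in_S free_mod_scl unitv_E)
        (simp_all add: lin_scl[OF h] unitv_E hu free_mod_scl mult.left_commute poly_idealD[OF J])
    have 4: "unitv (m, r \<odot>\<^bsub>M\<^esub> n) - scl r (unitv (m, n)) \<in> S"
      if "r \<in> polys P" "m \<in> free_mod P B" "n \<in> carrier M" for r m n
    proof (intro in_S free_mod_scl unitv_E that M_closed)
      fix b
      have "\<kappa> (rep (r \<odot>\<^bsub>M\<^esub> n)) = \<kappa> (r * rep n)"
        using rp[OF M_closed(2)[OF that(1,3)]] rp[OF that(3)] \<kappa>_smult[OF that(1)] by metis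
      then have "rep (r \<odot>\<^bsub>M\<^esub> n) - r * rep n \<in> J"
        using rp[OF M_closed(2)[OF that(1,3)]] rp[OF that(3)] that by (subst (asm) \<kappa>_eq_iff) auto
      then have "m b * (rep (r \<odot>\<^bsub>M\<^esub> n) - r * rep n) \<in> J"
        by (intro poly_idealD(4)[OF J] free_modD(1)[OF that(2)])
      then show "h (unitv (m, r \<odot>\<^bsub>M\<^esub> n)) b - h (scl r (unitv (m, n))) b \<in> J"
        using that by (simp add: lin_scl[OF h] unitv_E hu M_closed algebra_simps)
    qed
    show ?thesis unfolding rels_def using 1 2 3 4 by blast
  qed
  ultimately have "N \<subseteq> S" unfolding N_eq by (intro module.span_is_subset[OF module_E])
  then show ?thesis using f by (auto simp: S_def)
qed

lemma \<psi>_eq_zero_iff: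
  assumes x: "x \<in> free_mod P B"
  shows "\<psi> x = \<zero>\<^bsub>T\<^esub> \<longleftrightarrow> (\<forall>b. x b \<in> J)"
proof
  assume "\<psi> x = \<zero>\<^bsub>T\<^esub>"
  then have mem: "unitv (x, \<kappa> 1) \<in> N"
    using QE.coset_eq_zero[of "unitv (x, \<kappa> 1)"] x by (simp add: \<psi>_def pure_eq T_simps carrier_E unitv_E \<kappa>_in)
  have rp: "rep n \<in> polys P" "n = \<kappa> (rep n)" if "n \<in> carrier M" for n using rep[OF that] by auto
  have y: "(\<lambda>(m, n). scl (rep n) m) c \<in> free_mod P B" if "c \<in> D" for c
    using that rp by (auto intro!: free_mod_scl)
  obtain h where h: "lin P D B h" "\<And>c. c \<in> D \<Longrightarrow> h (unitv c) = (\<lambda>(m, n). scl (rep n) m) c"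
    using lin_extend[of D "\<lambda>(m, n). scl (rep n) m" P B] y by blast
  have one: "\<kappa> 1 \<in> carrier M" by (simp add: \<kappa>_in)
  have d: "1 - rep (\<kappa> 1) \<in> J"
    using rp[OF one] \<kappa>_eq_iff[of 1 "rep (\<kappa> 1)"] by simp
  show "\<forall>b. x b \<in> J"
  proof
    fix b
    have "h (unitv (x, \<kappa> 1)) b \<in> J"
      by (rule N_functional[OF h(1) _ mem]) (simp add: h(2))
    then have "rep (\<kappa> 1) * x b \<in> J" using x one by (simp add: h(2))
    moreover have "x b * (1 - rep (\<kappa> 1)) \<in> J" by (rule poly_idealD(4)[OF J free_modD(1)[OF x] d])
    ultimately have "x b * (1 - rep (\<kappa> 1)) + rep (\<kappa> 1) * x b \<in> J" by (intro poly_idealD(3)[OF J])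
    then show "x b \<in> J" by (simp add: algebra_simps)
  qed
next
  assume xJ: "\<forall>b. x b \<in> J"
  have u: "unitv b \<in> free_mod P B" if "x b \<noteq> 0" for b
    using free_modD(3)[OF x, of b] that by (intro free_mod_unitv) blast
  have "(\<Sum>b\<in>S. scl (x b) (unitv b)) \<in> free_mod P B \<and> \<psi> (\<Sum>b\<in>S. scl (x b) (unitv b)) = \<zero>\<^bsub>T\<^esub>"
    if "finite S" "S \<subseteq> {b. x b \<noteq> 0}" for S
    using that
  proof (induction S rule: finite_induct)
    case empty
    show ?case unfolding sum.empty by (intro conjI free_mod_zero \<psi>_zero[symmetric])
  next
    case (insert b S)
    let ?s = "\<Sum>b\<in>S. scl (x b) (unitv b)"
    have "S \<subseteq> {b. x b \<noteq> 0}" using insert.prems by simp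
    from insert.IH[OF this] have s: "?s \<in> free_mod P B" "\<psi> ?s = \<zero>\<^bsub>T\<^esub>" by blast+
    have ub: "unitv b \<in> free_mod P B" by (rule u) (use insert.prems in simp)
    have xb: "x b \<in> polys P" by (rule free_modD(1)[OF x])
    have \<kappa>b: "\<kappa> (x b) = \<kappa> 0" using xJ xb by (simp add: \<kappa>_eq_iff)
    have "\<psi> (scl (x b) (unitv b)) = pure (unitv b) (\<kappa> (x b))" by (rule pure_\<kappa>[OF ub xb, symmetric])
    also have "\<dots> = pure (unitv b) (\<kappa> 0)" by (simp only: \<kappa>b)
    also have "\<dots> = \<psi> (scl 0 (unitv b))" by (rule pure_\<kappa>[OF ub polys_zero])
    also have "scl 0 (unitv b) = (0 :: 'b \<Rightarrow> ('p, 'k) mpoly)" by (simp add: scl_def zero_fun_def)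
    finally have "\<psi> (scl (x b) (unitv b) + ?s) = \<psi> 0 \<oplus>\<^bsub>T\<^esub> \<psi> 0"
      using \<psi>_add[OF free_mod_scl[OF xb ub] s(1)] s(2) by (simp only: \<psi>_zero)
    also have "\<dots> = \<zero>\<^bsub>T\<^esub>"
      using \<psi>_add[OF free_mod_zero free_mod_zero] by (simp only: \<psi>_zero add_0_left)
    finally show ?case
      unfolding sum.insert[OF insert.hyps] by (intro conjI free_mod_add[OF free_mod_scl[OF xb ub] s(1)])
  qed
  from this[OF free_modD(2)[OF x] subset_refl] show "\<psi> x = \<zero>\<^bsub>T\<^esub>"
    using free_mod_expand[OF x] by simp
qed

lemma \<psi>_eq_iff:
  assumes "x \<in> free_mod P B" "y \<in> free_mod P B"
  shows "\<psi> x = \<psi> y \<longleftrightarrow> (\<forall>b. (x - y) b \<in> J)"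
proof -
  interpret T: module R T by (rule module_T)
  have d: "\<psi> x = \<psi> (x - y) \<oplus>\<^bsub>T\<^esub> \<psi> y" using \<psi>_add[OF free_mod_diff[OF assms] assms(2)] by simp
  have "\<psi> x = \<psi> y \<longleftrightarrow> \<psi> (x - y) = \<zero>\<^bsub>T\<^esub>"
    unfolding d using T.M.add.l_cancel_one[OF \<psi>_in[OF assms(2)] \<psi>_in[OF free_mod_diff[OF assms]]]
    T.M.add.r_cancel_one[OF \<psi>_in[OF assms(2)] \<psi>_in[OF free_mod_diff[OF assms]]] by simp
  then show ?thesis using \<psi>_eq_zero_iff[OF free_mod_diff[OF assms]] by simp
qed

lemma \<psi>_hcomp:
  assumes "x \<in> hcomp F j" shows "\<psi> x \<in> hcomp T j"
proof -
  have "1 \<in> hcomp R 0" by (simp add: hcomp_mpoly_ring tdeg_def)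
  then have "\<kappa> 1 \<in> hcomp M 0" by (simp add: QM.hcomp_quot)
  then have "pure x (\<kappa> 1) \<in> {pure m n | m n s t. m \<in> hcomp F s \<and> n \<in> hcomp M t \<and> s + t = j}"
    using assms by force
  then show ?thesis unfolding \<psi>_def tensor_def Let_def by (simp add: generate.incl)
qed

end

section \<open>Homology of a tensored resolution\<close>

text \<open>The map \<open>h \<otimes> id\<close> is selected by its values on pure tensors, so the point is that some homomorphism has these
values. It is induced by \<open>h\<close>, which sends \<open>J F\<close> to \<open>J F'\<close>.\<close>

lemma tensor_map_\<psi>:
  assumes J: "poly_ideal P J" and h: "lin P B B' h" and x: "x \<in> free_mod P B"
  shows "tensor_map (mpoly_ring P) (free_gmodule (mpoly_ring P) B a) (free_gmodule (mpoly_ring P) B' a')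
      (quot_gmodule (mpoly_ring P) J) h (cyclic_tensor.\<psi> P J B a x) = cyclic_tensor.\<psi> P J B' a' (h x)"
proof -
  interpret S: cyclic_tensor P J B a by (rule cyclic_tensor.intro[OF J])
  interpret T: cyclic_tensor P J B' a' by (rule cyclic_tensor.intro[OF J])
  define sel where "sel t = (SOME y. y \<in> free_mod P B \<and> S.\<psi> y = t)" for t
  have sel: "sel t \<in> free_mod P B" "S.\<psi> (sel t) = t" if "t \<in> carrier S.T" for t
  proof -
    have "\<exists>y. y \<in> free_mod P B \<and> S.\<psi> y = t" using that unfolding S.\<psi>_surj by auto
    then have "sel t \<in> free_mod P B \<and> S.\<psi> (sel t) = t" unfolding sel_def by (rule someI_ex)
    then show "sel t \<in> free_mod P B" "S.\<psi> (sel t) = t" by auto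
  qed
  define g where "g t = T.\<psi> (h (sel t))" for t
  have g: "g (S.\<psi> y) = T.\<psi> (h y)" if y: "y \<in> free_mod P B" for y
  proof -
    note s = sel[OF S.\<psi>_in[OF y]]
    have "\<forall>b. (sel (S.\<psi> y) - y) b \<in> J" using s(2) S.\<psi>_eq_iff[OF s(1) y] by simp
    then have "h (sel (S.\<psi> y) - y) b \<in> J" for b
      using lin_preserves_ideal[OF J h free_mod_diff[OF s(1) y]] by simp
    then have "\<forall>b. (h (sel (S.\<psi> y)) - h y) b \<in> J" by (simp add: lin_diff[OF h s(1) y])
    then show ?thesis
      unfolding g_def using T.\<psi>_eq_iff[OF lin_closed[OF h s(1)] lin_closed[OF h y]] by simp
  qed
  let ?Q = "\<lambda>g. g \<in> LinearCombinations.module_hom S.R S.T T.T \<and>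
    (\<forall>m\<in>carrier S.F. \<forall>n\<in>carrier S.M. g (S.pure m n) = T.pure (h m) n)"
  have "?Q g"
  proof (intro conjI ballI)
    show "g \<in> LinearCombinations.module_hom S.R S.T T.T"
      unfolding LinearCombinations.module_hom_def
    proof (intro CollectI conjI allI impI funcsetI)
      fix t assume "t \<in> carrier S.T"
      then obtain y where y: "y \<in> free_mod P B" "t = S.\<psi> y" unfolding S.\<psi>_surj by auto
      show "g t \<in> carrier T.T" unfolding y(2) g[OF y(1)] by (rule T.\<psi>_in[OF lin_closed[OF h y(1)]])
    next
      fix t u assume "t \<in> carrier S.T \<and> u \<in> carrier S.T"
      then obtain y z where y: "y \<in> free_mod P B" "t = S.\<psi> y" and z: "z \<in> free_mod P B" "u = S.\<psi> z"
        unfolding S.\<psi>_surj by auto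
      show "g (t \<oplus>\<^bsub>S.T\<^esub> u) = g t \<oplus>\<^bsub>T.T\<^esub> g u"
        unfolding y(2) z(2) S.\<psi>_add[OF y(1) z(1)] g[OF y(1)] g[OF z(1)] g[OF free_mod_add[OF y(1) z(1)]]
          T.\<psi>_add[OF lin_closed[OF h y(1)] lin_closed[OF h z(1)]] lin_add[OF h y(1) z(1)] ..
    next
      fix r t assume "r \<in> carrier S.R \<and> t \<in> carrier S.T"
      then obtain y where r: "r \<in> polys P" and y: "y \<in> free_mod P B" "t = S.\<psi> y"
        unfolding S.\<psi>_surj by auto
      show "g (r \<odot>\<^bsub>S.T\<^esub> t) = r \<odot>\<^bsub>T.T\<^esub> g t"
        unfolding y(2) S.\<psi>_smult[OF r y(1)] g[OF y(1)] g[OF free_mod_scl[OF r y(1)]]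
          T.\<psi>_smult[OF r lin_closed[OF h y(1)]] lin_scl[OF h r y(1)] ..
    qed
    fix m n assume "m \<in> carrier S.F" "n \<in> carrier S.M"
    then obtain r where m: "m \<in> free_mod P B" and r: "r \<in> polys P" "n = S.\<kappa> r"
      unfolding S.carrier_M by auto
    show "g (S.pure m n) = T.pure (h m) n"
      unfolding r(2) S.pure_\<kappa>[OF m r(1)] T.pure_\<kappa>[OF lin_closed[OF h m] r(1)]
        g[OF free_mod_scl[OF r(1) m]] lin_scl[OF h r(1) m] ..
  qed
  then have "?Q (tensor_map S.R S.F T.F S.M h)" unfolding tensor_map_def by (rule someI[of ?Q])
  then have "tensor_map S.R S.F T.F S.M h (S.pure x (S.\<kappa> 1)) = T.pure (h x) (S.\<kappa> 1)"
    using x S.\<kappa>_in[OF polys_one] by simp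
  then show ?thesis unfolding S.\<psi>_def T.\<psi>_def .
qed

text \<open>Homology in degree \<open>Suc k\<close> of a complex of free modules tensored with \<open>R/J\<close>, described by vectors of the original
complex.\<close>

locale tensored_complex =
  fixes P :: "'p set" and J :: "('p, 'k::field) mpoly set"
    and B :: "nat \<Rightarrow> nat set" and a :: "nat \<Rightarrow> nat \<Rightarrow> int"
    and d :: "nat \<Rightarrow> (nat \<Rightarrow> ('p, 'k) mpoly) \<Rightarrow> nat \<Rightarrow> ('p, 'k) mpoly" and k :: nat
  assumes J: "poly_ideal P J" and d_lin: "\<And>i. lin P (B (Suc i)) (B i) (d i)"
    and dd: "\<And>x. x \<in> free_mod P (B (Suc (Suc k))) \<Longrightarrow> d k (d (Suc k) x) = 0"
begin

abbreviation "R \<equiv> mpoly_ring P :: (('p, 'k) mpoly, ('p, 'k) mpoly) gmodule"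
abbreviation "F i \<equiv> free_gmodule R (B i) (a i)"
abbreviation "M \<equiv> quot_gmodule R J"
abbreviation "C i \<equiv> tensor R (F i) M"
abbreviation "\<psi> i \<equiv> cyclic_tensor.\<psi> P J (B i) (a i)"
abbreviation "H \<equiv> homology (\<lambda>i. tensor R (F i) M) (\<lambda>i. tensor_map R (F (Suc i)) (F i) M (d i)) (Suc k)"

sublocale CT: cyclic_tensor P J "B i" "a i" for i
  by (rule cyclic_tensor.intro[OF J])

text \<open>Vectors that become cycles after tensoring.\<close>

definition Z :: "(nat \<Rightarrow> ('p, 'k) mpoly) set" where
  "Z = {x \<in> free_mod P (B (Suc k)). \<forall>b. d k x b \<in> J}"

definition ZT where "ZT = cycles (\<lambda>i. tensor R (F i) M) (\<lambda>i. tensor_map R (F (Suc i)) (F i) M (d i)) (Suc k)"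
definition BT where "BT = boundaries (\<lambda>i. tensor R (F i) M) (\<lambda>i. tensor_map R (F (Suc i)) (F i) M (d i)) (Suc k)"

lemma Z_free: "x \<in> Z \<Longrightarrow> x \<in> free_mod P (B (Suc k))"
  by (simp add: Z_def)

lemma Z_add: "x \<in> Z \<Longrightarrow> y \<in> Z \<Longrightarrow> x + y \<in> Z"
  by (simp add: Z_def free_mod_add lin_add[OF d_lin] poly_idealD[OF J])

lemma Z_scl: "r \<in> polys P \<Longrightarrow> x \<in> Z \<Longrightarrow> scl r x \<in> Z"
  by (simp add: Z_def free_mod_scl lin_scl[OF d_lin] poly_idealD[OF J])

lemma Z_diff: "x \<in> Z \<Longrightarrow> y \<in> Z \<Longrightarrow> x - y \<in> Z"
  by (simp add: Z_def free_mod_diff lin_diff[OF d_lin] poly_ideal_diff[OF J])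

lemma Z_zero: "0 \<in> Z"
  unfolding Z_def using lin_zero[OF d_lin] by (simp add: free_mod_zero poly_idealD[OF J])

lemma d_in_Z: "w \<in> free_mod P (B (Suc (Suc k))) \<Longrightarrow> d (Suc k) w \<in> Z"
  unfolding Z_def using dd[of w] lin_closed[OF d_lin[of "Suc k"]] by (simp add: poly_idealD[OF J])

lemma map_\<psi>: "x \<in> free_mod P (B (Suc i)) \<Longrightarrow>
  tensor_map R (F (Suc i)) (F i) M (d i) (\<psi> (Suc i) x) = \<psi> i (d i x)"
  by (rule tensor_map_\<psi>[OF J d_lin])

lemma ZT_eq: "ZT = \<psi> (Suc k) ` Z"
proof -
  have "tensor_map R (F (Suc k)) (F k) M (d k) (\<psi> (Suc k) x) = \<zero>\<^bsub>C k\<^esub> \<longleftrightarrow> x \<in> Z"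
    if "x \<in> free_mod P (B (Suc k))" for x
    unfolding map_\<psi>[OF that] using CT.\<psi>_eq_zero_iff[OF lin_closed[OF d_lin that]] that by (simp add: Z_def)
  then show ?thesis
    unfolding ZT_def cycles.simps CT.\<psi>_surj using Z_free by auto
qed

lemma BT_eq: "BT = (\<lambda>w. \<psi> (Suc k) (d (Suc k) w)) ` free_mod P (B (Suc (Suc k)))"
proof -
  have "(\<lambda>w. tensor_map R (F (Suc (Suc k))) (F (Suc k)) M (d (Suc k)) (\<psi> (Suc (Suc k)) w)) `
      free_mod P (B (Suc (Suc k))) = (\<lambda>w. \<psi> (Suc k) (d (Suc k) w)) ` free_mod P (B (Suc (Suc k)))"
    by (rule image_cong[OF refl]) (rule map_\<psi>)
  then show ?thesis unfolding BT_def boundaries_def CT.\<psi>_surj image_image .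
qed

abbreviation "SZ \<equiv> sub_gmodule (C (Suc k)) ZT"

lemma H_eq: "H = quot_gmodule SZ BT"
  by (simp add: homology_def ZT_def BT_def)

lemma submodule_ZT: "submodule R ZT (C (Suc k))"
proof (rule submodule.intro[OF CT.module_T])
  show "ZT \<subseteq> carrier (C (Suc k))" unfolding ZT_eq CT.\<psi>_surj using Z_free by auto
  show "\<zero>\<^bsub>C (Suc k)\<^esub> \<in> ZT" unfolding ZT_eq CT.\<psi>_zero using Z_zero by (rule imageI)
  show "v \<oplus>\<^bsub>C (Suc k)\<^esub> w \<in> ZT" if vw: "v \<in> ZT" "w \<in> ZT" for v w
  proof -
    obtain x y where xy: "x \<in> Z" "v = \<psi> (Suc k) x" "y \<in> Z" "w = \<psi> (Suc k) y" using vw unfolding ZT_eq by auto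
    show ?thesis unfolding xy(2,4) CT.\<psi>_add[OF Z_free[OF xy(1)] Z_free[OF xy(3)]] ZT_eq
      by (rule imageI[OF Z_add[OF xy(1,3)]])
  qed
  show "c \<odot>\<^bsub>C (Suc k)\<^esub> v \<in> ZT" if c: "c \<in> carrier R" and v: "v \<in> ZT" for c v
  proof -
    obtain x where x: "x \<in> Z" "v = \<psi> (Suc k) x" using v unfolding ZT_eq by auto
    have c': "c \<in> polys P" using c by simp
    show ?thesis unfolding x(2) CT.\<psi>_smult[OF c' Z_free[OF x(1)]] ZT_eq
      by (rule imageI[OF Z_scl[OF c' x(1)]])
  qed
qed

lemma module_SZ: "module R SZ"
  by (rule module_sub_gmodule[OF CT.module_T submodule_ZT])

lemma submodule_BT: "submodule R BT SZ"
proof (rule submodule.intro[OF module_SZ])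
  let ?f = "\<lambda>w. \<psi> (Suc k) (d (Suc k) w)" and ?W = "free_mod P (B (Suc (Suc k)))"
  have fr: "d (Suc k) w \<in> free_mod P (B (Suc k))" if "w \<in> ?W" for w by (rule Z_free[OF d_in_Z[OF that]])
  show "BT \<subseteq> carrier SZ" using d_in_Z unfolding BT_eq by (auto simp: ZT_eq)
  have "\<zero>\<^bsub>C (Suc k)\<^esub> = ?f 0" unfolding lin_zero[OF d_lin] by (rule CT.\<psi>_zero)
  then show "\<zero>\<^bsub>SZ\<^esub> \<in> BT" unfolding BT_eq sub_gmodule_simps using free_mod_zero by (rule image_eqI)
  show "v \<oplus>\<^bsub>SZ\<^esub> w \<in> BT" if vw: "v \<in> BT" "w \<in> BT" for v w
  proof -
    obtain x y where xy: "x \<in> ?W" "v = ?f x" "y \<in> ?W" "w = ?f y" using vw unfolding BT_eq by auto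
    have "v \<oplus>\<^bsub>SZ\<^esub> w = ?f (x + y)"
      unfolding sub_gmodule_simps xy(2,4) CT.\<psi>_add[OF fr[OF xy(1)] fr[OF xy(3)]] lin_add[OF d_lin xy(1,3)] ..
    then show ?thesis unfolding BT_eq using free_mod_add[OF xy(1,3)] by (rule image_eqI)
  qed
  show "c \<odot>\<^bsub>SZ\<^esub> v \<in> BT" if c: "c \<in> carrier R" and v: "v \<in> BT" for c v
  proof -
    obtain x where x: "x \<in> ?W" "v = ?f x" using v unfolding BT_eq by auto
    have c': "c \<in> polys P" using c by simp
    have "c \<odot>\<^bsub>SZ\<^esub> v = ?f (scl c x)"
      unfolding sub_gmodule_simps x(2) CT.\<psi>_smult[OF c' fr[OF x(1)]] lin_scl[OF d_lin c' x(1)] ..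
    then show ?thesis unfolding BT_eq using free_mod_scl[OF c' x(1)] by (rule image_eqI)
  qed
qed

sublocale Q: submodule_quotient R SZ BT
  by (rule submodule_quotient.intro[OF module_SZ submodule_BT])

lemma module_H: "module R H"
  unfolding H_eq by (rule Q.module_quot)

definition cls where "cls x = Q.coset (\<psi> (Suc k) x)"

lemma \<psi>_SZ: "x \<in> Z \<Longrightarrow> \<psi> (Suc k) x \<in> carrier SZ"
  by (simp add: ZT_eq)

lemma carrier_H: "carrier H = cls ` Z"
proof -
  have "carrier H = Q.coset ` carrier SZ" unfolding H_eq by (rule Q.carrier_quot)
  also have "carrier SZ = \<psi> (Suc k) ` Z" using ZT_eq by simp
  also have "Q.coset ` (\<psi> (Suc k) ` Z) = cls ` Z" unfolding image_image cls_def ..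
  finally show ?thesis .
qed

lemma cls_add:
  assumes "x \<in> Z" "y \<in> Z" shows "cls x \<oplus>\<^bsub>H\<^esub> cls y = cls (x + y)"
  unfolding H_eq cls_def Q.add_quot[OF \<psi>_SZ[OF assms(1)] \<psi>_SZ[OF assms(2)]] sub_gmodule_simps
    CT.\<psi>_add[OF Z_free[OF assms(1)] Z_free[OF assms(2)]] ..

lemma cls_smult:
  assumes "r \<in> polys P" "x \<in> Z" shows "r \<odot>\<^bsub>H\<^esub> cls x = cls (scl r x)"
proof -
  have r: "r \<in> carrier R" using assms by simp
  show ?thesis
    unfolding H_eq cls_def Q.smult_quot[OF r \<psi>_SZ[OF assms(2)]] sub_gmodule_simps
      CT.\<psi>_smult[OF assms(1) Z_free[OF assms(2)]] ..
qed

lemma cls_zero_iff: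
  assumes x: "x \<in> Z"
  shows "cls x = \<zero>\<^bsub>H\<^esub> \<longleftrightarrow> (\<exists>w\<in>free_mod P (B (Suc (Suc k))). \<forall>b. (x - d (Suc k) w) b \<in> J)"
proof -
  have "cls x = \<zero>\<^bsub>H\<^esub> \<longleftrightarrow> \<psi> (Suc k) x \<in> BT"
    unfolding H_eq cls_def by (rule Q.coset_eq_zero[OF \<psi>_SZ[OF x]])
  also have "\<dots> \<longleftrightarrow> (\<exists>w\<in>free_mod P (B (Suc (Suc k))). \<psi> (Suc k) x = \<psi> (Suc k) (d (Suc k) w))"
    unfolding BT_eq by blast
  also have "\<dots> \<longleftrightarrow> (\<exists>w\<in>free_mod P (B (Suc (Suc k))). \<forall>b. (x - d (Suc k) w) b \<in> J)"
    using CT.\<psi>_eq_iff[OF Z_free[OF x] Z_free[OF d_in_Z]] by (intro bex_cong) simp_all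
  finally show ?thesis .
qed

lemma hcomp_H:
  assumes "x \<in> Z" "x \<in> hcomp (F (Suc k)) j" shows "cls x \<in> hcomp H j"
  unfolding H_eq Q.hcomp_quot cls_def
  using assms CT.\<psi>_hcomp[OF assms(2)] by (intro imageI) (simp add: ZT_eq)

lemma hcomp_H_sub: "hcomp H j \<subseteq> carrier H"
  unfolding H_eq Q.hcomp_quot Q.carrier_quot by auto

text \<open>Coordinates on vectors that detect boundaries modulo \<open>J\<close> are coordinates on homology. If every coordinate vector is
attained by a homogeneous vector of degree \<open>j\<close>, then every class has a representative of degree \<open>j\<close>.\<close>

theorem homology_by_coordinates:
  fixes I :: "'x set" and \<Phi> :: "(nat \<Rightarrow> ('p, 'k) mpoly) \<Rightarrow> 'x \<Rightarrow> 'k"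
  assumes fin: "finite I"
    and add: "\<And>x y i. x \<in> Z \<Longrightarrow> y \<in> Z \<Longrightarrow> i \<in> I \<Longrightarrow> \<Phi> (x + y) i = \<Phi> x i + \<Phi> y i"
    and smult: "\<And>c x i. x \<in> Z \<Longrightarrow> i \<in> I \<Longrightarrow> \<Phi> (scl (monom_mp 0 c) x) i = c * \<Phi> x i"
    and surj: "\<And>t. \<exists>x\<in>Z. x \<in> hcomp (F (Suc k)) j \<and> (\<forall>i\<in>I. \<Phi> x i = t i)"
    and ker: "\<And>x. x \<in> Z \<Longrightarrow> (\<forall>i\<in>I. \<Phi> x i = 0) \<longleftrightarrow>
      (\<exists>w\<in>free_mod P (B (Suc (Suc k))). \<forall>b. (x - d (Suc k) w) b \<in> J)"
  shows "K_fin_dim (K_space H)" "K_dim (K_space H) = card I" "hcomp H j = carrier H"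
proof -
  interpret H: module R H by (rule module_H)
  have c: "monom_mp 0 c \<in> polys P" for c :: 'k by (rule polys_monom) simp
  have diff: "\<Phi> (x - y) i = \<Phi> x i - \<Phi> y i" if "x \<in> Z" "y \<in> Z" "i \<in> I" for x y i
    using add[OF Z_diff[OF that(1,2)] that(2,3)] by simp
  have cls_eq: "cls x = cls y \<longleftrightarrow> (\<forall>i\<in>I. \<Phi> x i = \<Phi> y i)" if "x \<in> Z" "y \<in> Z" for x y
  proof -
    have eq: "cls x = cls (x - y) \<oplus>\<^bsub>H\<^esub> cls y" using cls_add[OF Z_diff[OF that] that(2)] by simp
    have cl: "cls y \<in> carrier H" "cls (x - y) \<in> carrier H" using that Z_diff[OF that] unfolding carrier_H by auto
    have "cls x = cls y \<longleftrightarrow> cls (x - y) = \<zero>\<^bsub>H\<^esub>"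
    proof
      assume "cls x = cls y"
      then show "cls (x - y) = \<zero>\<^bsub>H\<^esub>"
        using eq H.M.add.r_cancel_one[OF cl] H.M.add.l_cancel_one[OF cl] by simp
    next
      assume "cls (x - y) = \<zero>\<^bsub>H\<^esub>"
      then show "cls x = cls y" using eq cl by simp
    qed
    also have "\<dots> \<longleftrightarrow> (\<forall>i\<in>I. \<Phi> (x - y) i = 0)"
      using cls_zero_iff[OF Z_diff[OF that]] ker[OF Z_diff[OF that]] by simp
    also have "\<dots> \<longleftrightarrow> (\<forall>i\<in>I. \<Phi> x i = \<Phi> y i)" using diff[OF that] by (intro ball_cong) auto
    finally show ?thesis .
  qed
  define sel where "sel t = (SOME x. x \<in> Z \<and> cls x = t)" for t
  have sel: "sel t \<in> Z" "cls (sel t) = t" if "t \<in> carrier H" for t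
  proof -
    have "\<exists>x. x \<in> Z \<and> cls x = t" using that unfolding carrier_H by auto
    then have "sel t \<in> Z \<and> cls (sel t) = t" unfolding sel_def by (rule someI_ex)
    then show "sel t \<in> Z" "cls (sel t) = t" by auto
  qed
  define \<theta> where "\<theta> t = \<Phi> (sel t)" for t
  have \<theta>: "\<theta> (cls x) i = \<Phi> x i" if "x \<in> Z" "i \<in> I" for x i
  proof -
    have "cls x \<in> carrier H" using that unfolding carrier_H by auto
    then show ?thesis unfolding \<theta>_def using sel[of "cls x"] cls_eq[of "sel (cls x)" x] that by simp
  qed
  have V: "vectorspace (class_ring :: 'k ring) (K_space H)" by (rule vectorspace_K_space[OF module_H])
  have 1: "\<theta> (u \<oplus>\<^bsub>K_space H\<^esub> v) i = \<theta> u i + \<theta> v i"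
    if uv: "u \<in> carrier (K_space H)" "v \<in> carrier (K_space H)" and i: "i \<in> I" for u v i
  proof -
    obtain x y where xy: "x \<in> Z" "u = cls x" "y \<in> Z" "v = cls y" using uv unfolding K_space_simps carrier_H by auto
    show ?thesis
      unfolding K_space_simps xy(2,4) cls_add[OF xy(1,3)] \<theta>[OF xy(1) i] \<theta>[OF xy(3) i] \<theta>[OF Z_add[OF xy(1,3)] i]
      by (rule add[OF xy(1,3) i])
  qed
  have 2: "\<theta> (r \<odot>\<^bsub>K_space H\<^esub> v) i = r * \<theta> v i" if v: "v \<in> carrier (K_space H)" and i: "i \<in> I" for r v i
  proof -
    obtain x where x: "x \<in> Z" "v = cls x" using v unfolding K_space_simps carrier_H by auto
    show ?thesis
      unfolding K_space_simps x(2) cls_smult[OF c x(1)] \<theta>[OF x(1) i] \<theta>[OF Z_scl[OF c x(1)] i]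
      by (rule smult[OF x(1) i])
  qed
  have 3: "v = \<zero>\<^bsub>K_space H\<^esub>" if v: "v \<in> carrier (K_space H)" and z: "\<And>i. i \<in> I \<Longrightarrow> \<theta> v i = 0" for v
  proof -
    obtain x where x: "x \<in> Z" "v = cls x" using v unfolding K_space_simps carrier_H by auto
    have "\<forall>i\<in>I. \<Phi> x i = 0" using z \<theta>[OF x(1)] x(2) by simp
    then show ?thesis unfolding K_space_simps x(2) using cls_zero_iff[OF x(1)] ker[OF x(1)] by simp
  qed
  have 4: "\<exists>v\<in>carrier (K_space H). \<forall>i\<in>I. \<theta> v i = t i" for t
  proof -
    obtain x where x: "x \<in> Z" "\<forall>i\<in>I. \<Phi> x i = t i" using surj by blast
    then have "cls x \<in> carrier (K_space H)" unfolding K_space_simps carrier_H by auto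
    moreover have "\<forall>i\<in>I. \<theta> (cls x) i = t i" using \<theta>[OF x(1)] x(2) by simp
    ultimately show ?thesis by blast
  qed
  show "K_fin_dim (K_space H)" "K_dim (K_space H) = card I"
    by (rule dim_by_coordinates[OF V fin 1 2 3 4]; assumption)+
  show "hcomp H j = carrier H"
  proof
    show "hcomp H j \<subseteq> carrier H" by (rule hcomp_H_sub)
    show "carrier H \<subseteq> hcomp H j"
    proof
      fix t assume "t \<in> carrier H"
      then obtain x where x: "x \<in> Z" "t = cls x" unfolding carrier_H by auto
      obtain y where y: "y \<in> Z" "y \<in> hcomp (F (Suc k)) j" "\<forall>i\<in>I. \<Phi> y i = \<Phi> x i" using surj[of "\<Phi> x"] by blast
      have "t = cls y" unfolding x(2) using cls_eq[OF x(1) y(1)] y(3) by simp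
      then show "t \<in> hcomp H j" using hcomp_H[OF y(1,2)] by simp
    qed
  qed
qed

end

section \<open>Gradings\<close>

abbreviation hR :: "'p set \<Rightarrow> int \<Rightarrow> ('p, 'k::field) mpoly set" where
  "hR P j \<equiv> hcomp (mpoly_ring P) j"

lemma tdeg_superset: "finite A \<Longrightarrow> supp n \<subseteq> A \<Longrightarrow> tdeg n = (\<Sum>v\<in>A. coef n v)"
  unfolding tdeg_def by (rule sum.mono_neutral_left) (auto simp: in_keys_iff)

lemma tdeg_add: "tdeg (m + n) = tdeg m + tdeg n"
  using tdeg_superset[of "supp m \<union> supp n" m] tdeg_superset[of "supp m \<union> supp n" n]
    tdeg_superset[of "supp m \<union> supp n" "m + n"]
  by (simp add: lookup_add sum.distrib supp_add_exp)

lemma hR_iff: "f \<in> hR P j \<longleftrightarrow> f \<in> polys P \<and> (\<forall>m. coef f m \<noteq> 0 \<longrightarrow> int (tdeg m) = j)"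
  by (auto simp: hcomp_mpoly_ring in_keys_iff)

lemma hR_zero: "0 \<in> hR P j"
  by (simp add: hR_iff)

lemma hR_add: "f \<in> hR P j \<Longrightarrow> g \<in> hR P j \<Longrightarrow> f + g \<in> hR P j"
  unfolding hR_iff lookup_add by (metis add.right_neutral polys_add)

lemma hR_sum: "(\<And>x. x \<in> A \<Longrightarrow> f x \<in> hR P j) \<Longrightarrow> sum f A \<in> hR P j"
  by (induction A rule: infinite_finite_induct) (auto simp: hR_zero hR_add)

lemma hR_mult:
  assumes "f \<in> hR P i" "g \<in> hR P j" shows "f * g \<in> hR P (i + j)"
  unfolding hcomp_mpoly_ring
proof (intro CollectI conjI ballI)
  show "f * g \<in> polys P" using assms by (simp add: hR_iff)
  fix m assume "m \<in> supp (f * g)"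
  then obtain u v where "m = u + v" "u \<in> supp f" "v \<in> supp g" using keys_mult[of f g] by blast
  then show "int (tdeg m) = i + j" using assms by (simp add: hcomp_mpoly_ring tdeg_add)
qed

lemma hR_monom: "supp m \<subseteq> P \<Longrightarrow> int (tdeg m) = j \<Longrightarrow> monom_mp m c \<in> hR P j"
  by (simp add: hcomp_mpoly_ring polys_monom)

lemma tdeg_unit_exp: "tdeg (unit_exp v) = 1"
  by (simp add: tdeg_def)

definition homogeneous_part :: "int \<Rightarrow> ('p, 'k::field) mpoly \<Rightarrow> ('p, 'k) mpoly" where
  "homogeneous_part j f = Poly_Mapping.mapp (\<lambda>m c. if int (tdeg m) = j then c else 0) f"

lemma coef_homogeneous_part: "coef (homogeneous_part j f) m = (if int (tdeg m) = j then coef f m else 0)"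
  by (simp add: homogeneous_part_def lookup_mapp when_def in_keys_iff)

lemma homogeneous_part_zero [simp]: "homogeneous_part j 0 = 0"
  by (rule poly_mapping_eqI) (simp add: coef_homogeneous_part)

text \<open>The component of degree \<open>j\<close> in the free module whose basis element \<open>b\<close> has degree \<open>a b\<close>.\<close>

definition proj :: "('b \<Rightarrow> int) \<Rightarrow> int \<Rightarrow> ('b \<Rightarrow> ('p, 'k::field) mpoly) \<Rightarrow> 'b \<Rightarrow> ('p, 'k) mpoly" where
  "proj a j x = (\<lambda>b. homogeneous_part (j - a b) (x b))"

abbreviation hF where "hF P B a j \<equiv> hcomp (free_gmodule (mpoly_ring P) B a) j"

lemma hF_iff: "x \<in> hF P B a j \<longleftrightarrow> x \<in> free_mod P B \<and> (\<forall>b. x b \<in> hR P (j - a b))"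
  unfolding hcomp_free_gmodule by (auto simp: hR_zero) (metis free_modD(3) hR_zero)

lemma hF_coef: "x \<in> hF P B a j \<Longrightarrow> coef (x b) m \<noteq> 0 \<Longrightarrow> int (tdeg m) = j - a b"
  by (simp add: hF_iff hR_iff)

lemma hF_free: "x \<in> hF P B a j \<Longrightarrow> x \<in> free_mod P B"
  by (simp add: hF_iff)

lemma hF_sum: "(\<And>x. x \<in> A \<Longrightarrow> f x \<in> hF P B a j) \<Longrightarrow> sum f A \<in> hF P B a j"
  unfolding hF_iff by (auto simp: sum_fun_eval intro!: free_mod_sum hR_sum)

lemma hF_scl: "r \<in> hR P i \<Longrightarrow> x \<in> hF P B a j \<Longrightarrow> scl r x \<in> hF P B a (i + j)"
proof -
  assume r: "r \<in> hR P i" and x: "x \<in> hF P B a j"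
  have "scl r x b \<in> hR P (i + j - a b)" for b
    using hR_mult[OF r, of "x b" "j - a b"] x by (simp add: hF_iff add_diff_eq)
  moreover have "scl r x \<in> free_mod P B"
    by (rule free_mod_scl) (use r x in \<open>simp_all add: hR_iff hF_iff\<close>)
  ultimately show ?thesis by (simp add: hF_iff)
qed

lemma lin_hF:
  assumes h: "lin P B C h" and u: "\<And>b. b \<in> B \<Longrightarrow> h (unitv b) \<in> hF P C a j"
    and x: "x \<in> free_mod P B" "\<And>b. x b \<in> hR P i"
  shows "h x \<in> hF P C a (i + j)"
  unfolding lin_expand[OF h x(1)]
proof (intro hF_sum hF_scl x u)
  fix b assume "b \<in> {b. x b \<noteq> 0}"
  then show "b \<in> B" using free_modD(3)[OF x(1)] by blast
qed

lemma proj_hF: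
  assumes "x \<in> free_mod P B" shows "proj a j x \<in> hF P B a j"
proof -
  have p: "homogeneous_part i (x b) \<in> polys P" for i b
    using free_modD(1)[OF assms, of b] by (auto simp: polys_iff coef_homogeneous_part split: if_splits)
  have "finite {b. proj a j x b \<noteq> 0}"
    by (rule finite_subset[OF _ free_modD(2)[OF assms]]) (auto simp: proj_def)
  then have "proj a j x \<in> free_mod P B"
    using p free_modD(3)[OF assms] by (simp add: free_mod_def proj_def)
  then show ?thesis unfolding hF_iff using p by (auto simp: proj_def hR_iff coef_homogeneous_part split: if_splits)
qed

lemma proj_add: "proj a j (x + y) = proj a j x + proj a j y"
  by (intro ext poly_mapping_eqI) (simp add: proj_def coef_homogeneous_part lookup_add)

lemma proj_zero: "proj a j 0 = 0"
  by (intro ext poly_mapping_eqI) (simp add: proj_def coef_homogeneous_part)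

lemma proj_sum: "proj a j (sum f A) = (\<Sum>x\<in>A. proj a j (f x))"
  by (induction A rule: infinite_finite_induct) (simp_all only: sum.infinite sum.empty sum.insert proj_zero proj_add not_False_eq_True)

lemma proj_hF_other: "x \<in> hF P B a i \<Longrightarrow> proj a j x = (if i = j then x else 0)"
  using hF_coef[of x P B a i] by (intro ext poly_mapping_eqI) (auto simp: proj_def coef_homogeneous_part)

lemma hcomp_decomposition:
  assumes x: "x \<in> free_mod P B"
  obtains Js where "finite Js" "x = (\<Sum>j\<in>Js. proj a j x)" "\<forall>j. j \<notin> Js \<longrightarrow> proj a j x = 0"
proof -
  define Js where "Js = (\<Union>b\<in>{b. x b \<noteq> 0}. (\<lambda>m. int (tdeg m) + a b) ` supp (x b))"
  have fin: "finite Js" using free_modD(2)[OF x] by (simp add: Js_def)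
  have mem: "int (tdeg m) + a b \<in> Js" if "coef (x b) m \<noteq> 0" for b m
    unfolding Js_def
  proof (rule UN_I[of b])
    show "b \<in> {b. x b \<noteq> 0}" using that by auto
    show "int (tdeg m) + a b \<in> (\<lambda>m. int (tdeg m) + a b) ` supp (x b)"
      by (rule image_eqI[of _ _ m]) (use that in \<open>simp_all add: in_keys_iff\<close>)
  qed
  have "coef ((\<Sum>j\<in>Js. proj a j x) b) m = coef (x b) m" for b m
  proof -
    have "coef ((\<Sum>j\<in>Js. proj a j x) b) m = (\<Sum>j\<in>Js. if j = int (tdeg m) + a b then coef (x b) m else 0)"
      unfolding sum_fun_eval lookup_sum proj_def coef_homogeneous_part by (rule sum.cong) auto
    also have "\<dots> = coef (x b) m" 
      using fin mem[of b m] by (cases "coef (x b) m = 0") (simp_all add: sum.delta)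
    finally show ?thesis .
  qed
  then have dec: "x = (\<Sum>j\<in>Js. proj a j x)" by (intro ext poly_mapping_eqI) (simp only:)
  have zero: "proj a j x = 0" if nj: "j \<notin> Js" for j
  proof -
    have "coef (proj a j x b) m = 0" for b m
      using mem[of b m] nj by (cases "coef (x b) m = 0") (auto simp: proj_def coef_homogeneous_part)
    then show ?thesis by (intro ext poly_mapping_eqI) simp
  qed
  show thesis by (rule that[OF fin dec]) (simp add: zero)
qed

text \<open>Preimages of homogeneous vectors under graded maps can be taken homogeneous.\<close>

lemma graded_lift:
  assumes h: "lin P B C h" and gr: "\<And>j. h ` hF P B a j \<subseteq> hF P C c j"
    and x: "x \<in> free_mod P B" and y: "h x \<in> hF P C c j"
  shows "h (proj a j x) = h x"
proof -
  obtain Js where Js: "finite Js" "x = (\<Sum>i\<in>Js. proj a i x)" "\<forall>i. i \<notin> Js \<longrightarrow> proj a i x = 0"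
    by (rule hcomp_decomposition[OF x, of a], rule that)
  have hp: "h (proj a i x) \<in> hF P C c i" for i
    by (rule subsetD[OF gr imageI[OF proj_hF[OF x]]])
  have "h x = h (\<Sum>i\<in>Js. proj a i x)" by (rule arg_cong[OF Js(2)])
  also have "\<dots> = (\<Sum>i\<in>Js. h (proj a i x))"
    by (rule lin_sum[OF h]) (rule hF_free[OF proj_hF[OF x]])
  finally have eq: "h x = (\<Sum>i\<in>Js. h (proj a i x))" .
  have "h x = proj c j (h x)" by (simp only: proj_hF_other[OF y] refl if_True)
  also have "\<dots> = proj c j (\<Sum>i\<in>Js. h (proj a i x))" by (rule arg_cong[OF eq])
  also have "\<dots> = (\<Sum>i\<in>Js. proj c j (h (proj a i x)))" by (rule proj_sum)
  also have "\<dots> = (\<Sum>i\<in>Js. if i = j then h (proj a j x) else 0)"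
    by (rule sum.cong[OF refl]) (simp add: proj_hF_other[OF hp, of j])
  also have "\<dots> = h (proj a j x)"
  proof (cases "j \<in> Js")
    case True
    then show ?thesis using Js(1) by (simp only: sum.delta if_True)
  next
    case False
    then show ?thesis using Js(1) Js(3)[rule_format, OF False] lin_zero[OF h] by (simp only: sum.delta if_False)
  qed
  finally show ?thesis by simp
qed

section \<open>The Koszul resolution\<close>

lemma coef_mult_zero: "coef (r * f) 0 = coef r 0 * coef (f :: ('p, 'k::field) mpoly) 0"
proof -
  have "coef (r * f) 0 = coef ((\<Sum>m\<in>supp r. monom_mp m (coef r m)) * f) 0"
    by (simp only: sum_monoms)
  also have "\<dots> = (\<Sum>m\<in>supp r. coef (monom_mp m (coef r m) * f) 0)"
    by (simp only: sum_distrib_right lookup_sum)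
  also have "\<dots> = (\<Sum>m\<in>supp r. if m = 0 then coef r 0 * coef f 0 else 0)"
  proof (rule sum.cong[OF refl])
    fix m assume "m \<in> supp r"
    show "coef (monom_mp m (coef r m) * f) 0 = (if m = 0 then coef r 0 * coef f 0 else 0)"
    proof (cases "m = 0")
      case False
      have "0 \<noteq> m + k" for k
      proof
        assume "0 = m + k"
        then have "supp m = {}" using supp_add_exp[of m k] by simp
        then show False using False by simp
      qed
      then show ?thesis using False by (simp add: coef_monom_mult_other)
    qed (simp add: coef_const_mult)
  qed
  also have "\<dots> = coef r 0 * coef f 0" by (simp add: sum.delta in_keys_iff)
  finally show ?thesis .
qed

context koszul_sign begin

definition ksets :: "nat \<Rightarrow> 'p set set" where "ksets i = {S. S \<subseteq> P \<and> card S = i}"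

lemma finite_ksets: "finite (ksets i)"
  using finite_P by (simp add: ksets_def)

lemma kchains_free: "kchains i = free_mod P (ksets i)"
proof -
  have "finite {S. z S \<noteq> 0}" if "\<forall>S. S \<notin> ksets i \<longrightarrow> z S = 0" for z :: "'p set \<Rightarrow> ('p, 'k) mpoly"
    by (rule finite_subset[OF _ finite_ksets[of i]]) (use that in auto)
  then show ?thesis unfolding kchains_def free_mod_def by (auto simp: ksets_def)
qed

lemma lin_kbd: "lin P (ksets (Suc i)) (ksets i) kbd"
  unfolding lin_def kchains_free[symmetric]
proof (intro conjI ballI)
  show "kbd z \<in> kchains i" if "z \<in> kchains (Suc i)" for z by (rule kbd_kchains[OF that])
  show "kbd (x + y) = kbd x + kbd y" for x y
    by (rule ext) (simp add: kbd_def distrib_left sum.distrib)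
  show "kbd (scl r x) = scl r (kbd x)" for r x
    by (rule ext) (simp add: kbd_def sum_distrib_left mult.left_commute)
qed

abbreviation kaug :: "('p set \<Rightarrow> ('p, 'k) mpoly) \<Rightarrow> 'k" where "kaug z \<equiv> coef (z {}) 0"

text \<open>Exactness is the contraction of all multidegrees other than zero.\<close>

lemma koszul_resolution: "resolution P ksets (\<lambda>i. kbd) kaug"
proof
  show "lin P (ksets (Suc i)) (ksets i) kbd" for i by (rule lin_kbd)
  show "aug_cycle (\<lambda>i. kbd) kaug i x \<longleftrightarrow> (\<exists>y\<in>free_mod P (ksets (Suc i)). x = kbd y)"
    if x: "x \<in> free_mod P (ksets i)" for x i
  proof (cases i)
    case 0
    have "kaug (kbd y) = 0" for y
      unfolding kbd_def lookup_sum coef_var_mult by simp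
    then show ?thesis using koszul_exact_0[of x] x by (auto simp: 0 kchains_free)
  next
    case (Suc k)
    have "kbd x = 0 \<longleftrightarrow> (\<exists>y\<in>free_mod P (ksets (Suc i)). x = kbd y)"
      using koszul_exact[of x k] kbd_kbd[of _ k] x by (auto simp: Suc kchains_free)
    then show ?thesis by (simp add: Suc zero_fun_def)
  qed
  show "kaug (scl r x) = coef r 0 * kaug x" for r x by (simp add: coef_mult_zero)
  show "\<exists>x\<in>free_mod P (ksets 0). kaug x = 1"
  proof (rule bexI[of _ "unitv {}"])
    show "kaug (unitv {}) = 1" by (simp add: unitv_def)
    show "(unitv {} :: 'p set \<Rightarrow> ('p, 'k) mpoly) \<in> free_mod P (ksets 0)" by (rule free_mod_unitv) (simp add: ksets_def)
  qed
qed (simp add: lookup_add)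

lemma kbd_graded:
  assumes "\<And>S. z S \<in> hR P (j - 1)" shows "kbd z S \<in> hR P j"
proof -
  have "monom_mp (unit_exp v) (\<epsilon> v S) * z (insert v S) \<in> hR P (1 + (j - 1))" if "v \<in> P" for v
    by (rule hR_mult[OF hR_monom assms]) (use that in \<open>simp_all add: tdeg_unit_exp[simplified]\<close>)
  then show ?thesis unfolding kbd_def by (intro hR_sum) simp
qed

end

lemma residue_field_simps [simp]:
  "carrier residue_field = UNIV" "x \<oplus>\<^bsub>residue_field\<^esub> y = x + y" "\<zero>\<^bsub>residue_field\<^esub> = 0"
  "r \<odot>\<^bsub>residue_field\<^esub> x = coef r 0 * x" "hcomp residue_field j = (if j = 0 then UNIV else {0})"
  by (simp_all add: residue_field_def)

text \<open>The Koszul complex again, with subsets of \<open>P\<close> encoded by natural numbers. Without this witness, the resolution selected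
in the definition of \<open>Tor\<close> would be arbitrary.\<close>

lemma (in koszul_sign) free_resolution_exists:
  "\<exists>F d. free_resolution (mpoly_ring P :: (('p, 'k) mpoly, ('p, 'k) mpoly) gmodule) residue_field F d"
proof -
  let ?R = "mpoly_ring P :: (('p, 'k) mpoly, ('p, 'k) mpoly) gmodule"
  obtain code :: "'p set \<Rightarrow> nat" where inj: "inj_on code (Pow P)"
    using finite_imp_inj_to_nat_seg[of "Pow P"] finite_P by blast
  define B where "B i = code ` ksets i" for i
  define F where "F i = free_gmodule ?R (B i) (\<lambda>_. int i)" for i
  define dec :: "(nat \<Rightarrow> ('p, 'k) mpoly) \<Rightarrow> 'p set \<Rightarrow> ('p, 'k) mpoly"
    where "dec x = (\<lambda>S. if S \<subseteq> P then x (code S) else 0)" for x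
  define enc :: "('p set \<Rightarrow> ('p, 'k) mpoly) \<Rightarrow> nat \<Rightarrow> ('p, 'k) mpoly"
    where "enc z = (\<lambda>n. if n \<in> code ` Pow P then z (inv_into (Pow P) code n) else 0)" for z
  have code_in: "code S \<in> B i \<longleftrightarrow> S \<in> ksets i" if "S \<subseteq> P" for S i
    using that inj unfolding B_def ksets_def by (auto dest: inj_onD)
  have Bsub: "B i \<subseteq> code ` Pow P" for i by (auto simp: B_def ksets_def)
  have finB: "finite (B i)" for i by (simp add: B_def finite_ksets)
  have dec_in: "dec x \<in> free_mod P (ksets i)" if x: "x \<in> free_mod P (B i)" for x i
  proof -
    have "dec x S = 0" if "S \<notin> ksets i" for S
      using that code_in[of S i] free_modD(3)[OF x] by (auto simp: dec_def)
    then have "finite {S. dec x S \<noteq> 0}" by (intro finite_subset[OF _ finite_ksets[of i]]) auto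
    then show ?thesis
      using \<open>\<And>S. S \<notin> ksets i \<Longrightarrow> dec x S = 0\<close> free_modD(1)[OF x] by (simp add: free_mod_def dec_def)
  qed
  have enc_code: "enc z (code S) = z S" if "S \<subseteq> P" for z S
    using that inj by (simp add: enc_def)
  have enc_in: "enc z \<in> free_mod P (B i)" if z: "z \<in> free_mod P (ksets i)" for z i
  proof -
    have nz: "enc z n = 0" if "n \<notin> B i" for n
    proof (cases "n \<in> code ` Pow P")
      case True
      then obtain S where S: "S \<subseteq> P" "n = code S" by blast
      then have "S \<notin> ksets i" using that code_in by simp
      then show ?thesis using free_modD(3)[OF z] enc_code S by simp
    qed (simp add: enc_def)
    then have "finite {n. enc z n \<noteq> 0}" by (intro finite_subset[OF _ finB[of i]]) auto
    then show ?thesis using nz free_modD(1)[OF z] by (simp add: free_mod_def enc_def)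
  qed
  have dec_enc: "dec (enc z) = z" if z: "z \<in> free_mod P (ksets i)" for z i
  proof (rule ext)
    fix S show "dec (enc z) S = z S"
      using free_modD(3)[OF z, of S] by (auto simp: dec_def enc_code ksets_def)
  qed
  have enc_dec: "enc (dec x) = x" if x: "x \<in> free_mod P (B i)" for x i
  proof (rule ext)
    fix n show "enc (dec x) n = x n"
    proof (cases "n \<in> code ` Pow P")
      case True
      then obtain S where S: "S \<subseteq> P" "n = code S" by blast
      then show ?thesis by (simp add: enc_code dec_def)
    next
      case False
      then show ?thesis using free_modD(3)[OF x, of n] Bsub by (auto simp: enc_def)
    qed
  qed
  have dec_add: "dec (x + y) = dec x + dec y" for x y by (rule ext) (simp add: dec_def)
  have dec_scl: "dec (scl r x) = scl r (dec x)" for r x by (rule ext) (simp add: dec_def)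
  have enc_add: "enc (x + y) = enc x + enc y" for x y by (rule ext) (simp add: enc_def)
  have enc_scl: "enc (scl r x) = scl r (enc x)" for r x by (rule ext) (simp add: enc_def)
  have enc_zero: "enc 0 = 0" by (rule ext) (simp add: enc_def)
  have dec_zero: "dec 0 = 0" by (rule ext) (simp add: dec_def)
  interpret K: resolution P ksets "\<lambda>i. kbd" kaug by (rule koszul_resolution)
  define d where "d x = enc (kbd (dec x))" for x
  have kin: "kbd (dec x) \<in> free_mod P (ksets i)" if "x \<in> free_mod P (B (Suc i))" for x i
    by (rule lin_closed[OF lin_kbd dec_in[OF that]])
  have d_zero_iff: "d x = 0 \<longleftrightarrow> kbd (dec x) = 0" if x: "x \<in> free_mod P (B (Suc i))" for x i
  proof
    assume h: "d x = 0"
    have "kbd (dec x) = dec (d x)" unfolding d_def using dec_enc[OF kin[OF x]] by simp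
    then show "kbd (dec x) = 0" by (simp only: h dec_zero)
  qed (simp only: d_def enc_zero)
  have im_iff: "x \<in> d ` free_mod P (B (Suc i)) \<longleftrightarrow> (\<exists>w\<in>free_mod P (ksets (Suc i)). dec x = kbd w)"
    if x: "x \<in> free_mod P (B i)" for x i
  proof
    assume "x \<in> d ` free_mod P (B (Suc i))"
    then obtain y where y: "y \<in> free_mod P (B (Suc i))" "x = d y" by blast
    then have "dec x = kbd (dec y)" unfolding d_def using dec_enc[OF kin[OF y(1)]] by simp
    then show "\<exists>w\<in>free_mod P (ksets (Suc i)). dec x = kbd w" using dec_in[OF y(1)] by blast
  next
    assume "\<exists>w\<in>free_mod P (ksets (Suc i)). dec x = kbd w"
    then obtain w where w: "w \<in> free_mod P (ksets (Suc i))" "dec x = kbd w" by blast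
    have "x = d (enc w)" unfolding d_def dec_enc[OF w(1)] w(2)[symmetric] by (rule enc_dec[OF x, symmetric])
    then show "x \<in> d ` free_mod P (B (Suc i))" using enc_in[OF w(1)] by blast
  qed
  have "free_resolution ?R residue_field F (\<lambda>_. d)"
    unfolding free_resolution_def
  proof (intro conjI allI)
    show "\<exists>B a. F i = free_gmodule ?R B a" for i unfolding F_def by blast
    show "d \<in> ghom ?R (F (Suc i)) (F i)" for i
      unfolding ghom_def LinearCombinations.module_hom_def
    proof (intro CollectI conjI allI impI funcsetI)
      fix x assume "x \<in> carrier (F (Suc i))"
      then have x: "x \<in> free_mod P (B (Suc i))" by (simp add: F_def)
      show "d x \<in> carrier (F i)" unfolding d_def using enc_in[OF kin[OF x]] by (simp add: F_def)
    next
      fix x y assume "x \<in> carrier (F (Suc i)) \<and> y \<in> carrier (F (Suc i))"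
      then have xy: "x \<in> free_mod P (B (Suc i))" "y \<in> free_mod P (B (Suc i))" by (simp_all add: F_def)
      show "d (x \<oplus>\<^bsub>F (Suc i)\<^esub> y) = d x \<oplus>\<^bsub>F i\<^esub> d y"
        unfolding F_def free_gmodule_simps d_def dec_add lin_add[OF lin_kbd dec_in[OF xy(1)] dec_in[OF xy(2)]] enc_add ..
    next
      fix r x assume "r \<in> carrier ?R \<and> x \<in> carrier (F (Suc i))"
      then have rx: "r \<in> polys P" "x \<in> free_mod P (B (Suc i))" by (simp_all add: F_def)
      show "d (r \<odot>\<^bsub>F (Suc i)\<^esub> x) = r \<odot>\<^bsub>F i\<^esub> d x"
        unfolding F_def free_gmodule_simps d_def dec_scl lin_scl[OF lin_kbd rx(1) dec_in[OF rx(2)]] enc_scl ..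
    next
      fix j
      show "d ` hcomp (F (Suc i)) j \<subseteq> hcomp (F i) j"
      proof
        fix y assume "y \<in> d ` hcomp (F (Suc i)) j"
        then obtain x where x: "x \<in> hF P (B (Suc i)) (\<lambda>_. int (Suc i)) j" "y = d x" by (auto simp: F_def)
        have "dec x S \<in> hR P (j - int i - 1)" for S
          using x(1) by (auto simp: hF_iff dec_def hR_zero algebra_simps)
        then have "kbd (dec x) S \<in> hR P (j - int i)" for S by (rule kbd_graded)
        then have "y \<in> hF P (B i) (\<lambda>_. int i) j"
          unfolding hF_iff x(2) d_def using enc_in[OF kin[OF hF_free[OF x(1)]]] by (auto simp: enc_def hR_zero)
        then show "y \<in> hcomp (F i) j" by (simp add: F_def)
      qed
    qed
    show "cycles F (\<lambda>_. d) (Suc i) = boundaries F (\<lambda>_. d) (Suc i)" for i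
    proof -
      have *: "d x = 0 \<longleftrightarrow> x \<in> d ` free_mod P (B (Suc (Suc i)))" if x: "x \<in> free_mod P (B (Suc i))" for x
        unfolding d_zero_iff[OF x] im_iff[OF x] using K.exact[OF dec_in[OF x]] by (simp add: zero_fun_def)
      have "d ` free_mod P (B (Suc (Suc i))) \<subseteq> free_mod P (B (Suc i))"
        unfolding d_def using enc_in[OF kin] by auto
      then show ?thesis unfolding boundaries_def cycles.simps F_def free_gmodule_simps using * by blast
    qed
    show "\<exists>\<eta>\<in>ghom ?R (F 0) residue_field. \<eta> ` carrier (F 0) = carrier residue_field \<and>
        {x \<in> carrier (F 0). \<eta> x = \<zero>\<^bsub>residue_field\<^esub>} = boundaries F (\<lambda>_. d) 0"
    proof (intro bexI[of _ "\<lambda>x. kaug (dec x)"] conjI)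
      show "(\<lambda>x. kaug (dec x)) \<in> ghom ?R (F 0) residue_field"
        unfolding ghom_def LinearCombinations.module_hom_def
      proof (intro CollectI conjI allI impI funcsetI)
        fix j
        show "(\<lambda>x. kaug (dec x)) ` hcomp (F 0) j \<subseteq> hcomp residue_field j"
        proof
          fix c assume "c \<in> (\<lambda>x. kaug (dec x)) ` hcomp (F 0) j"
          then obtain x where x: "x \<in> hF P (B 0) (\<lambda>_. 0) j" "c = kaug (dec x)" by (auto simp: F_def)
          then show "c \<in> hcomp residue_field j"
            using hF_coef[OF x(1), of "code {}" 0] by (auto simp: dec_def tdeg_def)
        qed
      qed (simp_all add: F_def dec_add dec_scl lookup_add coef_mult_zero)
      show "(\<lambda>x. kaug (dec x)) ` carrier (F 0) = carrier residue_field"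
      proof -
        have "c \<in> (\<lambda>x. kaug (dec x)) ` free_mod P (B 0)" for c
        proof -
          obtain z where z: "z \<in> free_mod P (ksets 0)" "kaug z = c" using K.aug_onto by blast
          show ?thesis using enc_in[OF z(1)] dec_enc[OF z(1)] z(2) by (intro image_eqI[of _ _ "enc z"]) auto
        qed
        then show ?thesis by (auto simp: F_def)
      qed
      have *: "kaug (dec x) = 0 \<longleftrightarrow> x \<in> d ` free_mod P (B (Suc 0))" if x: "x \<in> free_mod P (B 0)" for x
        unfolding im_iff[OF x] using K.exact[OF dec_in[OF x]] by simp
      have "d ` free_mod P (B (Suc 0)) \<subseteq> free_mod P (B 0)"
        unfolding d_def using enc_in[OF kin] by auto
      then show "{x \<in> carrier (F 0). kaug (dec x) = \<zero>\<^bsub>residue_field\<^esub>} = boundaries F (\<lambda>_. d) 0"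
        unfolding boundaries_def F_def free_gmodule_simps residue_field_simps using * by blast
    qed
  qed
  then show ?thesis by blast
qed

text \<open>Translates a graded free resolution given by records. The augmentation kills all nonzero degrees since the
residue field is concentrated in degree zero.\<close>

lemma free_resolution_resolution:
  assumes "free_resolution (mpoly_ring P :: (('p, 'k::field) mpoly, ('p, 'k) mpoly) gmodule) residue_field F d"
  obtains B a \<eta> where "\<And>i. F i = free_gmodule (mpoly_ring P) (B i) (a i)" "resolution P B d \<eta>"
    "\<And>i j. d i ` hF P (B (Suc i)) (a (Suc i)) j \<subseteq> hF P (B i) (a i) j"
    "\<And>x j. x \<in> hF P (B 0) (a 0) j \<Longrightarrow> j \<noteq> 0 \<Longrightarrow> \<eta> x = 0"
proof -
  let ?R = "mpoly_ring P :: (('p, 'k::field) mpoly, ('p, 'k) mpoly) gmodule"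
  have "\<forall>i. \<exists>B a. F i = free_gmodule ?R B a" using assms by (simp add: free_resolution_def)
  then have "\<exists>B. \<forall>i. \<exists>a. F i = free_gmodule ?R (B i) a" by (rule choice)
  then obtain B where "\<forall>i. \<exists>a. F i = free_gmodule ?R (B i) a" by blast
  then have "\<exists>a. \<forall>i. F i = free_gmodule ?R (B i) (a i)" by (rule choice)
  then obtain a where F: "\<And>i. F i = free_gmodule ?R (B i) (a i)" by blast
  have dh: "d i \<in> ghom ?R (F (Suc i)) (F i)" for i using assms by (simp add: free_resolution_def)
  have ex: "cycles F d (Suc i) = boundaries F d (Suc i)" for i using assms unfolding free_resolution_def by blast
  obtain \<eta> where \<eta>: "\<eta> \<in> ghom ?R (F 0) residue_field" "\<eta> ` carrier (F 0) = UNIV"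
    "{x \<in> carrier (F 0). \<eta> x = 0} = boundaries F d 0"
    using assms unfolding free_resolution_def residue_field_simps by blast
  have dl: "lin P (B (Suc i)) (B i) (d i)" for i
    using dh[of i] unfolding ghom_def LinearCombinations.module_hom_def lin_def F by auto
  have res: "resolution P B d \<eta>"
  proof
    show "lin P (B (Suc i)) (B i) (d i)" for i by (rule dl)
    show "aug_cycle d \<eta> i x \<longleftrightarrow> (\<exists>y\<in>free_mod P (B (Suc i)). x = d i y)" if x: "x \<in> free_mod P (B i)" for x i
    proof (cases i)
      case 0
      have "\<eta> x = 0 \<longleftrightarrow> x \<in> d 0 ` free_mod P (B (Suc 0))"
        using \<eta>(3) x unfolding 0 boundaries_def F free_gmodule_simps by auto
      then show ?thesis unfolding 0 aug_cycle.simps by blast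
    next
      case (Suc k)
      have 1: "x \<in> cycles F d (Suc k) \<longleftrightarrow> d k x = 0"
        using x unfolding Suc cycles.simps F free_gmodule_simps by auto
      have 2: "x \<in> boundaries F d (Suc k) \<longleftrightarrow> x \<in> d i ` free_mod P (B (Suc i))"
        unfolding Suc boundaries_def F free_gmodule_simps ..
      have "d k x = 0 \<longleftrightarrow> x \<in> d i ` free_mod P (B (Suc i))"
        unfolding 1[symmetric] 2[symmetric] ex[of k] ..
      then show ?thesis unfolding Suc aug_cycle.simps zero_fun_def by blast
    qed
    show "\<eta> (x + y) = \<eta> x + \<eta> y" if "x \<in> free_mod P (B 0)" "y \<in> free_mod P (B 0)" for x y
      using \<eta>(1) that unfolding ghom_def LinearCombinations.module_hom_def F by auto
    show "\<eta> (scl r x) = coef r 0 * \<eta> x" if "r \<in> polys P" "x \<in> free_mod P (B 0)" for r x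
      using \<eta>(1) that unfolding ghom_def LinearCombinations.module_hom_def F by auto
    have "1 \<in> \<eta> ` free_mod P (B 0)" using \<eta>(2) unfolding F free_gmodule_simps by simp
    then show "\<exists>x\<in>free_mod P (B 0). \<eta> x = 1" by (metis imageE)
  qed
  have gr: "d i ` hF P (B (Suc i)) (a (Suc i)) j \<subseteq> hF P (B i) (a i) j" for i j
    using dh[of i] unfolding ghom_def F mem_Collect_eq by (elim conjE) (erule allE[of _ j])
  have aug: "\<eta> x = 0" if xj: "x \<in> hF P (B 0) (a 0) j" "j \<noteq> 0" for x j
  proof -
    have "\<eta> ` hF P (B 0) (a 0) j \<subseteq> hcomp (residue_field :: (('p, 'k) mpoly, 'k) gmodule) j"
      using \<eta>(1) unfolding ghom_def F mem_Collect_eq by (elim conjE) (erule allE[of _ j])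
    then have "\<eta> x \<in> hcomp (residue_field :: (('p, 'k) mpoly, 'k) gmodule) j" using imageI[OF xj(1)] by (rule subsetD)
    then show ?thesis using xj(2) by simp
  qed
  show ?thesis by (rule that[OF F res gr aug])
qed

section \<open>Tor of the residue field and the Stanley-Reisner ring\<close>

lemma ideal_of_poly_ideal:
  assumes "poly_ideal P J" shows "ideal J (mpoly_ring P)"
proof -
  interpret cring "mpoly_ring P" by (rule cring_mpoly_ring)
  have neg: "\<ominus>\<^bsub>mpoly_ring P\<^esub> y = - y" if "y \<in> polys P" for y
    using minus_equality[of "- y" y] that by simp
  show ?thesis
  proof (rule idealI)
    show "ring (mpoly_ring P)" by (rule ring_axioms)
    show "subgroup J (add_monoid (mpoly_ring P))"
    proof (rule group.subgroupI[OF a_group])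
      show "J \<noteq> {}" using poly_idealD(2)[OF assms] by blast
      show "J \<subseteq> carrier (add_monoid (mpoly_ring P))" using poly_idealD(1)[OF assms] by auto
      show "inv\<^bsub>add_monoid (mpoly_ring P)\<^esub> f \<in> J" if "f \<in> J" for f
        using that neg[OF poly_idealD(1)[OF assms that]] poly_ideal_uminus[OF assms that] by (simp add: a_inv_def)
      show "f \<otimes>\<^bsub>add_monoid (mpoly_ring P)\<^esub> g \<in> J" if "f \<in> J" "g \<in> J" for f g
        using poly_idealD(3)[OF assms that] by simp
    qed
    show "x \<otimes>\<^bsub>mpoly_ring P\<^esub> f \<in> J" if "f \<in> J" "x \<in> carrier (mpoly_ring P)" for f x
      using poly_idealD(4)[OF assms] that by simp
    show "f \<otimes>\<^bsub>mpoly_ring P\<^esub> x \<in> J" if "f \<in> J" "x \<in> carrier (mpoly_ring P)" for f x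
      using poly_idealD(4)[OF assms, of x f] that by (simp add: mult.commute[of f x])
  qed
qed

lemma poly_ideal_of_ideal:
  assumes "ideal J (mpoly_ring P)" shows "poly_ideal P J"
proof -
  interpret ideal J "mpoly_ring P" by (rule assms)
  show ?thesis
    unfolding poly_ideal_def using a_subset additive_subgroup.zero_closed[OF additive_subgroup_axioms]
      additive_subgroup.a_closed[OF additive_subgroup_axioms] I_l_closed by auto
qed

context finite_linear_space begin

lemma nonface_poly_ideal: "poly_ideal P (nonface_ideal P \<Lambda> :: ('p, 'k::field) mpoly set)"
  unfolding poly_ideal_def
proof (intro conjI ballI)
  fix r f :: "('p, 'k) mpoly" assume r: "r \<in> polys P" and f: "f \<in> nonface_ideal P \<Lambda>"
  show "r * f \<in> nonface_ideal P \<Lambda>"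
    unfolding nonface_ideal_def
  proof (intro CollectI conjI ballI)
    show "r * f \<in> polys P" using r f by (simp add: nonface_ideal_def)
    fix n assume "n \<in> supp (r * f)"
    then obtain a b where n: "n = a + b" "b \<in> supp f" using keys_mult[of r f] by blast
    then have "supp b \<notin> \<Lambda>" using f by (simp add: nonface_ideal_def)
    then show "supp n \<notin> \<Lambda>" using face_sub[of "supp n" "supp b"] by (auto simp: n supp_add_exp)
  qed
qed (auto simp: nonface_ideal_polys nonface_ideal_add)

text \<open>A monomial outside \<open>\<Lambda>\<close> is a multiple of the squarefree monomial with the same support.\<close>

lemma stanley_reisner_ideal_eq:
  "(stanley_reisner_ideal P (incidence_complex L) :: ('p, 'k::field) mpoly set) = nonface_ideal P \<Lambda>"
proof -
  let ?R = "mpoly_ring P :: (('p, 'k) mpoly, ('p, 'k) mpoly) gmodule"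
  let ?G = "sqfree_monomial ` {S. S \<subseteq> P \<and> S \<notin> \<Lambda>} :: ('p, 'k) mpoly set"
  interpret R: cring ?R by (rule cring_mpoly_ring)
  have sm: "sqfree_monomial S = monom_mp (sqfree_exp S) (1 :: 'k)" for S :: "'p set"
    by (simp add: sqfree_monomial_def sqfree_exp_def)
  have fin: "finite S" if "S \<subseteq> P" for S using that finite_points finite_subset by blast
  have Gn: "?G \<subseteq> nonface_ideal P \<Lambda>"
    by (auto simp: sm nonface_ideal_def fin intro!: polys_monom)
  have GR: "?G \<subseteq> carrier ?R" using Gn nonface_ideal_polys by auto
  have "genideal ?R ?G = nonface_ideal P \<Lambda>"
  proof
    show "genideal ?R ?G \<subseteq> nonface_ideal P \<Lambda>"
      by (rule R.genideal_minimal[OF ideal_of_poly_ideal[OF nonface_poly_ideal] Gn])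
    show "nonface_ideal P \<Lambda> \<subseteq> genideal ?R ?G"
    proof
      fix f :: "('p, 'k) mpoly" assume f: "f \<in> nonface_ideal P \<Lambda>"
      have gen: "poly_ideal P (genideal ?R ?G)"
        by (rule poly_ideal_of_ideal[OF R.genideal_ideal[OF GR]])
      have "monom_mp m (coef f m) \<in> genideal ?R ?G" if m: "m \<in> supp f" for m
      proof -
        have S: "supp m \<subseteq> P" "supp m \<notin> \<Lambda>" using f m by (auto simp: nonface_ideal_def polys_def)
        then have "sqfree_monomial (supp m) \<in> ?G" by (intro imageI) simp
        then have "sqfree_monomial (supp m) \<in> genideal ?R ?G" by (rule subsetD[OF R.genideal_self[OF GR]])
        moreover have "monom_mp (m - sqfree_exp (supp m)) (coef f m) \<in> polys P"
          by (rule polys_monom) (use S in \<open>auto simp: in_keys_iff lookup_minus\<close>)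
        ultimately have "monom_mp (m - sqfree_exp (supp m)) (coef f m) * sqfree_monomial (supp m) \<in> genideal ?R ?G"
          by (intro poly_idealD(4)[OF gen])
        moreover have "m - sqfree_exp (supp m) + sqfree_exp (supp m) = m"
          by (rule poly_mapping_eqI) (simp add: lookup_add lookup_minus coef_sqfree_exp in_keys_iff)
        ultimately show ?thesis by (simp add: sm mult_single)
      qed
      then have "(\<Sum>m\<in>supp f. monom_mp m (coef f m)) \<in> genideal ?R ?G"
        by (intro poly_ideal_sum[OF gen])
      then show "f \<in> genideal ?R ?G" by (simp only: sum_monoms)
    qed
  qed
  then show ?thesis by (simp add: stanley_reisner_ideal_def \<Lambda>_def)
qed

end

context koszul_linear_space begin

text \<open>The basis element \<open>e\<^sub>S\<close> has degree \<open>card S\<close>. Lifts are chosen homogeneous: at the start by passing to the degree zero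
component of a preimage of one, later by \<open>graded_lift\<close>.\<close>

lemma graded_chain_map_exists:
  assumes res: "resolution P B d \<eta>"
    and gr: "\<And>i j. d i ` hF P (B (Suc i)) (a (Suc i)) j \<subseteq> hF P (B i) (a i) j"
    and aug: "\<And>x j. x \<in> hF P (B 0) (a 0) j \<Longrightarrow> j \<noteq> 0 \<Longrightarrow> \<eta> x = (0 :: 'k)"
  shows "\<exists>g. chain_map P ksets (\<lambda>i. kbd) kaug B d \<eta> g \<and>
    (\<forall>i. \<forall>S\<in>ksets i. g i (unitv S) \<in> hF P (B i) (a i) (int i))"
proof (rule chain_map_exists_with[OF koszul_resolution res])
  interpret F: resolution P B d \<eta> by (rule res)
  fix S assume "S \<in> ksets 0"
  then have S: "S = {}" using finite_sub by (auto simp: ksets_def)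
  obtain y where y: "y \<in> free_mod P (B 0)" "\<eta> y = 1" using F.aug_surj by blast
  obtain Js where Js: "finite Js" "y = (\<Sum>i\<in>Js. proj (a 0) i y)" "\<forall>i. i \<notin> Js \<longrightarrow> proj (a 0) i y = 0"
    by (rule hcomp_decomposition[OF y(1), of "a 0"], rule that)
  have h0: "proj (a 0) i y \<in> hF P (B 0) (a 0) i" for i by (rule proj_hF[OF y(1)])
  have "\<eta> y = \<eta> (\<Sum>i\<in>Js. proj (a 0) i y)" by (rule arg_cong[OF Js(2)])
  also have "\<dots> = (\<Sum>i\<in>Js. \<eta> (proj (a 0) i y))" by (rule F.aug_sum) (rule hF_free[OF h0])
  also have "\<dots> = (\<Sum>i\<in>Js. if i = 0 then \<eta> (proj (a 0) 0 y) else 0)"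
    by (rule sum.cong[OF refl]) (simp add: aug[OF h0])
  also have "\<dots> = \<eta> (proj (a 0) 0 y)"
  proof (cases "0 \<in> Js")
    case True
    then show ?thesis using Js(1) by simp
  next
    case False
    then show ?thesis using Js(1) Js(3)[rule_format, OF False] F.aug_zero by (simp only: sum.delta if_False)
  qed
  finally have "\<eta> (proj (a 0) 0 y) = 1" using y(2) by simp
  moreover have "kaug (unitv S) = 1" by (simp add: S unitv_def)
  ultimately show "\<exists>y\<in>free_mod P (B 0). \<eta> y = kaug (unitv S) \<and> y \<in> hF P (B 0) (a 0) (int 0)"
    using h0[of 0] hF_free[OF h0, of 0] by (intro bexI[of _ "proj (a 0) 0 y"]) simp_all
next
  interpret F: resolution P B d \<eta> by (rule res)
  fix i h S
  assume h: "lin P (ksets i) (B i) h" and hu: "\<forall>S\<in>ksets i. h (unitv S) \<in> hF P (B i) (a i) (int i)"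
    and S: "S \<in> ksets (Suc i)" and cyc: "aug_cycle d \<eta> i (h (kbd (unitv S)))"
  have uS: "unitv S \<in> free_mod P (ksets (Suc i))" by (rule free_mod_unitv[OF S])
  have k: "kbd (unitv S) \<in> free_mod P (ksets i)" by (rule lin_closed[OF lin_kbd uS])
  have "(unitv S :: 'p set \<Rightarrow> ('p, 'k) mpoly) T \<in> hR P (1 - 1)" for T
    by (auto simp: unitv_def hR_iff lookup_one when_def tdeg_def)
  then have "kbd (unitv S) T \<in> hR P 1" for T by (rule kbd_graded)
  then have hom: "h (kbd (unitv S)) \<in> hF P (B i) (a i) (1 + int i)"
    by (intro lin_hF[OF h _ k]) (use hu in blast)
  obtain y where y: "y \<in> free_mod P (B (Suc i))" "h (kbd (unitv S)) = d i y"
    using F.exact[OF lin_closed[OF h k]] cyc by blast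
  have "d i (proj (a (Suc i)) (1 + int i) y) = d i y"
    by (rule graded_lift[OF F.d_lin gr y(1)]) (use hom y(2) in simp)
  then show "\<exists>y\<in>free_mod P (B (Suc i)). h (kbd (unitv S)) = d i y \<and> y \<in> hF P (B (Suc i)) (a (Suc i)) (int (Suc i))"
    using y(2) proj_hF[OF y(1), of "a (Suc i)" "1 + int i"] hF_free[OF proj_hF[OF y(1)]]
    by (intro bexI[of _ "proj (a (Suc i)) (1 + int i) y"]) simp_all
qed

text \<open>The loop values of the image in the Koszul complex are coordinates on \<open>Tor\<^sub>i\<close>. They detect boundaries because the
comparison maps are homotopy inverse. They attain all values on homogeneous elements: basic cycles have
coefficients of degree two, and the comparison map out of the Koszul complex adds \<open>i\<close>.\<close>

theorem tor_of_incidence_complex: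
  fixes i :: nat
  assumes i: "i \<ge> 1"
  defines "T \<equiv> tor_K P (stanley_reisner_ring P (incidence_complex L) :: (('p, 'k) mpoly, ('p, 'k) mpoly set) gmodule) i"
  shows "K_fin_dim (K_space T)" "K_dim (K_space T) = card (cycle_index i)" "hcomp T (int i + 2) = carrier T"
proof -
  let ?R = "mpoly_ring P :: (('p, 'k) mpoly, ('p, 'k) mpoly) gmodule"
  let ?M = "quot_gmodule ?R I\<Lambda>"
  have M: "stanley_reisner_ring P (incidence_complex L) = ?M"
    by (simp add: stanley_reisner_ring_def stanley_reisner_ideal_eq)
  obtain F d where Fd: "(SOME (F, d). free_resolution ?R residue_field F d) = (F, d)"
    by (cases "SOME (F, d). free_resolution ?R residue_field F d")
  have "\<exists>p. case p of (F, d) \<Rightarrow> free_resolution ?R residue_field F d"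
    using free_resolution_exists by auto
  then have "case (SOME (F, d). free_resolution ?R residue_field F d) of (F, d) \<Rightarrow> free_resolution ?R residue_field F d"
    by (rule someI_ex)
  then have fr: "free_resolution ?R residue_field F d" by (simp only: Fd prod.case)
  have T: "T = homology (\<lambda>i. tensor ?R (F i) ?M) (\<lambda>i. tensor_map ?R (F (Suc i)) (F i) ?M (d i)) i"
    unfolding T_def tor_K_def tor_def M Fd Let_def prod.case ..
  obtain B a \<eta> where F: "\<And>i. F i = free_gmodule ?R (B i) (a i)" and res: "resolution P B d \<eta>"
    and gr: "\<And>i j. d i ` hF P (B (Suc i)) (a (Suc i)) j \<subseteq> hF P (B i) (a i) j"
    and aug: "\<And>x j. x \<in> hF P (B 0) (a 0) j \<Longrightarrow> j \<noteq> 0 \<Longrightarrow> \<eta> x = 0"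
    by (rule free_resolution_resolution[OF fr]) blast
  interpret F: resolution P B d \<eta> by (rule res)
  interpret K: resolution P ksets "\<lambda>i. kbd" kaug by (rule koszul_resolution)
  obtain k where k: "i = Suc k" using i by (cases i) auto
  have J: "poly_ideal P I\<Lambda>" by (rule nonface_poly_ideal)
  interpret TC: tensored_complex P I\<Lambda> B a d k
  proof
    show "poly_ideal P I\<Lambda>" by (rule J)
    show "lin P (B (Suc i)) (B i) (d i)" for i by (rule F.d_lin)
    show "d k (d (Suc k) x) = 0" if "x \<in> free_mod P (B (Suc (Suc k)))" for x by (rule F.dd[OF that])
  qed
  have TH: "T = TC.H" unfolding T F k ..
  from chain_map_exists[OF res koszul_resolution]
  obtain f where f: "chain_map P B d \<eta> ksets (\<lambda>i. kbd) kaug f" ..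
  from graded_chain_map_exists[OF res gr aug]
  obtain g where gg: "chain_map P ksets (\<lambda>i. kbd) kaug B d \<eta> g \<and>
    (\<forall>i. \<forall>S\<in>ksets i. g i (unitv S) \<in> hF P (B i) (a i) (int i))" ..
  then have g: "chain_map P ksets (\<lambda>i. kbd) kaug B d \<eta> g"
    and gu: "\<forall>i. \<forall>S\<in>ksets i. g i (unitv S) \<in> hF P (B i) (a i) (int i)" by simp_all
  have f_lin: "lin P (B i) (ksets i) (f i)" for i using f by (simp add: chain_map_def)
  have f_comm: "f i (d i x) = kbd (f (Suc i) x)" if "x \<in> free_mod P (B (Suc i))" for i x
    using f that by (simp add: chain_map_def)
  have g_lin: "lin P (ksets i) (B i) (g i)" for i using g by (simp add: chain_map_def)
  have g_comm: "g i (kbd z) = d i (g (Suc i) z)" if "z \<in> free_mod P (ksets (Suc i))" for i z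
    using g that by (simp add: chain_map_def)
  have cyc_free: "z \<in> cycles_mod i \<Longrightarrow> z \<in> free_mod P (ksets (Suc k))" for z
    by (simp add: cycles_mod_def kchains_free k)
  have f_cyc: "f (Suc k) x \<in> cycles_mod i" if x: "x \<in> TC.Z" for x
  proof -
    have x': "x \<in> free_mod P (B (Suc k))" "\<And>b. d k x b \<in> I\<Lambda>" using x by (auto simp: TC.Z_def)
    have "kbd (f (Suc k) x) S \<in> I\<Lambda>" for S
      unfolding f_comm[OF x'(1), symmetric]
      by (rule lin_preserves_ideal[OF J f_lin lin_closed[OF F.d_lin x'(1)] x'(2)])
    then show ?thesis using lin_closed[OF f_lin x'(1)] by (simp add: cycles_mod_def kchains_free k)
  qed
  have g_Z: "g (Suc k) z \<in> TC.Z" if z: "z \<in> cycles_mod i" for z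
  proof -
    note z' = cyc_free[OF z]
    have "d k (g (Suc k) z) b \<in> I\<Lambda>" for b
      unfolding g_comm[OF z', symmetric]
      by (rule lin_preserves_ideal[OF J g_lin lin_closed[OF lin_kbd z']]) (use z in \<open>simp add: cycles_mod_def\<close>)
    then show ?thesis using lin_closed[OF g_lin z'] by (simp add: TC.Z_def)
  qed
  have coord_cong: "cycle_coord z x = cycle_coord z' x"
    if "z \<in> cycles_mod i" "z' \<in> cycles_mod i" "\<And>S. (z - z' - kbd w) S \<in> I\<Lambda>" "x \<in> cycle_index i" for z z' w x
  proof -
    have "z - z' \<in> kchains i" using free_mod_diff[OF cyc_free cyc_free] that by (simp add: kchains_free k)
    then have "cycle_coord (z - z') x = 0" by (rule boundary_coord_zero[OF _ that(3,4)])
    then show ?thesis using cycle_coord_add[of "z - z'" z' x] by simp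
  qed
  \<comment> \<open>The coordinates of \<open>homology_by_coordinates\<close>.\<close>
  define \<Phi> where "\<Phi> x = cycle_coord (f (Suc k) x)" for x
  have add: "\<Phi> (x + y) j = \<Phi> x j + \<Phi> y j" if "x \<in> TC.Z" "y \<in> TC.Z" for x y j
    unfolding \<Phi>_def lin_add[OF f_lin TC.Z_free[OF that(1)] TC.Z_free[OF that(2)]] by (rule cycle_coord_add)
  have smult: "\<Phi> (scl (monom_mp 0 c) x) j = c * \<Phi> x j" if "x \<in> TC.Z" for c x j
  proof -
    have c: "monom_mp 0 c \<in> polys P" by (rule polys_monom) simp
    show ?thesis
      unfolding \<Phi>_def lin_scl[OF f_lin c TC.Z_free[OF that]] using cycle_coord_scale[of c "f (Suc k) x" j] by (simp add: scl_def)
  qed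
  have surj: "\<exists>x\<in>TC.Z. x \<in> hcomp (TC.F (Suc k)) (int i + 2) \<and> (\<forall>j\<in>cycle_index i. \<Phi> x j = t j)" for t
  proof -
    obtain z where z: "z \<in> cycles_mod i" "\<forall>j\<in>cycle_index i. cycle_coord z j = t j" "\<forall>S. \<forall>n\<in>supp (z S). tdeg n = 2"
      using cycle_coord_surj[OF i, of t] by blast
    note z' = cyc_free[OF z(1)]
    have gz: "g (Suc k) z \<in> TC.Z" by (rule g_Z[OF z(1)])
    have "z S \<in> hR P 2" for S using z(3) free_modD(1)[OF z', of S] by (simp add: hcomp_mpoly_ring)
    then have "g (Suc k) z \<in> hF P (B (Suc k)) (a (Suc k)) (2 + int (Suc k))"
      by (intro lin_hF[OF g_lin gu[rule_format] z'])
    then have hom: "g (Suc k) z \<in> hcomp (TC.F (Suc k)) (int i + 2)" by (simp add: k add.commute)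
    have "kbd z S \<in> I\<Lambda>" for S using z(1) by (simp add: cycles_mod_def)
    from round_trip_homotopy[OF koszul_resolution res g f J z' this]
    obtain w where w: "\<forall>S. (f (Suc k) (g (Suc k) z) - z - kbd w) S \<in> I\<Lambda>" by blast
    have "\<Phi> (g (Suc k) z) j = t j" if j: "j \<in> cycle_index i" for j
      unfolding \<Phi>_def using coord_cong[OF f_cyc[OF gz] z(1) _ j, of w] w z(2) j by simp
    then show ?thesis using gz hom by blast
  qed
  have ker: "(\<forall>j\<in>cycle_index i. \<Phi> x j = 0) \<longleftrightarrow>
      (\<exists>w\<in>free_mod P (B (Suc (Suc k))). \<forall>b. (x - d (Suc k) w) b \<in> I\<Lambda>)" if x: "x \<in> TC.Z" for x
  proof
    note x' = TC.Z_free[OF x]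
    assume "\<forall>j\<in>cycle_index i. \<Phi> x j = 0"
    then obtain w where w: "w \<in> kchains (Suc i)" "\<forall>S. (f (Suc k) x - kbd w) S \<in> I\<Lambda>"
      using cycle_is_boundary[OF i f_cyc[OF x]] by (auto simp: \<Phi>_def)
    then have w': "w \<in> free_mod P (ksets (Suc (Suc k)))" by (simp add: kchains_free k)
    have dx: "d k x b \<in> I\<Lambda>" for b using x by (simp add: TC.Z_def)
    obtain w0 where w0: "w0 \<in> free_mod P (B (Suc (Suc k)))"
      "\<forall>b. (g (Suc k) (f (Suc k) x) - x - d (Suc k) w0) b \<in> I\<Lambda>"
      using round_trip_homotopy[OF res koszul_resolution f g J x' dx] by blast
    have fx: "f (Suc k) x \<in> free_mod P (ksets (Suc k))" by (rule lin_closed[OF f_lin x'])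
    have kw: "kbd w \<in> free_mod P (ksets (Suc k))" by (rule lin_closed[OF lin_kbd w'])
    have gw: "g (Suc (Suc k)) w \<in> free_mod P (B (Suc (Suc k)))" by (rule lin_closed[OF g_lin w'])
    have dif: "g (Suc k) (f (Suc k) x - kbd w) = g (Suc k) (f (Suc k) x) - d (Suc k) (g (Suc (Suc k)) w)"
      unfolding lin_diff[OF g_lin fx kw] g_comm[OF w'] ..
    show "\<exists>w\<in>free_mod P (B (Suc (Suc k))). \<forall>b. (x - d (Suc k) w) b \<in> I\<Lambda>"
    proof (intro bexI allI)
      show "g (Suc (Suc k)) w - w0 \<in> free_mod P (B (Suc (Suc k)))" by (rule free_mod_diff[OF gw w0(1)])
      fix b
      have 1: "(g (Suc k) (f (Suc k) x) - d (Suc k) (g (Suc (Suc k)) w)) b \<in> I\<Lambda>"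
        unfolding dif[symmetric]
        by (rule lin_preserves_ideal[OF J g_lin free_mod_diff[OF fx kw]]) (use w(2) in simp)
      have "(x - d (Suc k) (g (Suc (Suc k)) w - w0)) b =
        (g (Suc k) (f (Suc k) x) - d (Suc k) (g (Suc (Suc k)) w)) b - (g (Suc k) (f (Suc k) x) - x - d (Suc k) w0) b"
        unfolding lin_diff[OF F.d_lin gw w0(1)] by simp
      then show "(x - d (Suc k) (g (Suc (Suc k)) w - w0)) b \<in> I\<Lambda>"
        using poly_ideal_diff[OF J 1 w0(2)[rule_format, of b]] by (simp only:)
    qed
  next
    note x' = TC.Z_free[OF x]
    assume "\<exists>w\<in>free_mod P (B (Suc (Suc k))). \<forall>b. (x - d (Suc k) w) b \<in> I\<Lambda>"
    then obtain w where w: "w \<in> free_mod P (B (Suc (Suc k)))" "\<And>b. (x - d (Suc k) w) b \<in> I\<Lambda>" by blast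
    have dw: "d (Suc k) w \<in> free_mod P (B (Suc k))" by (rule lin_closed[OF F.d_lin w(1)])
    have "f (Suc k) (x - d (Suc k) w) S \<in> I\<Lambda>" for S
      by (rule lin_preserves_ideal[OF J f_lin free_mod_diff[OF x' dw] w(2)])
    then have bd: "(f (Suc k) x - kbd (f (Suc (Suc k)) w)) S \<in> I\<Lambda>" for S
      unfolding lin_diff[OF f_lin x' dw] f_comm[OF w(1)] .
    have fx: "f (Suc k) x \<in> kchains i" using f_cyc[OF x] by (simp add: cycles_mod_def)
    show "\<forall>j\<in>cycle_index i. \<Phi> x j = 0"
      unfolding \<Phi>_def by (intro ballI) (rule boundary_coord_zero[OF fx bd])
  qed
  note res = TC.homology_by_coordinates[OF finite_cycle_index add smult surj ker]
  show "K_fin_dim (K_space T)" unfolding TH by (rule res(1))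
  show "K_dim (K_space T) = card (cycle_index i)" unfolding TH by (rule res(2))
  show "hcomp T (int i + 2) = carrier T" unfolding TH by (rule res(3))
qed

end

section \<open>Two regular elements\<close>

context finite_linear_space begin

text \<open>The ideal of the full simplex on \<open>l\<close>, whose quotient is a polynomial ring in the variables of \<open>l\<close>. The
Stanley-Reisner ideal is the intersection of these ideals over all lines.\<close>

abbreviation line_ideal :: "'p set \<Rightarrow> ('p, 'k::field) mpoly set" where
  "line_ideal l \<equiv> nonface_ideal P (Pow l)"

lemma line_poly_ideal: "poly_ideal P (line_ideal l :: ('p, 'k::field) mpoly set)"
  unfolding poly_ideal_def
proof (intro conjI ballI)
  fix r f :: "('p, 'k) mpoly" assume r: "r \<in> polys P" and f: "f \<in> line_ideal l"
  show "r * f \<in> line_ideal l"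
    unfolding nonface_ideal_def
  proof (intro CollectI conjI ballI)
    show "r * f \<in> polys P" using r f by (simp add: nonface_ideal_def)
    fix n assume "n \<in> supp (r * f)"
    then obtain a b where n: "n = a + b" "b \<in> supp f" using keys_mult[of r f] by blast
    then have "supp b \<notin> Pow l" using f by (simp add: nonface_ideal_def)
    then show "supp n \<notin> Pow l" by (auto simp: n supp_add_exp)
  qed
qed (auto simp: nonface_ideal_polys nonface_ideal_add)

lemma lines_nonempty: "L \<noteq> {}"
proof -
  obtain a b where "a \<in> P" "b \<in> P" "a \<noteq> b"
    using card_P by (metis card_le_Suc0_iff_eq card.infinite not_less_eq_eq numeral_2_eq_2 zero_le)
  then show ?thesis using line_exists by blast
qed

lemma nonface_ideal_iff_lines:
  "f \<in> nonface_ideal P \<Lambda> \<longleftrightarrow> (\<forall>l\<in>L. f \<in> line_ideal l)"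
  using lines_nonempty unfolding nonface_ideal_def by (auto simp: face_iff)

text \<open>If \<open>\<theta>\<close> is monic of degree \<open>N\<close> in the variable of \<open>a\<close>, then among the terms of \<open>r\<close> supported on \<open>l\<close> those of highest
degree in that variable survive in the product, shifted by \<open>N\<close>.\<close>

lemma monic_cancel:
  fixes \<theta> r :: "('p, 'k::field) mpoly"
  assumes r: "r \<in> polys P" and prod: "\<theta> * r \<in> line_ideal l" and a: "a \<in> l"
    and lead: "coef \<theta> (Poly_Mapping.single a N) = 1"
    and other: "\<And>m. coef \<theta> m \<noteq> 0 \<Longrightarrow> m \<noteq> Poly_Mapping.single a N \<Longrightarrow> coef m a < N"
  shows "r \<in> line_ideal l"
proof (rule ccontr)
  assume "r \<notin> line_ideal l"
  then have ne: "{n \<in> supp r. supp n \<subseteq> l} \<noteq> {}" using r by (auto simp: nonface_ideal_def)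
  define D where "D = Max ((\<lambda>n. coef n a) ` {n \<in> supp r. supp n \<subseteq> l})"
  have fin: "finite ((\<lambda>n. coef n a) ` {n \<in> supp r. supp n \<subseteq> l})" by simp
  have "D \<in> (\<lambda>n. coef n a) ` {n \<in> supp r. supp n \<subseteq> l}"
    unfolding D_def by (rule Max_in[OF fin]) (use ne in simp)
  then obtain n where n: "n \<in> supp r" "supp n \<subseteq> l" "coef n a = D" by auto
  have max: "coef n' a \<le> D" if "n' \<in> supp r" "supp n' \<subseteq> l" for n'
    unfolding D_def by (rule Max_ge[OF fin]) (use that in blast)
  define k where "k = Poly_Mapping.single a N + n"
  have ka: "coef k a = N + D" by (simp add: k_def lookup_add n)
  have kl: "supp k \<subseteq> l" using n a by (auto simp: k_def supp_add_exp split: if_splits)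
  have "coef (\<theta> * r) k = coef (\<Sum>m\<in>supp \<theta>. monom_mp m (coef \<theta> m) * r) k"
    by (subst sum_monoms[of \<theta>, symmetric]) (simp only: sum_distrib_right)
  also have "\<dots> = (\<Sum>m\<in>supp \<theta>. if m = Poly_Mapping.single a N then coef r n else 0)"
    unfolding lookup_sum
  proof (rule sum.cong[OF refl])
    fix m assume m: "m \<in> supp \<theta>"
    show "coef (monom_mp m (coef \<theta> m) * r) k = (if m = Poly_Mapping.single a N then coef r n else 0)"
    proof (cases "m = Poly_Mapping.single a N")
      case True
      then show ?thesis by (simp add: k_def coef_monom_mult_add lead)
    next
      case False
      have lt: "coef m a < N" using other[of m] m False by (simp add: in_keys_iff)
      show ?thesis
      proof (cases "\<exists>n'. k = m + n'")
        case True
        then obtain n' where n': "k = m + n'" by blast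
        have "supp n' \<subseteq> l" using kl by (simp add: n' supp_add_exp)
        moreover have "D < coef n' a" using ka lt by (simp add: n' lookup_add)
        ultimately have "coef r n' = 0" using max[of n'] by (auto simp: in_keys_iff)
        then show ?thesis using False by (simp add: n' coef_monom_mult_add)
      next
        case no: False
        have "coef (monom_mp m (coef \<theta> m) * r) k = 0" by (rule coef_monom_mult_other) (use no in blast)
        then show ?thesis using False by simp
      qed
    qed
  qed
  also have "\<dots> = coef r n"
    using lead by (simp add: sum.delta in_keys_iff)
  finally have "coef (\<theta> * r) k \<noteq> 0" using n by (simp add: in_keys_iff)
  moreover have "coef (\<theta> * r) k = 0" by (rule nonface_idealD[OF prod]) (use kl in simp)
  ultimately show False by simp
qed

text \<open>\<open>e1 V\<close> and \<open>e2 V\<close> are the elementary symmetric polynomials in the variables of \<open>V\<close>.\<close>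

definition e1 :: "'p set \<Rightarrow> ('p, 'k::field) mpoly" where
  "e1 V = (\<Sum>v\<in>V. monom_mp (unit_exp v) 1)"

definition e2 :: "'p set \<Rightarrow> ('p, 'k::field) mpoly" where
  "e2 V = (\<Sum>S\<in>{S. S \<subseteq> V \<and> card S = 2}. monom_mp (sqfree_exp S) 1)"

lemma e1_hR: "V \<subseteq> Q \<Longrightarrow> e1 V \<in> hR Q 1"
  unfolding e1_def by (intro hR_sum hR_monom) (auto simp: tdeg_unit_exp[simplified])

lemma e2_hR: assumes "V \<subseteq> Q" "finite Q" shows "e2 V \<in> hR Q 2"
  unfolding e2_def
proof (intro hR_sum hR_monom)
  fix S assume S: "S \<in> {S. S \<subseteq> V \<and> card S = 2}"
  then have "finite S" using card.infinite by fastforce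
  then show "supp (sqfree_exp S) \<subseteq> Q" "int (tdeg (sqfree_exp S)) = 2" using S assms by (auto simp: tdeg_sqfree)
qed

lemma hR_polys: "f \<in> hR Q j \<Longrightarrow> f \<in> polys Q"
  by (simp add: hR_iff)

lemma unit_exp_inj: "unit_exp u = unit_exp v \<longleftrightarrow> u = v"
  by (metis (mono_tags) keys_single singleton_inject one_neq_zero)

lemma coef_e1: "finite V \<Longrightarrow> coef (e1 V) (unit_exp b) = (if b \<in> V then 1 else 0)"
  unfolding e1_def lookup_sum lookup_single when_def unit_exp_inj by simp

lemma tdeg_one_unit_exp: "tdeg m = 1 \<Longrightarrow> a \<in> supp m \<Longrightarrow> m = unit_exp a"
proof -
  assume t: "tdeg m = 1" and a: "a \<in> supp m"
  have m: "m = unit_exp a + (m - unit_exp a)" by (rule unit_exp_decomp[OF a])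
  then have "tdeg (m - unit_exp a) = 0" using t tdeg_add[of "unit_exp a" "m - unit_exp a"] tdeg_unit_exp[of a] by simp
  then have z: "\<forall>v\<in>supp (m - unit_exp a). coef (m - unit_exp a) v = 0" by (simp add: tdeg_def)
  have "m - unit_exp a = 0"
  proof (rule poly_mapping_eqI)
    fix v show "coef (m - unit_exp a) v = coef 0 v"
      using z by (cases "v \<in> supp (m - unit_exp a)") (simp_all add: not_in_keys_iff_lookup_eq_zero)
  qed
  then show ?thesis using m by (simp only: add_0_right)
qed

lemma e1_monic:
  assumes "finite V" "a \<in> V" "coef (e1 V :: ('p, 'k::field) mpoly) m \<noteq> 0" "m \<noteq> Poly_Mapping.single a 1"
  shows "coef m a < 1"
proof (rule ccontr)
  assume "\<not> coef m a < 1"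
  moreover have "tdeg m = 1" using e1_hR[OF subset_refl, of V] assms by (auto simp: hR_iff)
  ultimately show False using tdeg_one_unit_exp[of m a] assms(4) by (simp add: in_keys_iff)
qed

lemma e1_regular:
  assumes r: "r \<in> polys P" and prod: "e1 P * r \<in> nonface_ideal P \<Lambda>"
  shows "(r :: ('p, 'k::field) mpoly) \<in> nonface_ideal P \<Lambda>"
  unfolding nonface_ideal_iff_lines
proof
  fix l assume l: "l \<in> L"
  then obtain a where a: "a \<in> l" using card_line[OF l] by fastforce
  then have aP: "a \<in> P" using line_sub l by auto
  show "r \<in> line_ideal l"
  proof (rule monic_cancel[OF r _ a, of "e1 P" 1])
    show "e1 P * r \<in> line_ideal l" using prod l by (simp only: nonface_ideal_iff_lines)
    show "coef (e1 P) (unit_exp a) = (1 :: 'k)" using coef_e1[OF finite_points, of a] aP by simp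
    show "coef m a < 1" if "coef (e1 P :: ('p, 'k) mpoly) m \<noteq> 0" "m \<noteq> unit_exp a" for m
      by (rule e1_monic[OF finite_points aP that])
  qed
qed

lemma polys_mono: "V \<subseteq> W \<Longrightarrow> f \<in> polys V \<Longrightarrow> f \<in> polys W"
  by (auto simp: polys_def)

lemma e1_split: "a \<in> V \<Longrightarrow> finite V \<Longrightarrow> e1 V = monom_mp (unit_exp a) 1 + e1 (V - {a})"
  unfolding e1_def by (rule sum.remove)

lemma e2_split:
  assumes a: "a \<in> V" and fin: "finite V"
  shows "e2 V = monom_mp (unit_exp a) 1 * e1 (V - {a}) + (e2 (V - {a}) :: ('p, 'k::field) mpoly)"
proof -
  let ?m = "\<lambda>S. monom_mp (sqfree_exp S) 1 :: ('p, 'k) mpoly"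
  have U: "{S. S \<subseteq> V \<and> card S = 2} = (\<lambda>v. {a, v}) ` (V - {a}) \<union> {S. S \<subseteq> V - {a} \<and> card S = 2}"
  proof
    show "{S. S \<subseteq> V \<and> card S = 2} \<subseteq> (\<lambda>v. {a, v}) ` (V - {a}) \<union> {S. S \<subseteq> V - {a} \<and> card S = 2}"
    proof
      fix S assume S: "S \<in> {S. S \<subseteq> V \<and> card S = 2}"
      then obtain u v where uv: "S = {u, v}" "u \<noteq> v" by (auto simp: card_2_iff)
      show "S \<in> (\<lambda>v. {a, v}) ` (V - {a}) \<union> {S. S \<subseteq> V - {a} \<and> card S = 2}"
        using S uv by (cases "u = a"; cases "v = a") (auto simp: insert_commute)
    qed
  qed (use a in \<open>auto simp: card_2_iff\<close>)
  have "e2 V = sum ?m ((\<lambda>v. {a, v}) ` (V - {a})) + sum ?m {S. S \<subseteq> V - {a} \<and> card S = 2}"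
    unfolding e2_def U by (rule sum.union_disjoint) (use fin in auto)
  also have "sum ?m ((\<lambda>v. {a, v}) ` (V - {a})) = (\<Sum>v\<in>V - {a}. ?m {a, v})"
    by (rule sum.reindex_cong[of "\<lambda>v. {a, v}"]) (auto simp: inj_on_def doubleton_eq_iff)
  also have "\<dots> = monom_mp (unit_exp a) 1 * e1 (V - {a})"
    unfolding e1_def sum_distrib_left
    by (rule sum.cong) (auto simp: sqfree_exp_def mult_single)
  finally show ?thesis by (simp add: e2_def)
qed

text \<open>Replace the variable of \<open>a\<close> by \<open>e1 P\<close> minus the other variables.\<close>

lemma division_by_e1:
  fixes f :: "('p, 'k::field) mpoly"
  assumes a: "a \<in> P" and f: "f \<in> polys P"
  shows "\<exists>q r. q \<in> polys P \<and> r \<in> polys (P - {a}) \<and> f = e1 P * q + r"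
proof -
  have mon: "\<exists>q r. q \<in> polys P \<and> r \<in> polys (P - {a}) \<and> monom_mp m c = e1 P * q + r"
    if "supp m \<subseteq> P" "coef m a = N" for m and c :: 'k and N
    using that
  proof (induction N arbitrary: m)
    case 0
    then have "monom_mp m c \<in> polys (P - {a})" by (intro polys_monom) (auto simp: in_keys_iff)
    then show ?case by (intro exI[of _ 0] exI[of _ "monom_mp m c"]) simp
  next
    case (Suc N)
    have m: "m = unit_exp a + (m - unit_exp a)"
      by (rule unit_exp_decomp) (use Suc.prems in \<open>simp add: in_keys_iff\<close>)
    define m' where "m' = m - unit_exp a"
    have m': "m = unit_exp a + m'" using m by (simp only: m'_def)
    have "supp m' \<subseteq> P" "coef m' a = N" using Suc.prems by (simp_all add: m' supp_add_exp lookup_add)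
    then obtain q r where qr: "q \<in> polys P" "r \<in> polys (P - {a})" "monom_mp m' c = e1 P * q + r"
      using Suc.IH by blast
    have rP: "r \<in> polys P" by (rule polys_mono[OF _ qr(2)]) auto
    have e1s: "(e1 P :: ('p, 'k) mpoly) = monom_mp (unit_exp a) 1 + e1 (P - {a})"
      by (rule e1_split[OF a finite_points])
    have xa: "(monom_mp (unit_exp a) 1 :: ('p, 'k) mpoly) \<in> polys P" by (rule polys_monom) (use a in simp)
    have "monom_mp m c = monom_mp (unit_exp a) 1 * monom_mp m' c" by (simp add: mult_single m')
    also have "\<dots> = monom_mp (unit_exp a) 1 * (e1 P * q) + (e1 P - e1 (P - {a})) * r"
    proof -
      have "e1 P - e1 (P - {a}) = (monom_mp (unit_exp a) 1 :: ('p, 'k) mpoly)" using e1s by simp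
      then show ?thesis unfolding qr(3) by (simp only: distrib_left)
    qed
    also have "\<dots> = e1 P * (monom_mp (unit_exp a) 1 * q + r) + (- (e1 (P - {a}) * r))"
      by (simp add: algebra_simps)
    finally have eq: "monom_mp m c = \<dots>" .
    have "e1 (P - {a}) * r \<in> polys (P - {a})"
      by (rule polys_mult[OF hR_polys[OF e1_hR[OF subset_refl]] qr(2)])
    then have 1: "- (e1 (P - {a}) * r) \<in> polys (P - {a})" by (rule polys_uminus)
    have 2: "monom_mp (unit_exp a) 1 * q + r \<in> polys P" by (intro polys_add polys_mult xa qr(1) rP)
    show ?case by (rule exI, rule exI, rule conjI[OF 2 conjI[OF 1 eq]])
  qed
  have "\<exists>q r. q \<in> polys P \<and> r \<in> polys (P - {a}) \<and> (\<Sum>m\<in>A. monom_mp m (coef f m)) = e1 P * q + r"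
    if "finite A" "A \<subseteq> supp f" for A
    using that
  proof (induction A rule: finite_induct)
    case empty
    show ?case by (intro exI[of _ 0]) simp
  next
    case (insert m A)
    obtain q r where 1: "q \<in> polys P" "r \<in> polys (P - {a})" "(\<Sum>m\<in>A. monom_mp m (coef f m)) = e1 P * q + r"
      using insert.IH insert.prems by (metis insert_subset)
    have "supp m \<subseteq> P" using f insert.prems by (simp add: polys_def)
    then obtain q' r' where 2: "q' \<in> polys P" "r' \<in> polys (P - {a})" "monom_mp m (coef f m) = e1 P * q' + r'"
      using mon[OF _ refl] by blast
    have "(\<Sum>m\<in>insert m A. monom_mp m (coef f m)) = e1 P * (q' + q) + (r' + r)"
      unfolding sum.insert[OF insert.hyps] 1(3) 2(3) by (simp add: algebra_simps)
    then show ?case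
      by (intro exI conjI) (rule polys_add[OF 2(1) 1(1)], rule polys_add[OF 2(2) 1(2)])
  qed
  from this[OF finite_keys subset_refl] show ?thesis by (simp only: sum_monoms)
qed

text \<open>Let \<open>E1\<close> and \<open>E2\<close> be the symmetric polynomials without the variable of \<open>a\<close>. Modulo \<open>e1 P\<close> this variable equals \<open>- E1\<close>,
so that \<open>e2 P\<close> becomes \<open>- h\<close> with \<open>h = E1 * E1 - E2\<close>. On the line, \<open>h\<close> is monic of degree two in the variable of a second point
\<open>b\<close>, hence cancellable.\<close>

lemma e2_regular_on_line:
  fixes r s :: "('p, 'k::field) mpoly"
  assumes l: "l \<in> L" and r: "r \<in> polys P" and s: "s \<in> polys P"
    and rel: "e2 P * r - e1 P * s \<in> line_ideal l"
  shows "\<exists>w\<in>polys P. r - e1 P * w \<in> line_ideal l"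
proof -
  obtain a b where ab: "a \<in> l" "b \<in> l" "a \<noteq> b"
    using card_line[OF l] by (metis card_le_Suc0_iff_eq card.infinite not_less_eq_eq numeral_2_eq_2 zero_le)
  have aP: "a \<in> P" "b \<in> P" using line_sub l ab by auto
  define E1 E2 where "E1 = (e1 (P - {a}) :: ('p, 'k) mpoly)" and "E2 = (e2 (P - {a}) :: ('p, 'k) mpoly)"
  define h where "h = E1 * E1 - E2"
  obtain q r0 where q: "q \<in> polys P" and r0: "r0 \<in> polys (P - {a})" and rq: "r = e1 P * q + r0"
    using division_by_e1[OF aP(1) r] by blast
  have r0P: "r0 \<in> polys P" by (rule polys_mono[OF _ r0]) auto
  have E: "E1 \<in> hR (P - {a}) 1" "E2 \<in> hR (P - {a}) 2"
    unfolding E1_def E2_def by (rule e1_hR[OF subset_refl], rule e2_hR[OF subset_refl finite_Diff[OF finite_points]])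
  have EP: "E1 \<in> polys P" "e2 P \<in> polys P"
    using polys_mono[OF _ hR_polys[OF E(1)], of P] hR_polys[OF e2_hR[OF subset_refl finite_points]] by auto
  have hh: "h \<in> hR (P - {a}) 2"
    using hR_mult[OF E(1) E(1)] hR_add[of "E1 * E1" "P - {a}" 2 "- E2"] E(2) by (simp add: h_def hR_iff)
  have e1s: "e1 P = monom_mp (unit_exp a) 1 + E1"
    unfolding E1_def by (rule e1_split[OF aP(1) finite_points])
  have e2P: "e2 P = e1 P * E1 - h"
    unfolding e2_split[OF aP(1) finite_points] h_def E1_def[symmetric] E2_def[symmetric]
    by (simp add: e1s algebra_simps)
  define g where "g = e2 P * q + E1 * r0 - s"
  have g: "g \<in> polys P" unfolding g_def by (intro polys_diff polys_add polys_mult EP q r0P s)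
  have "e1 P * g - h * r0 = e2 P * r - e1 P * s"
  proof -
    have "e2 P * r - e1 P * s = e2 P * (e1 P * q) + e2 P * r0 - e1 P * s" by (simp add: rq distrib_left)
    also have "e2 P * r0 = e1 P * E1 * r0 - h * r0" by (simp add: e2P left_diff_distrib)
    finally show ?thesis by (simp add: g_def algebra_simps)
  qed
  then have rel2: "e1 P * g - h * r0 \<in> line_ideal l" using rel by simp
  have hr0: "h * r0 \<in> polys (P - {a})" by (rule polys_mult[OF hR_polys[OF hh] r0])
  \<comment> \<open>In \<open>e1 P * g - h * r0\<close>, terms of positive degree in the variable of \<open>a\<close> come from \<open>e1 P * g\<close> alone.\<close>
  have gl: "g \<in> line_ideal l"
  proof (rule ccontr)
    assume "g \<notin> line_ideal l"
    then have ne: "{n \<in> supp g. supp n \<subseteq> l} \<noteq> {}" using g by (auto simp: nonface_ideal_def)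
    define D where "D = Max ((\<lambda>n. coef n a) ` {n \<in> supp g. supp n \<subseteq> l})"
    have fin: "finite ((\<lambda>n. coef n a) ` {n \<in> supp g. supp n \<subseteq> l})" by simp
    have "D \<in> (\<lambda>n. coef n a) ` {n \<in> supp g. supp n \<subseteq> l}"
      unfolding D_def by (rule Max_in[OF fin]) (use ne in simp)
    then obtain n where n: "n \<in> supp g" "supp n \<subseteq> l" "coef n a = D" by auto
    have max: "coef n' a \<le> D" if "n' \<in> supp g" "supp n' \<subseteq> l" for n'
      unfolding D_def by (rule Max_ge[OF fin]) (use that in blast)
    define k where "k = unit_exp a + n"
    have kl: "supp k \<subseteq> l" using n ab by (auto simp: k_def supp_add_exp)
    have "coef (e1 P * g) k = (\<Sum>v\<in>P. if v = a then coef g n else 0)"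
      unfolding e1_def sum_distrib_right lookup_sum coef_var_mult
    proof (rule sum.cong[OF refl])
      fix v assume "v \<in> P"
      show "(if v \<in> supp k then 1 * coef g (k - unit_exp v) else 0) = (if v = a then coef g n else 0)"
      proof (cases "v = a")
        case True
        then show ?thesis by (simp add: k_def supp_add_exp)
      next
        case False
        have "coef g (k - unit_exp v) = 0" if v: "v \<in> supp k"
        proof -
          have "coef (k - unit_exp v) a = D + 1" using False n by (simp add: k_def lookup_minus lookup_add lookup_single when_def)
          moreover have "supp (k - unit_exp v) \<subseteq> l"
            using kl by (auto simp: in_keys_iff lookup_minus)
          ultimately show ?thesis using max[of "k - unit_exp v"] by (auto simp: in_keys_iff)
        qed
        then show ?thesis using False by simp
      qed
    qed
    also have "\<dots> = coef g n" using finite_points aP by simp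
    finally have "coef (e1 P * g) k \<noteq> 0" using n by (simp add: in_keys_iff)
    moreover have "coef (h * r0) k = 0"
      using hr0 by (auto simp: polys_iff k_def supp_add_exp)
    moreover have "coef (e1 P * g - h * r0) k = 0" by (rule nonface_idealD[OF rel2]) (use kl in simp)
    ultimately show False by (simp add: lookup_minus)
  qed
  have "e1 P * g \<in> line_ideal l"
    by (rule poly_idealD(4)[OF line_poly_ideal hR_polys[OF e1_hR[OF subset_refl]] gl])
  from poly_ideal_diff[OF line_poly_ideal this rel2] have hr: "h * r0 \<in> line_ideal l" by simp
  have "r0 \<in> line_ideal l"
  proof (rule monic_cancel[OF r0P hr ab(2), of 2])
    have bb: "Poly_Mapping.single b (2::nat) = unit_exp b + unit_exp b" by (simp only: single_add[symmetric] one_add_one)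
    have "coef (E1 * E1) (unit_exp b + unit_exp b)
        = (\<Sum>v\<in>P - {a}. if v = b then coef E1 (unit_exp b) else 0)"
      unfolding E1_def e1_def[of "P - {a}"] sum_distrib_right lookup_sum coef_var_mult
      by (rule sum.cong) (auto simp: supp_add_exp)
    also have "\<dots> = 1" using aP ab finite_points coef_e1[of "P - {a}" b] by (simp add: E1_def)
    finally have c1: "coef (E1 * E1) (Poly_Mapping.single b 2) = 1" by (simp only: bb)
    have "coef E2 (Poly_Mapping.single b 2) = 0"
      unfolding E2_def e2_def lookup_sum
    proof (rule sum.neutral, intro ballI)
      fix S assume S: "S \<in> {S. S \<subseteq> P - {a} \<and> card S = 2}"
      have "S \<subseteq> P" using S by auto
      then have fS: "finite S" by (rule finite_subset[OF _ finite_points])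
      have "coef (sqfree_exp S) b \<noteq> 2" unfolding coef_sqfree_exp[OF fS] by simp
      moreover have "coef (Poly_Mapping.single b (2::nat)) b = 2" by simp
      ultimately have "coef (sqfree_exp S) b \<noteq> coef (Poly_Mapping.single b (2::nat)) b" by (simp only:) simp
      then have "sqfree_exp S \<noteq> Poly_Mapping.single b 2" by (rule contrapos_nn) simp
      then show "coef (monom_mp (sqfree_exp S) (1 :: 'k)) (Poly_Mapping.single b 2) = 0"
        by (simp add: lookup_single when_def)
    qed
    then show "coef h (Poly_Mapping.single b 2) = 1" using c1 by (simp add: h_def lookup_minus)
    fix m assume m: "coef h m \<noteq> 0" "m \<noteq> Poly_Mapping.single b 2"
    show "coef m b < 2"
    proof (rule ccontr)
      assume mb: "\<not> coef m b < 2"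
      then have "b \<in> supp m" by (auto simp: in_keys_iff)
      then have 1: "m = unit_exp b + (m - unit_exp b)" by (rule unit_exp_decomp)
      have "tdeg m = 2" using hh m by (auto simp: hR_iff)
      moreover have "tdeg m = tdeg (unit_exp b) + tdeg (m - unit_exp b)" by (subst 1) (rule tdeg_add)
      ultimately have "tdeg (m - unit_exp b) = 1" using tdeg_unit_exp[of b] by simp
      moreover have "b \<in> supp (m - unit_exp b)" using mb by (simp add: in_keys_iff lookup_minus)
      ultimately have "m - unit_exp b = unit_exp b" by (rule tdeg_one_unit_exp)
      then show False using 1 m(2) bb by simp
    qed
  qed
  then show ?thesis using q by (intro bexI[of _ q]) (simp_all add: rq)
qed

text \<open>On a line \<open>l\<close> there is a quotient \<open>W l\<close>. Along the axis of a point \<open>v\<close> the form \<open>e1 P\<close> is just the variable of \<open>v\<close>, so \<open>r\<close>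
determines the coefficients of \<open>W l\<close> at powers of this variable. Lines through \<open>v\<close> thus agree there, and any
two lines agree in the constant term by way of a line joining a point of each. Since distinct lines share at most one
point, the quotients glue.\<close>

lemma e2_regular:
  fixes r s :: "('p, 'k::field) mpoly"
  assumes r: "r \<in> polys P" and s: "s \<in> polys P" and rel: "e2 P * r - e1 P * s \<in> nonface_ideal P \<Lambda>"
  shows "\<exists>w\<in>polys P. r - e1 P * w \<in> nonface_ideal P \<Lambda>"
proof -
  have "\<forall>l\<in>L. \<exists>w. w \<in> polys P \<and> r - e1 P * w \<in> line_ideal l"
    using e2_regular_on_line[OF _ r s] rel unfolding nonface_ideal_iff_lines by blast
  then have "\<exists>W. \<forall>l\<in>L. W l \<in> polys P \<and> r - e1 P * W l \<in> line_ideal l" by (rule bchoice)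
  then obtain W where W: "\<And>l. l \<in> L \<Longrightarrow> W l \<in> polys P" "\<And>l. l \<in> L \<Longrightarrow> r - e1 P * W l \<in> line_ideal l" by blast
  have vertex: "coef (W l) m = coef r (m + unit_exp v)" if l: "l \<in> L" "v \<in> l" and m: "supp m \<subseteq> {v}" for l v m
  proof -
    have v: "v \<in> P" using line_sub l by auto
    have sm: "supp (m + unit_exp v) = {v}" using m by (auto simp: supp_add_exp)
    have "coef (e1 P * W l) (m + unit_exp v) = (\<Sum>u\<in>P. if u = v then coef (W l) m else 0)"
      unfolding e1_def sum_distrib_right lookup_sum coef_var_mult sm by (rule sum.cong) auto
    also have "\<dots> = coef (W l) m" using finite_points v by simp
    finally have "coef (e1 P * W l) (m + unit_exp v) = coef (W l) m" .
    moreover have "coef (r - e1 P * W l) (m + unit_exp v) = 0"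
      by (rule nonface_idealD[OF W(2)[OF l(1)]]) (use sm l in simp)
    ultimately show ?thesis by (simp add: lookup_minus)
  qed
  \<comment> \<open>Only supports with at most one point can lie on two lines.\<close>
  have agree: "coef (W l) m = coef (W l') m" if l: "l \<in> L" "l' \<in> L" "supp m \<subseteq> l" "supp m \<subseteq> l'" for l l' m
  proof (cases "2 \<le> card (supp m)")
    case True
    then show ?thesis using face_line_unique[OF l(1,2,3,4)] by simp
  next
    case False
    show ?thesis
    proof (cases "supp m = {}")
      case True
      obtain v v' where v: "v \<in> l" "v' \<in> l'" using card_line[OF l(1)] card_line[OF l(2)] by fastforce
      have "v \<in> P" "v' \<in> P" using v line_sub l by auto
      then obtain l'' where l'': "l'' \<in> L" "{v, v'} \<subseteq> l''" using pair_face by (auto simp: face_iff)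
      then have vs: "v \<in> l''" "v' \<in> l''" by auto
      have "coef (W l) m = coef (W l'') m"
        using vertex[OF l(1) v(1)] vertex[OF l''(1) vs(1)] True by simp
      also have "\<dots> = coef (W l') m" using vertex[OF l(2) v(2)] vertex[OF l''(1) vs(2)] True by simp
      finally show ?thesis .
    next
      case ne: False
      have "card (supp m) = 1" using False ne card_0_eq[OF finite_keys, of m] by linarith
      then obtain v where v: "supp m = {v}" by (auto simp: card_1_singleton_iff)
      then show ?thesis using vertex[OF l(1), of v m] vertex[OF l(2), of v m] l by simp
    qed
  qed
  define c where "c m = (if supp m \<in> \<Lambda> then coef (W (SOME l. l \<in> L \<and> supp m \<subseteq> l)) m else 0)" for m
  have c: "c m = coef (W l) m" if "l \<in> L" "supp m \<subseteq> l" for l m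
  proof -
    define l' where "l' = (SOME l. l \<in> L \<and> supp m \<subseteq> l)"
    have l': "l' \<in> L \<and> supp m \<subseteq> l'" unfolding l'_def by (rule someI[of _ l]) (use that in simp)
    have "supp m \<in> \<Lambda>" using that by (auto simp: face_iff)
    then have "c m = coef (W l') m" by (simp only: c_def l'_def if_True)
    also have "\<dots> = coef (W l) m" by (rule agree) (use l' that in simp_all)
    finally show ?thesis .
  qed
  have c0: "c m = 0" if "supp m \<notin> \<Lambda>" for m using that by (simp add: c_def)
  have "{m. c m \<noteq> 0} \<subseteq> (\<Union>l\<in>L. supp (W l))"
  proof
    fix m assume m: "m \<in> {m. c m \<noteq> 0}"
    then have "supp m \<in> \<Lambda>" using c0 by blast
    then obtain l where "l \<in> L" "supp m \<subseteq> l" by (auto simp: face_iff)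
    then show "m \<in> (\<Union>l\<in>L. supp (W l))" using c[of l m] m by (auto simp: in_keys_iff)
  qed
  then have fin: "finite {m. c m \<noteq> 0}" by (rule finite_subset) (use finite_lines in simp)
  define w where "w = Abs_poly_mapping c"
  have cw: "coef w = c" using fin by (simp add: w_def)
  have wP: "w \<in> polys P"
    unfolding polys_iff cw
  proof (intro allI impI)
    fix m assume "c m \<noteq> 0"
    then have "supp m \<in> \<Lambda>" using c0 by blast
    then show "supp m \<subseteq> P" using line_sub by (auto simp: face_iff)
  qed
  have "r - e1 P * w \<in> line_ideal l" if l: "l \<in> L" for l
  proof -
    have "W l - w \<in> line_ideal l"
      by (rule nonface_idealI) (use W(1)[OF l] wP c[OF l] in \<open>simp_all add: lookup_minus cw\<close>)
    then have "e1 P * (W l - w) \<in> line_ideal l"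
      by (rule poly_idealD(4)[OF line_poly_ideal hR_polys[OF e1_hR[OF subset_refl]]])
    from poly_idealD(3)[OF line_poly_ideal W(2)[OF l] this] show ?thesis by (simp add: algebra_simps)
  qed
  then show ?thesis using wP unfolding nonface_ideal_iff_lines by blast
qed

end

section \<open>Ideals of quotients of polynomial rings\<close>

text \<open>The quotient ring, whose ideals are handled through their preimages in the polynomial ring.\<close>

locale poly_quotient =
  fixes P :: "'p set" and J :: "('p, 'k::field) mpoly set"
  assumes J: "poly_ideal P J"
begin

abbreviation "R \<equiv> mpoly_ring P :: (('p, 'k) mpoly, ('p, 'k) mpoly) gmodule"
abbreviation "A \<equiv> quot_gmodule R J"
abbreviation \<pi> :: "('p, 'k) mpoly \<Rightarrow> ('p, 'k) mpoly set" where "\<pi> r \<equiv> J +>\<^bsub>R\<^esub> r"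

sublocale Q: submodule_quotient R R J
  by (rule submodule_quotient.intro[OF module_mpoly_ring submodule_poly_ideal[OF J]])

lemma carrier_A: "carrier A = \<pi> ` polys P"
  using Q.carrier_quot by simp

lemma \<pi>_in: "r \<in> polys P \<Longrightarrow> \<pi> r \<in> carrier A"
  unfolding carrier_A by (rule imageI)

lemma \<pi>_eq: "r \<in> polys P \<Longrightarrow> s \<in> polys P \<Longrightarrow> \<pi> r = \<pi> s \<longleftrightarrow> r - s \<in> J"
  using Q.coset_eq_iff[of r s] by (simp add: a_minus_mpoly_ring)

lemma \<pi>_add: "r \<in> polys P \<Longrightarrow> s \<in> polys P \<Longrightarrow> \<pi> r \<oplus>\<^bsub>A\<^esub> \<pi> s = \<pi> (r + s)"
  using Q.add_quot[of r s] by simp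

lemma \<pi>_mult: "r \<in> polys P \<Longrightarrow> s \<in> polys P \<Longrightarrow> \<pi> r \<otimes>\<^bsub>A\<^esub> \<pi> s = \<pi> (r * s)"
  using ideal.rcoset_mult_add[OF ideal_of_poly_ideal[OF J], of r s]
  by (simp add: quot_gmodule_def FactRing_def)

lemma \<pi>_one: "\<one>\<^bsub>A\<^esub> = \<pi> 1"
  by (simp add: quot_gmodule_def FactRing_def)

lemma \<pi>_zero: "\<zero>\<^bsub>A\<^esub> = \<pi> 0"
  using Q.zero_quot by simp

lemma carrier_A_E: assumes "x \<in> carrier A" obtains r where "r \<in> polys P" "x = \<pi> r"
  using assms unfolding carrier_A by (rule imageE) (rule that)

lemma cring_A: "cring A"
proof (rule cringI)
  show "abelian_group A" using Q.module_quot by (simp add: module_def)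
  show "comm_monoid A"
  proof (rule comm_monoidI)
    fix x y z assume x: "x \<in> carrier A" and y: "y \<in> carrier A" and z: "z \<in> carrier A"
    obtain r where r: "r \<in> polys P" "x = \<pi> r" using x by (rule carrier_A_E)
    obtain s where s: "s \<in> polys P" "y = \<pi> s" using y by (rule carrier_A_E)
    obtain t where t: "t \<in> polys P" "z = \<pi> t" using z by (rule carrier_A_E)
    have "r * s \<in> polys P" "s * t \<in> polys P" using r s t by (simp_all add: polys_mult)
    then show "x \<otimes>\<^bsub>A\<^esub> y \<otimes>\<^bsub>A\<^esub> z = x \<otimes>\<^bsub>A\<^esub> (y \<otimes>\<^bsub>A\<^esub> z)"
      by (simp only: r s t \<pi>_mult mult.assoc)
  next
    fix x y assume x: "x \<in> carrier A" and y: "y \<in> carrier A"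
    obtain r where r: "r \<in> polys P" "x = \<pi> r" using x by (rule carrier_A_E)
    obtain s where s: "s \<in> polys P" "y = \<pi> s" using y by (rule carrier_A_E)
    show "x \<otimes>\<^bsub>A\<^esub> y \<in> carrier A" using \<pi>_in[OF polys_mult[OF r(1) s(1)]] by (simp only: r s \<pi>_mult)
    show "x \<otimes>\<^bsub>A\<^esub> y = y \<otimes>\<^bsub>A\<^esub> x" unfolding r s \<pi>_mult[OF r(1) s(1)] \<pi>_mult[OF s(1) r(1)] by (simp only: mult.commute)
  next
    show "\<one>\<^bsub>A\<^esub> \<in> carrier A" unfolding \<pi>_one by (rule \<pi>_in) simp
    fix x assume "x \<in> carrier A"
    then obtain r where r: "r \<in> polys P" "x = \<pi> r" by (rule carrier_A_E)
    show "\<one>\<^bsub>A\<^esub> \<otimes>\<^bsub>A\<^esub> x = x" by (simp only: r \<pi>_one \<pi>_mult polys_one mult_1)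
  qed
  fix x y z assume x: "x \<in> carrier A" and y: "y \<in> carrier A" and z: "z \<in> carrier A"
  obtain r where r: "r \<in> polys P" "x = \<pi> r" using x by (rule carrier_A_E)
  obtain s where s: "s \<in> polys P" "y = \<pi> s" using y by (rule carrier_A_E)
  obtain t where t: "t \<in> polys P" "z = \<pi> t" using z by (rule carrier_A_E)
  have "r + s \<in> polys P" "r * t \<in> polys P" "s * t \<in> polys P" using r s t by (simp_all add: polys_mult)
  then show "(x \<oplus>\<^bsub>A\<^esub> y) \<otimes>\<^bsub>A\<^esub> z = x \<otimes>\<^bsub>A\<^esub> z \<oplus>\<^bsub>A\<^esub> y \<otimes>\<^bsub>A\<^esub> z"
    by (simp only: r s t \<pi>_add \<pi>_mult distrib_right)
qed

sublocale A: cring A by (rule cring_A)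

lemma a_inv_\<pi>: "r \<in> polys P \<Longrightarrow> \<ominus>\<^bsub>A\<^esub> \<pi> r = \<pi> (- r)"
  using A.minus_equality[of "\<pi> (- r)" "\<pi> r"] by (simp add: \<pi>_in \<pi>_add \<pi>_zero)

lemma ideal_image:
  assumes "poly_ideal P Q" shows "ideal (\<pi> ` Q) A"
proof -
  note Q = poly_idealD[OF assms] poly_ideal_uminus[OF assms]
  show ?thesis
  proof (rule idealI[OF A.ring_axioms])
    show "subgroup (\<pi> ` Q) (add_monoid A)"
    proof (rule group.subgroupI[OF A.a_group])
      show "\<pi> ` Q \<noteq> {}" using Q(2) by blast
      show "\<pi> ` Q \<subseteq> carrier (add_monoid A)" using Q(1) \<pi>_in by auto
      show "inv\<^bsub>add_monoid A\<^esub> x \<in> \<pi> ` Q" if x: "x \<in> \<pi> ` Q" for x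
      proof -
        obtain r where r: "r \<in> Q" "x = \<pi> r" using x by (rule imageE)
        have "inv\<^bsub>add_monoid A\<^esub> x = \<pi> (- r)" using a_inv_\<pi>[OF Q(1)[OF r(1)]] by (simp only: r a_inv_def)
        then show ?thesis by (rule image_eqI) (rule Q(5)[OF r(1)])
      qed
      show "x \<otimes>\<^bsub>add_monoid A\<^esub> y \<in> \<pi> ` Q" if x: "x \<in> \<pi> ` Q" and y: "y \<in> \<pi> ` Q" for x y
      proof -
        obtain r where r: "r \<in> Q" "x = \<pi> r" using x by (rule imageE)
        obtain s where s: "s \<in> Q" "y = \<pi> s" using y by (rule imageE)
        have "x \<otimes>\<^bsub>add_monoid A\<^esub> y = \<pi> (r + s)"
          using \<pi>_add[OF Q(1)[OF r(1)] Q(1)[OF s(1)]] by (simp only: r s monoid.simps)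
        then show ?thesis by (rule image_eqI) (rule Q(3)[OF r(1) s(1)])
      qed
    qed
    show mem: "x \<otimes>\<^bsub>A\<^esub> y \<in> \<pi> ` Q" if y: "y \<in> \<pi> ` Q" and x: "x \<in> carrier A" for x y
    proof -
      obtain r where r: "r \<in> polys P" "x = \<pi> r" using x by (rule carrier_A_E)
      obtain s where s: "s \<in> Q" "y = \<pi> s" using y by (rule imageE)
      have "x \<otimes>\<^bsub>A\<^esub> y = \<pi> (r * s)" using \<pi>_mult[OF r(1) Q(1)[OF s(1)]] by (simp only: r s)
      then show ?thesis by (rule image_eqI) (rule Q(4)[OF r(1) s(1)])
    qed
    show "y \<otimes>\<^bsub>A\<^esub> x \<in> \<pi> ` Q" if y: "y \<in> \<pi> ` Q" and x: "x \<in> carrier A" for x y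
    proof -
      have "y \<in> carrier A" using y Q(1) \<pi>_in by auto
      then show ?thesis using mem[OF y x] A.m_comm[OF x] by simp
    qed
  qed
qed

definition preimage :: "('p, 'k) mpoly set set \<Rightarrow> ('p, 'k) mpoly set" where
  "preimage S = {r \<in> polys P. \<pi> r \<in> Idl\<^bsub>A\<^esub> S}"

lemma preimage_poly_ideal:
  assumes "S \<subseteq> carrier A" shows "poly_ideal P (preimage S)"
proof -
  interpret I: ideal "Idl\<^bsub>A\<^esub> S" A by (rule A.genideal_ideal[OF assms])
  show ?thesis
    unfolding poly_ideal_def preimage_def
  proof (intro conjI ballI)
    show "0 \<in> {r \<in> polys P. \<pi> r \<in> Idl\<^bsub>A\<^esub> S}" using I.zero_closed by (simp add: \<pi>_zero)
    fix f assume "f \<in> {r \<in> polys P. \<pi> r \<in> Idl\<^bsub>A\<^esub> S}"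
    then have f: "f \<in> polys P" "\<pi> f \<in> Idl\<^bsub>A\<^esub> S" by simp_all
    show "f + g \<in> {r \<in> polys P. \<pi> r \<in> Idl\<^bsub>A\<^esub> S}" if "g \<in> {r \<in> polys P. \<pi> r \<in> Idl\<^bsub>A\<^esub> S}" for g
    proof -
      have g: "g \<in> polys P" "\<pi> g \<in> Idl\<^bsub>A\<^esub> S" using that by simp_all
      have "\<pi> (f + g) \<in> Idl\<^bsub>A\<^esub> S" using I.a_closed[OF f(2) g(2)] by (simp only: \<pi>_add f g)
      then show ?thesis using f g by simp
    qed
  next
    fix r f :: "('p, 'k) mpoly" assume r: "r \<in> polys P" and "f \<in> {r \<in> polys P. \<pi> r \<in> Idl\<^bsub>A\<^esub> S}"
    then have f: "f \<in> polys P" "\<pi> f \<in> Idl\<^bsub>A\<^esub> S" by simp_all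
    have "\<pi> (r * f) \<in> Idl\<^bsub>A\<^esub> S" using I.I_l_closed[OF f(2) \<pi>_in[OF r]] by (simp only: \<pi>_mult f r)
    then show "r * f \<in> {r \<in> polys P. \<pi> r \<in> Idl\<^bsub>A\<^esub> S}" using polys_mult[OF r f(1)] by simp
  qed simp
qed

lemma preimage_least:
  assumes Q: "poly_ideal P Q" "J \<subseteq> Q" and S: "S \<subseteq> \<pi> ` Q" shows "preimage S \<subseteq> Q"
proof
  fix r assume "r \<in> preimage S"
  then have r: "r \<in> polys P" "\<pi> r \<in> Idl\<^bsub>A\<^esub> S" by (simp_all add: preimage_def)
  have "\<pi> r \<in> \<pi> ` Q" by (rule subsetD[OF A.genideal_minimal[OF ideal_image[OF Q(1)] S] r(2)])
  then obtain q where q: "q \<in> Q" "\<pi> r = \<pi> q" by (rule imageE) 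
  then have "r - q \<in> J" using \<pi>_eq[OF r(1) poly_idealD(1)[OF Q(1) q(1)]] by simp
  then have "r - q \<in> Q" using Q(2) by (rule rev_subsetD)
  from poly_idealD(3)[OF Q(1) this q(1)] show "r \<in> Q" by simp
qed

lemma preimage_superset:
  assumes S: "S \<subseteq> carrier A" shows "J \<subseteq> preimage S"
proof
  fix r assume r: "r \<in> J"
  have rP: "r \<in> polys P" by (rule poly_idealD(1)[OF J r])
  have "\<pi> r = \<zero>\<^bsub>A\<^esub>" unfolding \<pi>_zero using \<pi>_eq[OF rP polys_zero] r by simp
  then show "r \<in> preimage S"
    using additive_subgroup.zero_closed[OF ideal.axioms(1)[OF A.genideal_ideal[OF S]]] rP
    by (simp add: preimage_def)
qed

lemma preimage_mem: "S \<subseteq> carrier A \<Longrightarrow> a \<in> polys P \<Longrightarrow> \<pi> a \<in> S \<Longrightarrow> a \<in> preimage S"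
  unfolding preimage_def using subsetD[OF A.genideal_self] by simp

lemma preimage_empty: "preimage {} = J"
  using preimage_least[OF J, of "{}"] preimage_superset[of "{}"] by auto

text \<open>The right-hand side describes an ideal that contains the new generator and the old ideal.\<close>

lemma preimage_insert:
  assumes S: "S \<subseteq> carrier A" and a: "a \<in> polys P" and r: "r \<in> preimage (insert (\<pi> a) S)"
  shows "\<exists>s\<in>polys P. r - a * s \<in> preimage S"
proof -
  define Q where "Q = {r \<in> polys P. \<exists>s\<in>polys P. r - a * s \<in> preimage S}"
  note pI = preimage_poly_ideal[OF S]
  note p = poly_idealD[OF pI]
  have "preimage (insert (\<pi> a) S) \<subseteq> Q"
  proof (rule preimage_least)
    show Q: "poly_ideal P Q"
      unfolding poly_ideal_def
    proof (intro conjI ballI)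
      show "0 \<in> Q" unfolding Q_def using p(2) by (auto intro!: bexI[of _ 0])
      fix f assume "f \<in> Q"
      then obtain s where s: "f \<in> polys P" "s \<in> polys P" "f - a * s \<in> preimage S" by (auto simp: Q_def)
      show "f + g \<in> Q" if gQ: "g \<in> Q" for g
      proof -
        obtain t where t: "g \<in> polys P" "t \<in> polys P" "g - a * t \<in> preimage S" using gQ by (auto simp: Q_def)
        have "(f + g) - a * (s + t) = (f - a * s) + (g - a * t)" by (simp add: algebra_simps)
        then have "(f + g) - a * (s + t) \<in> preimage S" using p(3)[OF s(3) t(3)] by (simp only:)
        then show ?thesis unfolding Q_def using polys_add[OF s(1) t(1)] polys_add[OF s(2) t(2)] by blast
      qed
    next
      fix q f :: "('p, 'k) mpoly" assume q: "q \<in> polys P" and "f \<in> Q"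
      then obtain s where s: "f \<in> polys P" "s \<in> polys P" "f - a * s \<in> preimage S" by (auto simp: Q_def)
      have "q * f - a * (q * s) = q * (f - a * s)" by (simp add: algebra_simps)
      then have "q * f - a * (q * s) \<in> preimage S" using p(4)[OF q s(3)] by (simp only:)
      then show "q * f \<in> Q" unfolding Q_def using polys_mult[OF q s(1)] polys_mult[OF q s(2)] by blast
    qed (simp add: Q_def subset_iff)
    have sub: "preimage S \<subseteq> Q"
    proof
      fix f assume f: "f \<in> preimage S"
      then show "f \<in> Q" unfolding Q_def using p(1)[OF f] by (auto intro!: bexI[of _ 0])
    qed
    show "J \<subseteq> Q" using preimage_superset[OF S] sub by (rule order_trans)
    show "insert (\<pi> a) S \<subseteq> \<pi> ` Q"
    proof (rule insert_subsetI)
      have "a \<in> Q" unfolding Q_def using p(2) a by (auto intro!: bexI[of _ 1])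
      then show "\<pi> a \<in> \<pi> ` Q" by (rule imageI)
      show "S \<subseteq> \<pi> ` Q"
      proof
        fix x assume x: "x \<in> S"
        then have "x \<in> carrier A" using S by (rule rev_subsetD)
        then obtain f where f: "f \<in> polys P" "x = \<pi> f" by (rule carrier_A_E)
        have "f \<in> preimage S" by (rule preimage_mem[OF S f(1)]) (use x f in simp)
        then have "f \<in> Q" using sub by (rule rev_subsetD)
        then show "x \<in> \<pi> ` Q" unfolding f(2) by (rule imageI)
      qed
    qed
  qed
  then have "r \<in> Q" using r by (rule subsetD)
  then show ?thesis by (simp add: Q_def)
qed

lemma hcomp_A: "hcomp A j = \<pi> ` hR P j"
  by (rule Q.hcomp_quot)

end

section \<open>Regular elements shift Koszul homology\<close>

context koszul_sign begin

definition koszul_homology_nonzero :: "('p, 'k) mpoly set \<Rightarrow> nat \<Rightarrow> bool" where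
  "koszul_homology_nonzero Q i \<longleftrightarrow>
     (\<exists>z\<in>kchains i. (\<forall>S. kbd z S \<in> Q) \<and> \<not> (\<exists>w\<in>kchains (Suc i). \<forall>S. (z - kbd w) S \<in> Q))"

text \<open>Multiplication by \<open>a\<close> is null-homotopic on the Koszul complex, with homotopy \<open>s\<close>. For a cycle \<open>z\<close> modulo \<open>Q\<close> the
boundary of \<open>s z\<close> is \<open>a z\<close> modulo \<open>Q\<close>, so \<open>s z\<close> is a cycle modulo \<open>Q' = Q + (a)\<close>. This is a section of the connecting map:
if \<open>s z\<close> were \<open>kbd u + q + a t\<close> with \<open>q\<close> in \<open>Q\<close>, then \<open>a (z - kbd t)\<close> would lie in \<open>Q\<close>, and cancelling \<open>a\<close> would make
\<open>z\<close> a boundary.\<close>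

lemma koszul_homology_shift:
  assumes Q: "poly_ideal P Q" and Q': "poly_ideal P Q'" and sub: "Q \<subseteq> Q'"
    and a: "a \<in> polys P" "coef a 0 = 0" "a \<in> Q'"
    and regular: "\<And>r. r \<in> polys P \<Longrightarrow> a * r \<in> Q \<Longrightarrow> r \<in> Q"
    and gen: "\<And>r. r \<in> Q' \<Longrightarrow> \<exists>s\<in>polys P. r - a * s \<in> Q"
    and nz: "koszul_homology_nonzero Q (Suc k)"
  shows "koszul_homology_nonzero Q' (Suc (Suc k))"
proof -
  obtain z where z: "z \<in> kchains (Suc k)" "\<And>S. kbd z S \<in> Q"
    and nb: "\<And>w. w \<in> kchains (Suc (Suc k)) \<Longrightarrow> \<not> (\<forall>S. (z - kbd w) S \<in> Q)"
    using nz unfolding koszul_homology_nonzero_def by blast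
  have lin_a: "lin P (ksets i) (ksets i) (scl a)" for i
    unfolding lin_def by (auto intro!: free_mod_scl a(1) simp: scl_add fun_eq_iff mult.left_commute)
  have comm: "scl a (kbd x) = kbd (scl a x)" if "x \<in> free_mod P (ksets (Suc i))" for x and i
    using lin_scl[OF lin_kbd a(1) that] by (rule sym)
  have aug: "kaug (scl a x) = 0" for x by (simp add: coef_mult_zero a(2))
  have "\<exists>s. (\<forall>i. lin P (ksets i) (ksets (Suc i)) (s i)) \<and>
      (\<forall>i. \<forall>x\<in>free_mod P (ksets (Suc i)). scl a x = kbd (s (Suc i) x) + s i (kbd x))"
    by (rule null_homotopic[OF koszul_resolution lin_a comm aug])
  then obtain s where sh: "(\<forall>i. lin P (ksets i) (ksets (Suc i)) (s i)) \<and>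
      (\<forall>i. \<forall>x\<in>free_mod P (ksets (Suc i)). scl a x = kbd (s (Suc i) x) + s i (kbd x))" ..
  have s: "lin P (ksets i) (ksets (Suc i)) (s i)" for i by (rule spec[OF conjunct1[OF sh]])
  have hom: "scl a x = kbd (s (Suc i) x) + s i (kbd x)" if "x \<in> free_mod P (ksets (Suc i))" for i x
    by (rule bspec[OF spec[OF conjunct2[OF sh]] that])
  have zf: "z \<in> free_mod P (ksets (Suc k))" using z(1) by (simp only: kchains_free)
  have dz: "kbd z \<in> free_mod P (ksets k)" by (rule lin_closed[OF lin_kbd zf])
  define w where "w = s (Suc k) z"
  have w: "w \<in> free_mod P (ksets (Suc (Suc k)))" unfolding w_def by (rule lin_closed[OF s zf])
  have rest: "s k (kbd z) S \<in> Q" for S by (rule lin_preserves_ideal[OF Q s dz z(2)])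
  have az: "a * z S = kbd w S + s k (kbd z) S" for S
    using fun_cong[OF hom[OF zf], of S] by (simp add: w_def)
  have cyc: "kbd w S \<in> Q'" for S
  proof -
    have zS: "z S \<in> polys P" by (rule free_modD(1)[OF zf])
    have "kbd w S = z S * a - s k (kbd z) S" using az[of S] by (simp add: mult.commute)
    moreover have "z S * a \<in> Q'" by (rule poly_idealD(4)[OF Q' zS a(3)])
    moreover have "s k (kbd z) S \<in> Q'" using sub rest by (rule subsetD)
    ultimately show ?thesis using poly_ideal_diff[OF Q'] by simp
  qed
  have "\<not> (\<forall>S. (w - kbd u) S \<in> Q')" if u: "u \<in> kchains (Suc (Suc (Suc k)))" for u
  proof
    assume h: "\<forall>S. (w - kbd u) S \<in> Q'"
    have uf: "u \<in> free_mod P (ksets (Suc (Suc (Suc k))))" using u by (simp only: kchains_free)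
    have du: "kbd u \<in> free_mod P (ksets (Suc (Suc k)))" by (rule lin_closed[OF lin_kbd uf])
    \<comment> \<open>The entries of \<open>q'\<close> are split as \<open>q + a t\<close>, keeping \<open>t\<close> zero off the basis so that it is again a chain.\<close>
    define q' where "q' = w - kbd u"
    have q': "q' \<in> free_mod P (ksets (Suc (Suc k)))" unfolding q'_def by (rule free_mod_diff[OF w du])
    have "\<forall>S. \<exists>t. t \<in> polys P \<and> q' S - a * t \<in> Q \<and> (S \<notin> ksets (Suc (Suc k)) \<longrightarrow> t = 0)"
    proof
      fix S
      show "\<exists>t. t \<in> polys P \<and> q' S - a * t \<in> Q \<and> (S \<notin> ksets (Suc (Suc k)) \<longrightarrow> t = 0)"
      proof (cases "S \<in> ksets (Suc (Suc k))")
        case True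
        have "q' S \<in> Q'" using h by (simp only: q'_def)
        then obtain t where "t \<in> polys P" "q' S - a * t \<in> Q" using gen by blast
        then show ?thesis using True by blast
      next
        case False
        then have "q' S = 0" by (rule free_modD(3)[OF q'])
        then show ?thesis using poly_idealD(2)[OF Q] by (intro exI[of _ 0]) simp
      qed
    qed
    then obtain t where t: "\<And>S. t S \<in> polys P" "\<And>S. q' S - a * t S \<in> Q" "\<And>S. S \<notin> ksets (Suc (Suc k)) \<Longrightarrow> t S = 0"
      by metis
    have tf: "t \<in> kchains (Suc (Suc k))" using t(1,3) by (auto simp: kchains_def ksets_def)
    then have tf': "t \<in> free_mod P (ksets (Suc (Suc k)))" by (simp only: kchains_free)
    have qf: "q' - scl a t \<in> free_mod P (ksets (Suc (Suc k)))"
      by (rule free_mod_diff[OF q' free_mod_scl[OF a(1) tf']])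
    have dq: "kbd (q' - scl a t) S \<in> Q" for S
      by (rule lin_preserves_ideal[OF Q lin_kbd qf]) (use t(2) in simp)
    have dq': "kbd q' = kbd w"
      unfolding q'_def lin_diff[OF lin_kbd w du] kbd_kbd[OF u] by simp
    have "kbd (q' - scl a t) = kbd w - scl a (kbd t)"
      unfolding lin_diff[OF lin_kbd q' free_mod_scl[OF a(1) tf']] dq' lin_scl[OF lin_kbd a(1) tf'] ..
    then have e: "kbd (q' - scl a t) S = kbd w S - a * kbd t S" for S by simp
    have "\<forall>S. (z - kbd t) S \<in> Q"
    proof
      fix S
      have "kbd t S \<in> polys P" by (rule free_modD(1)[OF lin_closed[OF lin_kbd tf']])
      then have p: "(z - kbd t) S \<in> polys P" using free_modD(1)[OF zf, of S] by simp
      have "a * (z - kbd t) S = kbd (q' - scl a t) S + s k (kbd z) S"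
        by (simp add: e right_diff_distrib az)
      then have "a * (z - kbd t) S \<in> Q" using poly_idealD(3)[OF Q dq rest] by simp
      then show "(z - kbd t) S \<in> Q" by (rule regular[OF p])
    qed
    then show False using nb[OF tf] by blast
  qed
  then show ?thesis unfolding koszul_homology_nonzero_def using w cyc by (auto simp: kchains_free)
qed

lemma koszul_homology_bound:
  assumes Q: "poly_ideal P Q" and nz: "koszul_homology_nonzero Q i"
  shows "i \<le> card P"
proof (rule ccontr)
  assume i: "\<not> i \<le> card P"
  obtain z where z: "z \<in> kchains i" and nb: "\<And>w. w \<in> kchains (Suc i) \<Longrightarrow> \<not> (\<forall>S. (z - kbd w) S \<in> Q)"
    using nz unfolding koszul_homology_nonzero_def by blast
  have "z S = 0" for S
  proof -
    have "\<not> (S \<subseteq> P \<and> card S = i)" using i card_mono[OF finite_P, of S] by auto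
    then show ?thesis using z by (simp add: kchains_def)
  qed
  moreover have "kbd 0 S = 0" for S by (simp add: kbd_def)
  ultimately have "\<forall>S. (z - kbd 0) S \<in> Q" using poly_idealD(2)[OF Q] by simp
  then show False using nb[OF kchains_zero] by blast
qed

end

section \<open>Depth\<close>

context finite_linear_space begin

lemma incidence_complex_simplex_iff: "incidence_complex L = Pow P \<longleftrightarrow> P \<in> L"
proof
  assume "incidence_complex L = Pow P"
  then have "P \<in> \<Lambda>" by (simp add: \<Lambda>_def)
  then obtain l where "l \<in> L" "P \<subseteq> l" by (auto simp: face_iff)
  then show "P \<in> L" using line_sub[of l] by (simp add: subset_antisym)
next
  assume "P \<in> L"
  then show "incidence_complex L = Pow P" using line_sub by (auto simp: incidence_complex_def)
qed

lemma other_point: "p \<in> P \<Longrightarrow> \<exists>a\<in>P. a \<noteq> p"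
proof (rule ccontr)
  assume p: "p \<in> P" and "\<not> (\<exists>a\<in>P. a \<noteq> p)"
  then have "P \<subseteq> {p}" by blast
  then have "card P \<le> 1" using card_mono[of "{p}" P] by simp
  then show False using card_P by simp
qed

lemma two_points_on_line:
  assumes "l \<in> L" shows "\<exists>a b. a \<in> l \<and> b \<in> l \<and> a \<noteq> b"
  using card_line[OF assms] by (metis card_le_Suc0_iff_eq card.infinite not_less_eq_eq numeral_2_eq_2 zero_le)

lemma simplex_iff_one_line: "incidence_complex L = Pow P \<longleftrightarrow> card L = 1"
  unfolding incidence_complex_simplex_iff
proof
  assume PL: "P \<in> L"
  have "l = P" if l: "l \<in> L" for l
  proof -
    obtain a b where ab: "a \<in> l" "b \<in> l" "a \<noteq> b" using two_points_on_line[OF l] by blast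
    then have "a \<in> P" "b \<in> P" using line_sub[OF l] by auto
    then show ?thesis using line_unique[OF l PL] ab by blast
  qed
  then have "L = {P}" using PL by blast
  then show "card L = 1" by simp
next
  assume "card L = 1"
  then obtain l where l: "L = {l}" by (auto simp: card_1_singleton_iff)
  have "p \<in> l" if "p \<in> P" for p
    using other_point[OF that] line_exists[OF that] l by auto
  then have "P = l" using line_sub[of l] l by auto
  then show "P \<in> L" using l by simp
qed

text \<open>If one line through \<open>p\<close> is not everything, a point outside it and a second point on it span a line that avoids \<open>p\<close>.\<close>

lemma line_missing_point:
  assumes p: "p \<in> P" and ns: "incidence_complex L \<noteq> Pow P"
  shows "\<exists>l\<in>L. p \<notin> l"
proof -
  obtain a where a: "a \<in> P" "a \<noteq> p" using other_point[OF p] by blast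
  obtain l where l: "l \<in> L" "p \<in> l" "a \<in> l" using line_exists[OF p a(1)] a(2) by blast
  have "l \<noteq> P" using ns l(1) by (auto simp: incidence_complex_simplex_iff)
  then obtain b where b: "b \<in> P" "b \<notin> l" using line_sub[OF l(1)] by blast
  have "a \<noteq> b" using b l by blast
  then obtain l' where l': "l' \<in> L" "a \<in> l'" "b \<in> l'" using line_exists[OF a(1) b(1)] by blast
  have "p \<notin> l'"
  proof
    assume "p \<in> l'"
    then have "l' = l" using line_unique[OF l'(1) l(1), of a p] l' l a by blast
    then show False using l' b by simp
  qed
  then show ?thesis using l'(1) by blast
qed

end

context koszul_linear_space begin

lemma nonface_poly_quotient: "poly_quotient P I\<Lambda>"
  by (rule poly_quotient.intro[OF nonface_poly_ideal])

lemma three_points: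
  assumes "incidence_complex L \<noteq> Pow P" shows "card P \<ge> 3"
proof -
  obtain p where p: "p \<in> P" using card_P by fastforce
  obtain l where l: "l \<in> L" "p \<notin> l" using line_missing_point[OF p assms] by blast
  have "card (insert p l) \<le> card P" by (rule card_mono[OF finite_points]) (use p line_sub[OF l(1)] in blast)
  then show ?thesis using card_line[OF l(1)] l finite_line[OF l(1)] by simp
qed

text \<open>The whole point set \<open>W = P\<close> carries a loop because some line misses \<open>pt P\<close>.\<close>

lemma koszul_homology_incidence:
  assumes ns: "incidence_complex L \<noteq> Pow P"
  shows "koszul_homology_nonzero I\<Lambda> (card P - 2)"
proof -
  obtain p where "p \<in> P" using card_P by fastforce
  then have "pt P \<in> P" by (rule pt_in)
  then obtain l where l: "l \<in> L" "pt P \<notin> l" using line_missing_point ns by blast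
  obtain q where q: "q \<in> l" "q \<noteq> pt (l \<inter> P)" using two_points_on_line[OF l(1)] by blast
  define x where "x = (P, l, q)"
  have x: "x \<in> cycle_index (card P - 2)"
    using l q line_sub[OF l(1)] card_P by (auto simp: x_def cycle_index_def)
  have i: "card P - 2 \<ge> 1" using three_points[OF ns] by simp
  have z: "basic_cycle (card P - 2) x \<in> kchains (card P - 2)" by (rule basic_cycle_kchains[OF x])
  have cyc: "kbd (basic_cycle (card P - 2) x) S \<in> I\<Lambda>" for S
    using basic_cycle_cycles_mod[OF i x] by (simp add: cycles_mod_def)
  have "\<not> (\<forall>S. (basic_cycle (card P - 2) x - kbd w) S \<in> I\<Lambda>)" for w
    using boundary_coord_zero[OF z _ x, of w] coord_basic_cycle[OF x x] by blast
  then show ?thesis unfolding koszul_homology_nonzero_def using z cyc by blast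
qed

text \<open>Koszul homology is nonzero in degree \<open>card P - 2\<close> to begin with, every entry of the sequence moves it up by one, and it
stops at \<open>card P\<close>. Homogeneity enters through the constant term: a homogeneous entry that has one is a unit.\<close>

lemma regular_sequence_length:
  assumes ns: "incidence_complex L \<noteq> Pow P"
    and reg: "regular_sequence (quot_gmodule (mpoly_ring P) I\<Lambda>) xs"
    and hom: "\<forall>x\<in>set xs. \<exists>j. x \<in> hcomp (quot_gmodule (mpoly_ring P) I\<Lambda>) j"
  shows "length xs \<le> 2"
proof -
  interpret Q: poly_quotient P I\<Lambda> by (rule nonface_poly_quotient)
  have xs: "set xs \<subseteq> carrier Q.A" and proper: "Idl\<^bsub>Q.A\<^esub> (set xs) \<noteq> carrier Q.A"
    and nzd: "\<And>i y. i < length xs \<Longrightarrow> y \<in> carrier Q.A \<Longrightarrow>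
       xs ! i \<otimes>\<^bsub>Q.A\<^esub> y \<in> Idl\<^bsub>Q.A\<^esub> (set (take i xs)) \<Longrightarrow> y \<in> Idl\<^bsub>Q.A\<^esub> (set (take i xs))"
    using reg unfolding regular_sequence_def by blast+
  have tk: "set (take k xs) \<subseteq> carrier Q.A" for k using set_take_subset[of k xs] xs by blast
  define pre where "pre k = Q.preimage (set (take k xs))" for k
  have pI: "poly_ideal P (pre k)" for k unfolding pre_def by (rule Q.preimage_poly_ideal[OF tk])
  have "koszul_homology_nonzero (pre k) (card P - 2 + k)" if "k \<le> length xs" for k
    using that
  proof (induction k)
    case 0
    show ?case using koszul_homology_incidence[OF ns] by (simp add: pre_def Q.preimage_empty)
  next
    case (Suc k)
    then have k: "k < length xs" by simp
    have step: "set (take (Suc k) xs) = insert (xs ! k) (set (take k xs))"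
      using k by (simp add: take_Suc_conv_app_nth)
    obtain j where "xs ! k \<in> hcomp Q.A j" using hom nth_mem[OF k] by blast
    then obtain a where aj: "a \<in> hR P j" and xk: "xs ! k = Q.\<pi> a" unfolding Q.hcomp_A by (rule imageE) 
    have a: "a \<in> polys P" by (rule hR_polys[OF aj])
    have a0: "coef a 0 = 0"
    proof (rule ccontr)
      assume c: "coef a 0 \<noteq> 0"
      have "tdeg (0 :: 'p \<Rightarrow>\<^sub>0 nat) = 0" by (simp add: tdeg_def)
      then have "j = 0" using aj c unfolding hR_iff by fastforce
      have other: "coef a m = 0" if "m \<noteq> 0" for m
      proof (rule ccontr)
        assume "coef a m \<noteq> 0"
        then have "tdeg m = 0" using aj \<open>j = 0\<close> by (auto simp: hR_iff)
        then have "m = 0" by (intro poly_mapping_eqI) (auto simp: tdeg_def in_keys_iff)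
        then show False using that by simp
      qed
      have "monom_mp 0 (inverse (coef a 0)) * a = 1"
      proof (rule poly_mapping_eqI)
        fix m show "coef (monom_mp 0 (inverse (coef a 0)) * a) m = coef 1 m"
          unfolding coef_const_mult using c other[of m] by (cases "m = 0") (simp_all add: lookup_one)
      qed
      moreover have "a \<in> Q.preimage (set xs)"
        by (rule Q.preimage_mem[OF xs a]) (use nth_mem[OF k] xk in simp)
      moreover have "monom_mp 0 (inverse (coef a 0)) \<in> polys P" by (rule polys_monom) simp
      ultimately have "1 \<in> Q.preimage (set xs)"
        using poly_idealD(4)[OF Q.preimage_poly_ideal[OF xs]] by metis
      then have "\<one>\<^bsub>Q.A\<^esub> \<in> Idl\<^bsub>Q.A\<^esub> (set xs)" by (simp add: Q.preimage_def Q.\<pi>_one)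
      then have "Idl\<^bsub>Q.A\<^esub> (set xs) = carrier Q.A"
        by (rule ideal.one_imp_carrier[OF Q.A.genideal_ideal[OF xs]])
      then show False using proper by blast
    qed
    have shift: "koszul_homology_nonzero (pre (Suc k)) (Suc (Suc (card P - 3 + k)))"
    proof (rule koszul_homology_shift[OF pI[of k] pI[of "Suc k"] _ a a0])
      show "pre k \<subseteq> pre (Suc k)"
        unfolding pre_def Q.preimage_def step genideal_def by auto
      show "a \<in> pre (Suc k)" unfolding pre_def by (rule Q.preimage_mem[OF tk a]) (simp add: step xk)
      show "r \<in> pre k" if r: "r \<in> polys P" and ar: "a * r \<in> pre k" for r
      proof -
        have "xs ! k \<otimes>\<^bsub>Q.A\<^esub> Q.\<pi> r \<in> Idl\<^bsub>Q.A\<^esub> (set (take k xs))"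
          using ar unfolding xk Q.\<pi>_mult[OF a r] by (simp add: pre_def Q.preimage_def)
        then have "Q.\<pi> r \<in> Idl\<^bsub>Q.A\<^esub> (set (take k xs))" by (rule nzd[OF k Q.\<pi>_in[OF r]])
        then show ?thesis using r by (simp add: pre_def Q.preimage_def)
      qed
      show "\<exists>s\<in>polys P. r - a * s \<in> pre k" if r: "r \<in> pre (Suc k)" for r
        using Q.preimage_insert[OF tk a, of r k] r unfolding pre_def step xk by blast
      have "card P - 2 + k = Suc (card P - 3 + k)" using three_points[OF ns] by simp
      then show "koszul_homology_nonzero (pre k) (Suc (card P - 3 + k))" using Suc by simp
    qed
    have "card P - 2 + Suc k = Suc (Suc (card P - 3 + k))" using three_points[OF ns] by simp
    then show ?case using shift by simp
  qed
  from koszul_homology_bound[OF pI this[OF order_refl]] show ?thesis using card_P by simp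
qed

text \<open>The two polynomials lie in the maximal ideal, so the ideal that they generate is proper.\<close>

lemma regular_sequence_e1_e2:
  fixes A defines "A \<equiv> quot_gmodule (mpoly_ring P) I\<Lambda>"
  shows "\<exists>xs. length xs = 2 \<and> regular_sequence A xs \<and> (\<forall>x\<in>set xs. \<exists>j. x \<in> hcomp A j)"
proof -
  interpret Q: poly_quotient P I\<Lambda> by (rule nonface_poly_quotient)
  have h: "(e1 P :: ('p, 'k) mpoly) \<in> hR P 1" "(e2 P :: ('p, 'k) mpoly) \<in> hR P 2" using e1_hR[OF subset_refl] e2_hR[OF subset_refl finite_points] .
  have p: "(e1 P :: ('p, 'k) mpoly) \<in> polys P" "(e2 P :: ('p, 'k) mpoly) \<in> polys P" using hR_polys[OF h(1)] hR_polys[OF h(2)] .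
  note c = Q.\<pi>_in[OF p(1)] Q.\<pi>_in[OF p(2)]
  define xs where "xs = [Q.\<pi> (e1 P), Q.\<pi> (e2 P)]"
  have car: "set xs \<subseteq> carrier Q.A" using c by (simp add: xs_def)
  have mem: "Q.\<pi> r \<in> Idl\<^bsub>Q.A\<^esub> S \<longleftrightarrow> r \<in> Q.preimage S" if "r \<in> polys P" for r S
    using that by (simp add: Q.preimage_def)
  have first: "y \<in> Idl\<^bsub>Q.A\<^esub> {}" if y: "y \<in> carrier Q.A" "Q.\<pi> (e1 P) \<otimes>\<^bsub>Q.A\<^esub> y \<in> Idl\<^bsub>Q.A\<^esub> {}" for y
  proof -
    obtain r where r: "r \<in> polys P" "y = Q.\<pi> r" using y(1) by (rule Q.carrier_A_E)
    have "e1 P * r \<in> I\<Lambda>"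
      using y(2) mem[OF polys_mult[OF p(1) r(1)], of "{}"] by (simp only: r Q.\<pi>_mult[OF p(1) r(1)] Q.preimage_empty)
    then have "r \<in> I\<Lambda>" by (rule e1_regular[OF r(1)])
    then show ?thesis using mem[OF r(1), of "{}"] by (simp only: r(2) Q.preimage_empty)
  qed
  have second: "y \<in> Idl\<^bsub>Q.A\<^esub> {Q.\<pi> (e1 P)}"
    if y: "y \<in> carrier Q.A" "Q.\<pi> (e2 P) \<otimes>\<^bsub>Q.A\<^esub> y \<in> Idl\<^bsub>Q.A\<^esub> {Q.\<pi> (e1 P)}" for y
  proof -
    obtain r where r: "r \<in> polys P" "y = Q.\<pi> r" using y(1) by (rule Q.carrier_A_E)
    have S: "{Q.\<pi> (e1 P)} \<subseteq> carrier Q.A" using c by simp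
    have "e2 P * r \<in> Q.preimage (insert (Q.\<pi> (e1 P)) {})"
      using y(2) mem[OF polys_mult[OF p(2) r(1)], of "{Q.\<pi> (e1 P)}"] by (simp only: r Q.\<pi>_mult[OF p(2) r(1)])
    then obtain s where s: "s \<in> polys P" "e2 P * r - e1 P * s \<in> I\<Lambda>"
      using Q.preimage_insert[OF empty_subsetI p(1), of "e2 P * r"] unfolding Q.preimage_empty by blast
    obtain w where w: "w \<in> polys P" "r - e1 P * w \<in> I\<Lambda>" using e2_regular[OF r(1) s] by blast
    note pI = Q.preimage_poly_ideal[OF S]
    have 1: "r - e1 P * w \<in> Q.preimage {Q.\<pi> (e1 P)}" by (rule subsetD[OF Q.preimage_superset[OF S] w(2)])
    have "e1 P \<in> Q.preimage {Q.\<pi> (e1 P)}" by (rule Q.preimage_mem[OF S p(1)]) simp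
    then have 2: "w * e1 P \<in> Q.preimage {Q.\<pi> (e1 P)}" by (rule poly_idealD(4)[OF pI w(1)])
    from poly_idealD(3)[OF pI 1 2] have "r \<in> Q.preimage {Q.\<pi> (e1 P)}" by (simp add: mult.commute[of w])
    then show ?thesis using mem[OF r(1)] by (simp only: r(2))
  qed
  have "Q.\<pi> 1 \<notin> Idl\<^bsub>Q.A\<^esub> (set xs)"
  proof
    assume "Q.\<pi> 1 \<in> Idl\<^bsub>Q.A\<^esub> (set xs)"
    then have 1: "1 \<in> Q.preimage (set xs)" using mem[OF polys_one] by blast
    let ?m = "{f \<in> polys P. coef f 0 = 0} :: ('p, 'k) mpoly set"
    have m: "poly_ideal P ?m" by (auto simp: poly_ideal_def lookup_add coef_mult_zero)
    have "{} \<in> \<Lambda>" using lines_nonempty by (auto simp: face_iff)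
    then have JI: "I\<Lambda> \<subseteq> ?m" by (auto simp: nonface_ideal_polys intro!: nonface_idealD)
    have "coef f 0 = 0" if "f \<in> hR P j" "j \<noteq> 0" for f :: "('p, 'k) mpoly" and j
      using that by (auto simp: hR_iff tdeg_def)
    from this[OF h(1)] this[OF h(2)] have "e1 P \<in> ?m" "e2 P \<in> ?m" using p by simp_all
    then have "set xs \<subseteq> Q.\<pi> ` ?m" unfolding xs_def by (simp only: list.set insert_subset empty_subsetI imageI simp_thms)
    then have "Q.preimage (set xs) \<subseteq> ?m" by (rule Q.preimage_least[OF m JI])
    then have "1 \<in> ?m" using 1 by (rule subsetD)
    then show False by (simp add: lookup_one)
  qed
  moreover have "Q.\<pi> 1 \<in> carrier Q.A" by (rule Q.\<pi>_in) simp
  ultimately have proper: "Idl\<^bsub>Q.A\<^esub> (set xs) \<noteq> carrier Q.A" by blast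
  have "\<forall>i<length xs. \<forall>y\<in>carrier Q.A. xs ! i \<otimes>\<^bsub>Q.A\<^esub> y \<in> Idl\<^bsub>Q.A\<^esub> (set (take i xs)) \<longrightarrow>
      y \<in> Idl\<^bsub>Q.A\<^esub> (set (take i xs))"
  proof (intro allI impI ballI)
    fix i y assume i: "i < length xs" and y: "y \<in> carrier Q.A" "xs ! i \<otimes>\<^bsub>Q.A\<^esub> y \<in> Idl\<^bsub>Q.A\<^esub> (set (take i xs))"
    consider "i = 0" | "i = 1" using i by (fastforce simp: xs_def)
    then show "y \<in> Idl\<^bsub>Q.A\<^esub> (set (take i xs))"
    proof cases
      case 1 then show ?thesis using first[of y] y by (simp add: xs_def)
    next
      case 2 then show ?thesis using second[of y] y by (simp add: xs_def)
    qed
  qed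
  then have "regular_sequence Q.A xs" unfolding regular_sequence_def using car proper by blast
  moreover have "\<forall>x\<in>set xs. \<exists>j. x \<in> hcomp Q.A j"
    using imageI[OF h(1), of Q.\<pi>] imageI[OF h(2), of Q.\<pi>] unfolding Q.hcomp_A xs_def by auto
  moreover have "length xs = 2" by (simp add: xs_def)
  ultimately show ?thesis unfolding A_def by blast
qed

theorem depth_incidence_complex:
  assumes ns: "incidence_complex L \<noteq> Pow P"
  shows "depth (stanley_reisner_ring P (incidence_complex L) :: (('p, 'k) mpoly, ('p, 'k) mpoly set) gmodule) = 2"
proof -
  let ?A = "quot_gmodule (mpoly_ring P) I\<Lambda>"
  have A: "stanley_reisner_ring P (incidence_complex L) = ?A"
    by (simp add: stanley_reisner_ring_def stanley_reisner_ideal_eq)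
  let ?D = "{enat (length xs) | xs. regular_sequence ?A xs \<and> (\<forall>x\<in>set xs. \<exists>j. x \<in> hcomp ?A j)}"
  have "depth ?A = 2"
  proof (rule antisym)
    show "depth ?A \<le> 2"
      unfolding depth_def
    proof (rule Sup_least)
      fix n assume "n \<in> ?D"
      then obtain xs where "n = enat (length xs)" "regular_sequence ?A xs" "\<forall>x\<in>set xs. \<exists>j. x \<in> hcomp ?A j" by blast
      then show "n \<le> 2" using regular_sequence_length[OF ns] by (simp add: numeral_eq_enat)
    qed
    obtain xs where xs: "length xs = 2" "regular_sequence ?A xs" "\<forall>x\<in>set xs. \<exists>j. x \<in> hcomp ?A j"
      using regular_sequence_e1_e2 by blast
    then have "enat (length xs) \<in> ?D" by blast
    then have "enat (length xs) \<le> depth ?A" unfolding depth_def by (rule Sup_upper)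
    then show "2 \<le> depth ?A" by (simp add: xs(1) numeral_eq_enat)
  qed
  then show ?thesis by (simp only: A)
qed

end

theorem theorem2p9:
  fixes P :: "'p set" and L :: "'p set set"
    and K\<Lambda> :: "(('p, 'k::field) mpoly, ('p, 'k) mpoly set) gmodule"
  assumes "linear_space P L"
    and "card P \<ge> 2"
    and "K\<Lambda> = stanley_reisner_ring P (incidence_complex L)"
  shows
    "(\<forall>i\<ge>1.
        K_fin_dim (K_space (tor_K P K\<Lambda> i)) \<and>
        betti P K\<Lambda> i = graded_betti P K\<Lambda> i (int i + 2) \<and>
        int (betti P K\<Lambda> i) =
          (\<Sum>k = 1..card P. int ((card P - k) choose (i + 2)) * int (lines_of_size L k))
          - int (card P choose (i + 2)) * (- 1 + int (card L))
          + int ((card P - 1) choose (i + 1))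
              * (- int (card P) + (\<Sum>k = 2..card P. int k * int (lines_of_size L k)))
          - int ((card P - 2) choose i)
              * (- int (card P choose 2)
                 + (\<Sum>k = 2..card P. int (k choose 2) * int (lines_of_size L k))))
     \<and> (incidence_complex L = Pow P \<longleftrightarrow> card L = 1)
     \<and> (incidence_complex L \<noteq> Pow P \<longrightarrow> depth K\<Lambda> = 2)"
proof -
  have fin: "finite P" using assms(1) by (simp add: linear_space_def)
  obtain \<epsilon> :: "'p \<Rightarrow> 'p set \<Rightarrow> 'k" where "koszul_sign P \<epsilon>" using koszul_sign_exists[OF fin] by blast
  then interpret koszul_linear_space P \<epsilon> L
    by (intro koszul_linear_space.intro finite_linear_space.intro assms(1,2))
  have fin_dim: "K_fin_dim (K_space (tor_K P K\<Lambda> i))"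
    and linear: "betti P K\<Lambda> i = graded_betti P K\<Lambda> i (int i + 2)"
    and betti: "betti P K\<Lambda> i = card (cycle_index i)" if i: "i \<ge> 1" for i
  proof -
    note tor = tor_of_incidence_complex[OF i, folded assms(3)]
    show "K_fin_dim (K_space (tor_K P K\<Lambda> i))" by (rule tor(1))
    show "betti P K\<Lambda> i = card (cycle_index i)" unfolding betti_def by (rule tor(2))
    show "betti P K\<Lambda> i = graded_betti P K\<Lambda> i (int i + 2)"
      unfolding betti_def graded_betti_def tor(3) by (simp add: K_space_def)
  qed
  show ?thesis
  proof (intro conjI allI impI, goal_cases)
    case (1 i)
    then show ?case by (rule fin_dim)
  next
    case (2 i)
    then show ?case by (rule linear)
  next
    case (3 i)
    show ?case unfolding betti[OF 3] by (rule cycle_index_formula)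
  next
    case 4
    show ?case by (rule simplex_iff_one_line)
  next
    case 5
    then show ?case unfolding assms(3) by (rule depth_incidence_complex)
  qed
qed

end
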